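(* There exist positive constants $\epsilon_0$ and $c_3$ such that the following holds. Let $F:3\mathbb{D}\to\mathbb{R}$ be a not identically zero solution of $$\Delta F+qF=0\quad\text{in }3\mathbb{D},$$ with potential $q\in C^\infty(3\mathbb{D})$ real-valued and satisfying $\|q\|_\infty=\sup_{3\mathbb{D}}|q|<\epsilon_0$. Let $$\beta:=\log\frac{\sup_{\frac52\mathbb{D}}|F|}{\sup_{\frac14\mathbb{D}}|F|},\qquad \beta^*:=\max\{\beta,1\},$$ and let $Z_F=\{p\in3\mathbb{D}:F(p)=0\}$. Then $$\mathcal{H}^1\Big(Z_F\cap\tfrac1{60}\mathbb{D}\Big)\le c_3\,\beta^*.$$
   Context: $\mathbb{D}$ is the open unit disk in $\mathbb{R}^2$ and $r\mathbb{D}$ is the concentric disk of radius $r$. $\Delta$ is the flat Laplacian on $\mathbb{R}^2$. $\mathcal{H}^1$ is one-dimensional Hausdorff measure. The potential $q$ is not assumed to have constant sign. The constants $\epsilon_0,c_3$ do not depend on $F$ or $q$. *)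

theory Defs
  imports "HOL-Analysis.Analysis"
begin

definition partial_deriv :: "'a::euclidean_space \<Rightarrow> ('a \<Rightarrow> real) \<Rightarrow> 'a \<Rightarrow> real" where
  "partial_deriv b f x = deriv (\<lambda>t. f (x + t *\<^sub>R b)) 0"

text \<open>\<open>f\<close> has continuous partial derivatives of all orders up to \<open>k\<close> on \<open>S\<close>.
  For open \<open>S\<close> this is the usual class \<open>C\<^sup>k\<close>, and only the values of \<open>f\<close> on \<open>S\<close> matter.\<close>

primrec Ck_on :: "nat \<Rightarrow> ('a::euclidean_space \<Rightarrow> real) \<Rightarrow> 'a set \<Rightarrow> bool" where
  "Ck_on 0 f S \<longleftrightarrow> continuous_on S f"
| "Ck_on (Suc k) f S \<longleftrightarrow> continuous_on S f \<and>
     (\<forall>b\<in>Basis. (\<forall>x\<in>S. (\<lambda>t. f (x + t *\<^sub>R b)) differentiable (at 0)) \<and>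
                Ck_on k (partial_deriv b f) S)"

definition smooth_on :: "('a::euclidean_space \<Rightarrow> real) \<Rightarrow> 'a set \<Rightarrow> bool" where
  "smooth_on f S \<longleftrightarrow> (\<forall>k. Ck_on k f S)"

definition laplacian :: "('a::euclidean_space \<Rightarrow> real) \<Rightarrow> 'a \<Rightarrow> real" where
  "laplacian f x = (\<Sum>b\<in>Basis. partial_deriv b (partial_deriv b f) x)"

text \<open>Classical solutions of \<open>\<Delta>F + q F = 0\<close> on an open set.\<close>

definition schroedinger_solution ::
    "('a::euclidean_space \<Rightarrow> real) \<Rightarrow> ('a \<Rightarrow> real) \<Rightarrow> 'a set \<Rightarrow> bool" where
  "schroedinger_solution q F S \<longleftrightarrow>
     Ck_on 2 F S \<and> (\<forall>x\<in>S. laplacian F x + q x * F x = 0)"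

text \<open>One-dimensional Hausdorff measure, as an outer measure on all subsets, normalised so that
  it is arc length on a line. The covering sets are required to be bounded
  because \<open>diameter\<close> is a meaningless real number on unbounded sets.\<close>

definition hausdorff1_pre :: "real \<Rightarrow> 'a::metric_space set \<Rightarrow> ennreal" where
  "hausdorff1_pre \<delta> A =
     (INF C \<in> {C :: nat \<Rightarrow> 'a set. A \<subseteq> (\<Union>i. C i) \<and> (\<forall>i. bounded (C i) \<and> diameter (C i) \<le> \<delta>)}.
        \<Sum>i. ennreal (diameter (C i)))"

definition hausdorff1 :: "'a::metric_space set \<Rightarrow> ennreal" where
  "hausdorff1 A = (SUP \<delta>\<in>{0<..}. hausdorff1_pre \<delta> A)"

definition growth_exponent :: "(real^2 \<Rightarrow> real) \<Rightarrow> real" where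
  "growth_exponent F =
     ln ((SUP x\<in>ball 0 (5/2). \<bar>F x\<bar>) / (SUP x\<in>ball 0 (1/4). \<bar>F x\<bar>))"

end

theory Submission
  imports Defs "HOL-Complex_Analysis.Complex_Analysis"
begin

text \<open>
  Identify \<open>\<real>\<^sup>2\<close> with \<open>\<complex>\<close> and write \<open>P = \<partial>F/\<partial>z\<close>, so that the equation reads
  \<open>4 \<partial>P/\<partial>zbar = - q F\<close>. The right-hand side contains \<open>F\<close> and not \<open>P\<close>; this is repaired by a bounded
  solution \<open>l\<close> of the Riccati equation \<open>\<partial>l/\<partial>zbar = - q/4 - |l|\<^sup>2\<close>, which exists and is small when \<open>q\<close> is
  small, because the Cauchy transform turns it into a contracting fixed point problem. The function
  \<open>G = P - l F\<close> then satisfies \<open>\<partial>G/\<partial>zbar = - l cnj G\<close>, and the similarity principle of Bers and Vekua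
  gives \<open>G = exp s * H\<close> with \<open>H\<close> holomorphic and \<open>|s| \<le> 1/10\<close>
  (theorem \<open>similarity_representation\<close>). Where \<open>F = 0\<close>, the gradient of \<open>F\<close> is \<open>exp s * H\<close>, up to
  conjugation and a factor two. So the holomorphic function \<open>H\<close> gives the direction of \<open>\<nabla>F\<close> on the
  nodal set up to a small angle.

  The growth of \<open>H\<close> is controlled by the growth of \<open>F\<close>. Caccioppoli's inequality bounds \<open>|H|\<close> on the
  disc of radius 2 by the supremum of \<open>|F|\<close> on the disc of radius 5/2
  (\<open>representation_factor_bound\<close>); and if \<open>F\<close> has a zero in the disc of radius 1/60, integrating along
  segments from it shows that \<open>|F|\<close> on the disc of radius 1/4 is bounded by \<open>|H|\<close>
  (\<open>F_bound_by_factor\<close>). The logarithm of the ratio of the two suprema of \<open>|H|\<close> is therefore at most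
  \<open>\<beta>\<close> plus a constant. By Jensen's argument \<open>H\<close> has at most \<open>C \<beta>*\<close> zeros \<open>a\<close> near the small disc, and by
  the Borel-Caratheodory argument the logarithmic derivative of the remaining factor is at most
  \<open>C \<beta>*\<close>. Hence \<open>H\<close> is nearly constant on the disc about \<open>z\<close> of radius \<open>c / W z\<close>, where
  \<open>W z = (\<Sum>a. 1 / |z - a|) + C \<beta>*\<close> (\<open>doubling_controls_oscillation\<close>).

  On such a disc all gradients of \<open>F\<close> at zeros point into one narrow cone. Two zeros on a segment in a
  direction of this cone are impossible: \<open>F\<close> would cross zero upwards at both ends and at every zero
  between them. So the nodal set in the disc lies on a Lipschitz graph, and its length is at most a
  constant times the radius (\<open>zeros_lipschitz_graph\<close>). A Vitali covering by these discs reduces the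
  theorem to a bound for the sum of the radii of disjoint discs. As the radius is \<open>c / W\<close>, each radius
  is comparable to the integral of \<open>W\<close> over its disc, and the sum is at most a constant times
  \<open>\<integral> W\<close> over the unit disc. This integral is \<open>O(\<beta>*)\<close>, since \<open>1 / |z|\<close> is integrable in the plane
  (\<open>disjoint_radii_sum\<close>).

  The coefficient \<open>l\<close> and the exponent \<open>s\<close> are only constructed as limits. All differential equations
  are solved up to an error tending to zero by continuously differentiable functions, for which the
  Cauchy transform inverts \<open>\<partial>/\<partial>zbar\<close> in the classical sense, and \<open>H\<close> is obtained from Montel's theorem.
\<close>

section \<open>Wirtinger derivatives and cutoff functions\<close>

text \<open>
  The real derivative of \<open>f\<close> at \<open>z\<close>, in the coordinates in which it is \<open>h \<mapsto> A h + B cnj h\<close>. Thus \<open>A\<close> and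
  \<open>B\<close> are the values of \<open>\<partial>f/\<partial>z\<close> and \<open>\<partial>f/\<partial>zbar\<close>. A relation is used instead of two operators because the
  computation rules then need no separate differentiability statements.
\<close>

definition has_wirtinger ::
    "(complex \<Rightarrow> complex) \<Rightarrow> complex \<Rightarrow> complex \<Rightarrow> complex \<Rightarrow> bool" where
  "has_wirtinger f A B z \<longleftrightarrow> (f has_derivative (\<lambda>h. A * h + B * cnj h)) (at z)"

definition C1_on :: "complex set \<Rightarrow> (complex \<Rightarrow> complex) \<Rightarrow> bool" where
  "C1_on S f \<longleftrightarrow> (\<exists>A B. continuous_on S A \<and> continuous_on S B \<and>
     (\<forall>z\<in>S. has_wirtinger f (A z) (B z) z))"

lemma has_wirtinger_unique:
  assumes "has_wirtinger f A B z" "has_wirtinger f A' B' z"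
  shows "A = A'" "B = B'"
proof -
  have eq: "(\<lambda>h. A * h + B * cnj h) = (\<lambda>h. A' * h + B' * cnj h)"
    using assms unfolding has_wirtinger_def by (rule has_derivative_unique)
  have "A + B = A' + B'" using fun_cong[OF eq, of 1] by simp
  moreover have "A - B = A' - B'"
    using fun_cong[OF eq, of \<i>] by (simp add: complex_eq_iff)
  ultimately have "2 * A = 2 * A'" "2 * B = 2 * B'" by (simp_all add: algebra_simps complex_eq_iff)
  then show "A = A'" "B = B'" by simp_all
qed

lemma has_wirtinger_transform:
  assumes "has_wirtinger f A B z" "open S" "z \<in> S" "\<And>w. w \<in> S \<Longrightarrow> f w = g w"
  shows "has_wirtinger g A B z"
  using has_derivative_transform_within_open[OF assms(1)[unfolded has_wirtinger_def] assms(2,3,4)]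
  unfolding has_wirtinger_def .

lemma has_wirtinger_eq_rhs:
  "has_wirtinger f A B z \<Longrightarrow> A = A' \<Longrightarrow> B = B' \<Longrightarrow> has_wirtinger f A' B' z"
  by simp

lemma has_wirtinger_const: "has_wirtinger (\<lambda>_. c) 0 0 z"
  by (simp add: has_wirtinger_def)

lemma has_wirtinger_ident: "has_wirtinger (\<lambda>z. z) 1 0 z"
  by (simp add: has_wirtinger_def)

lemma has_wirtinger_cnj:
  "has_wirtinger f A B z \<Longrightarrow> has_wirtinger (\<lambda>z. cnj (f z)) (cnj B) (cnj A) z"
  unfolding has_wirtinger_def
  by (drule bounded_linear.has_derivative[OF bounded_linear_cnj]) (simp add: algebra_simps)

lemma has_wirtinger_add:
  "has_wirtinger f A B z \<Longrightarrow> has_wirtinger g A' B' z \<Longrightarrow>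
   has_wirtinger (\<lambda>z. f z + g z) (A + A') (B + B') z"
  unfolding has_wirtinger_def by (drule (1) has_derivative_add) (simp add: algebra_simps)

lemma has_wirtinger_minus:
  "has_wirtinger f A B z \<Longrightarrow> has_wirtinger (\<lambda>z. - f z) (- A) (- B) z"
  unfolding has_wirtinger_def by (drule has_derivative_minus) (simp add: algebra_simps)

lemma has_wirtinger_diff:
  "has_wirtinger f A B z \<Longrightarrow> has_wirtinger g A' B' z \<Longrightarrow>
   has_wirtinger (\<lambda>z. f z - g z) (A - A') (B - B') z"
  unfolding has_wirtinger_def by (drule (1) has_derivative_diff) (simp add: algebra_simps)

lemma has_wirtinger_mult:
  "has_wirtinger f A B z \<Longrightarrow> has_wirtinger g A' B' z \<Longrightarrow>
   has_wirtinger (\<lambda>z. f z * g z) (A * g z + f z * A') (B * g z + f z * B') z"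
  unfolding has_wirtinger_def by (drule (1) has_derivative_mult) (simp add: algebra_simps)

lemma has_wirtinger_holomorphic_compose:
  assumes "has_wirtinger f A B z" "(g has_field_derivative g') (at (f z))"
  shows "has_wirtinger (\<lambda>z. g (f z)) (g' * A) (g' * B) z"
proof -
  have "((\<lambda>z. g (f z)) has_derivative (\<lambda>h. g' * (A * h + B * cnj h))) (at z)"
    using has_derivative_compose[OF assms(1)[unfolded has_wirtinger_def]
      assms(2)[unfolded has_field_derivative_def]] by simp
  then show ?thesis by (simp add: has_wirtinger_def algebra_simps)
qed

lemma has_wirtinger_real_compose:
  assumes "has_wirtinger (\<lambda>z. of_real (f z)) A B z" "(g has_real_derivative g') (at (f z))"
  shows "has_wirtinger (\<lambda>z. of_real (g (f z))) (g' * A) (g' * B) z"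
proof -
  have "(f has_derivative (\<lambda>h. Re (A * h + B * cnj h))) (at z)"
    using bounded_linear.has_derivative[OF bounded_linear_Re assms(1)[unfolded has_wirtinger_def]]
    by simp
  from has_derivative_compose[OF this assms(2)[unfolded has_field_derivative_def]]
  have *: "((\<lambda>z. of_real (g (f z))) has_derivative (\<lambda>h. of_real (g' * Re (A * h + B * cnj h)))) (at z)"
    by (rule bounded_linear.has_derivative[OF bounded_linear_of_real])
  have "((\<lambda>z. of_real (f z) :: complex) has_derivative (\<lambda>h. of_real (Re (A * h + B * cnj h)))) (at z)"
    using \<open>(f has_derivative _) _\<close> by (rule bounded_linear.has_derivative[OF bounded_linear_of_real])
  then have "(\<lambda>h. of_real (Re (A * h + B * cnj h))) = (\<lambda>h. A * h + B * cnj h)"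
    using assms(1) unfolding has_wirtinger_def by (metis has_derivative_unique)
  then have "of_real (Re (A * h + B * cnj h)) = A * h + B * cnj h" for h
    by (rule fun_cong)
  then have "of_real (g' * Re (A * h + B * cnj h)) = g' * A * h + g' * B * cnj h" for h
    unfolding of_real_mult by (simp only: ring_distribs mult.assoc)
  then have "(\<lambda>h. complex_of_real (g' * Re (A * h + B * cnj h))) = (\<lambda>h. g' * A * h + g' * B * cnj h)"
    by (rule ext)
  with * show ?thesis unfolding has_wirtinger_def by (metis (no_types))
qed

lemma has_wirtinger_continuous: "has_wirtinger f A B z \<Longrightarrow> isCont f z"
  unfolding has_wirtinger_def by (rule has_derivative_continuous)

text \<open>
  The Cauchy-Riemann equations.
\<close>

lemma has_field_derivative_if_dbar_zero:
  "has_wirtinger f A 0 z \<Longrightarrow> (f has_field_derivative A) (at z)"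
  by (simp add: has_wirtinger_def has_field_derivative_def)

lemma has_wirtinger_holomorphic:
  "(f has_field_derivative A) (at z) \<Longrightarrow> has_wirtinger f A 0 z"
  by (simp add: has_wirtinger_def has_field_derivative_def)

lemma C1_onI:
  "continuous_on S A \<Longrightarrow> continuous_on S B \<Longrightarrow> (\<And>z. z \<in> S \<Longrightarrow> has_wirtinger f (A z) (B z) z)
   \<Longrightarrow> C1_on S f"
  unfolding C1_on_def by blast

lemma C1_onE:
  assumes "C1_on S f"
  obtains A B where "continuous_on S A" "continuous_on S B"
    "\<And>z. z \<in> S \<Longrightarrow> has_wirtinger f (A z) (B z) z"
proof -
  from assms obtain A B where "continuous_on S A \<and> continuous_on S B \<and>
     (\<forall>z\<in>S. has_wirtinger f (A z) (B z) z)" unfolding C1_on_def by auto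
  with that[of A B] show thesis by auto
qed

lemma C1_on_continuous: "C1_on S f \<Longrightarrow> continuous_on S f"
  unfolding C1_on_def by (meson has_wirtinger_continuous continuous_at_imp_continuous_on)

lemma C1_on_subset: "C1_on S f \<Longrightarrow> T \<subseteq> S \<Longrightarrow> C1_on T f"
  unfolding C1_on_def by (meson continuous_on_subset subsetD)

lemma C1_on_const: "C1_on S (\<lambda>_. c)"
  by (rule C1_onI[where A="\<lambda>_. 0" and B="\<lambda>_. 0"]) (auto intro: has_wirtinger_const)

lemma C1_on_ident: "C1_on S (\<lambda>z. z)"
  by (rule C1_onI[where A="\<lambda>_. 1" and B="\<lambda>_. 0"]) (auto intro: has_wirtinger_ident)

lemma C1_on_cnj: "C1_on S f \<Longrightarrow> C1_on S (\<lambda>z. cnj (f z))"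
  apply (erule C1_onE)
  subgoal for A B
    by (rule C1_onI[where A="\<lambda>z. cnj (B z)" and B="\<lambda>z. cnj (A z)"])
      (auto intro: has_wirtinger_cnj continuous_intros)
  done

lemma C1_on_add:
  assumes "C1_on S f" "C1_on S g"
  shows "C1_on S (\<lambda>z. f z + g z)"
proof -
  from assms(1) obtain A B where 1: "continuous_on S A" "continuous_on S B"
    "\<And>z. z \<in> S \<Longrightarrow> has_wirtinger f (A z) (B z) z" by (rule C1_onE) blast
  from assms(2) obtain A' B' where 2: "continuous_on S A'" "continuous_on S B'"
    "\<And>z. z \<in> S \<Longrightarrow> has_wirtinger g (A' z) (B' z) z" by (rule C1_onE) blast
  show ?thesis
    by (rule C1_onI[OF _ _ has_wirtinger_add[OF 1(3) 2(3)]]) (use 1 2 in \<open>auto intro: continuous_intros\<close>)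
qed

lemma C1_on_mult:
  assumes "C1_on S f" "C1_on S g"
  shows "C1_on S (\<lambda>z. f z * g z)"
proof -
  from assms(1) obtain A B where 1: "continuous_on S A" "continuous_on S B"
    "\<And>z. z \<in> S \<Longrightarrow> has_wirtinger f (A z) (B z) z" by (rule C1_onE) blast
  from assms(2) obtain A' B' where 2: "continuous_on S A'" "continuous_on S B'"
    "\<And>z. z \<in> S \<Longrightarrow> has_wirtinger g (A' z) (B' z) z" by (rule C1_onE) blast
  show ?thesis
    by (rule C1_onI[OF _ _ has_wirtinger_mult[OF 1(3) 2(3)]])
      (use 1 2 assms[THEN C1_on_continuous] in \<open>auto intro: continuous_intros\<close>)
qed

lemma C1_on_minus: "C1_on S f \<Longrightarrow> C1_on S (\<lambda>z. - f z)"
  using C1_on_mult[OF C1_on_const[of S "-1"]] by simp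

lemma C1_on_diff: "C1_on S f \<Longrightarrow> C1_on S g \<Longrightarrow> C1_on S (\<lambda>z. f z - g z)"
  using C1_on_add[OF _ C1_on_minus] by simp

lemma C1_on_exp:
  assumes "C1_on S f"
  shows "C1_on S (\<lambda>z. exp (f z))"
proof -
  from assms(1) obtain A B where 1: "continuous_on S A" "continuous_on S B"
    "\<And>z. z \<in> S \<Longrightarrow> has_wirtinger f (A z) (B z) z" by (rule C1_onE) blast
  show ?thesis
    by (rule C1_onI[OF _ _ has_wirtinger_holomorphic_compose[OF 1(3) DERIV_exp]])
      (use 1 assms[THEN C1_on_continuous] in \<open>auto intro: continuous_intros\<close>)
qed

lemma C1_on_inverse:
  assumes "C1_on S f" "\<And>z. z \<in> S \<Longrightarrow> f z \<noteq> 0"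
  shows "C1_on S (\<lambda>z. inverse (f z))"
proof -
  from assms(1) obtain A B where 1: "continuous_on S A" "continuous_on S B"
    "\<And>z. z \<in> S \<Longrightarrow> has_wirtinger f (A z) (B z) z" by (rule C1_onE) blast
  show ?thesis
    by (rule C1_onI[OF _ _ has_wirtinger_holomorphic_compose[OF 1(3) DERIV_inverse[OF assms(2)]]])
      (use 1 assms(2) assms(1)[THEN C1_on_continuous] in \<open>auto intro!: continuous_intros\<close>)
qed

lemma C1_on_real_compose:
  assumes "C1_on S (\<lambda>z. of_real (f z))" "continuous_on UNIV g'"
    "\<And>x. (g has_real_derivative g' x) (at x)"
  shows "C1_on S (\<lambda>z. of_real (g (f z)))"
proof -
  from assms(1) obtain A B where 1: "continuous_on S A" "continuous_on S B"
    "\<And>z. z \<in> S \<Longrightarrow> has_wirtinger (\<lambda>z. of_real (f z)) (A z) (B z) z" by (rule C1_onE) blast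
  have "continuous_on S (\<lambda>z. Re (of_real (f z)))"
    by (rule continuous_intros C1_on_continuous assms)+
  then have "continuous_on S f" by simp
  then have "continuous_on S (\<lambda>z. g' (f z))"
    using continuous_on_compose2[OF assms(2), of S f] by simp
  then show ?thesis
    by (intro C1_onI[OF _ _ has_wirtinger_real_compose[OF 1(3) assms(3)]])
      (use 1 in \<open>auto intro!: continuous_intros\<close>)
qed

lemmas C1_on_intros = C1_on_const C1_on_ident C1_on_cnj C1_on_add C1_on_mult C1_on_minus
  C1_on_diff C1_on_exp

text \<open>
  This turns functions that are smooth only on a disc, after multiplication by a cutoff, into functions
  on the whole plane to which the Cauchy transform applies. Off \<open>K\<close> the function vanishes on an open set,
  so its derivatives vanish there too and the extended derivatives are continuous on the union of the
  two open sets \<open>S\<close> and \<open>- K\<close>.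
\<close>

lemma C1_on_zero_extension:
  assumes "C1_on S f" "open S" "closed K" "K \<subseteq> S" and zero: "\<And>z. z \<notin> K \<Longrightarrow> f z = 0"
  shows "C1_on UNIV f"
proof -
  from assms(1) obtain A B where AB: "continuous_on S A" "continuous_on S B"
    "\<And>z. z \<in> S \<Longrightarrow> has_wirtinger f (A z) (B z) z" by (rule C1_onE) blast
  have out: "has_wirtinger f 0 0 z" if "z \<notin> K" for z
    by (rule has_wirtinger_transform[OF has_wirtinger_const, of "-K" _ 0])
      (use that assms zero in auto)
  define A' B' where "A' z = (if z \<in> S then A z else 0)" and "B' z = (if z \<in> S then B z else 0)" for z
  have A0: "A' z = 0" "B' z = 0" if "z \<in> -K" for z
    using that has_wirtinger_unique[OF AB(3)[of z] out[of z]] by (auto simp: A'_def B'_def)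
  have 1: "continuous_on (-K) A'" "continuous_on (-K) B'"
    using A0 by (auto intro: continuous_on_eq[OF continuous_on_const[of _ 0]])
  have 2: "continuous_on S A'" "continuous_on S B'"
    using AB by (auto intro: continuous_on_eq simp: A'_def B'_def)
  have U: "S \<union> (-K) = UNIV" using assms by auto
  show ?thesis
  proof (rule C1_onI)
    show "continuous_on UNIV A'" "continuous_on UNIV B'"
      using continuous_on_open_Un[of S "-K" A'] continuous_on_open_Un[of S "-K" B'] 1 2 assms U
      by (auto simp: open_Compl)
    show "has_wirtinger f (A' z) (B' z) z" for z
      using AB(3) out assms(4) by (auto simp: A'_def B'_def)
  qed
qed

lemma DERIV_pos_part_square: "((\<lambda>x::real. (max 0 x)\<^sup>2) has_real_derivative 2 * max 0 x) (at x)"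
proof (cases x "0::real" rule: linorder_cases)
  case less
  show ?thesis
    by (rule has_field_derivative_transform_within_open[of "\<lambda>_. 0" _ _ "{..<0}"])
      (use less in auto)
next
  case greater
  show ?thesis
    by (rule has_field_derivative_transform_within_open[of "\<lambda>x. x\<^sup>2" _ _ "{0<..}"])
      (use greater in \<open>auto intro!: derivative_eq_intros\<close>)
next
  case equal
  have "((\<lambda>h::real. max 0 h ^ 2 / h) \<longlongrightarrow> 0) (at 0)"
  proof (rule Lim_null_comparison)
    show "\<forall>\<^sub>F h in at (0::real). norm (max 0 h ^ 2 / h) \<le> \<bar>h\<bar>"
      by (rule always_eventually) (auto simp: max_def power2_eq_square)
    show "((\<lambda>h::real. \<bar>h\<bar>) \<longlongrightarrow> 0) (at 0)" by (auto intro!: tendsto_eq_intros)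
  qed
  then show ?thesis using equal by (simp add: DERIV_def)
qed

lemma C1_on_norm_square: "C1_on S (\<lambda>z. of_real ((norm z)\<^sup>2))"
  using C1_on_mult[OF C1_on_ident C1_on_cnj[OF C1_on_ident], of S] by (simp only: complex_norm_square)

lemma has_wirtinger_norm_square: "has_wirtinger (\<lambda>z. of_real ((norm z)\<^sup>2)) (cnj z) z z"
  using has_wirtinger_mult[OF has_wirtinger_ident has_wirtinger_cnj[OF has_wirtinger_ident], of z]
  by (simp only: complex_norm_square mult_1 mult_1_right mult_zero_left mult_zero_right complex_cnj_one complex_cnj_zero add_0_left add_0_right)

text \<open>
  With \<open>m x = (max 0 x)\<^sup>2\<close>, which is \<open>C\<^sup>1\<close>, and an affine \<open>l\<close> taking \<open>[a\<^sup>2, b\<^sup>2]\<close> to \<open>[0, 1]\<close>, the cutoff is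
  \<open>m (1 - m (l (|z|\<^sup>2)))\<close>.
\<close>

lemma C1_cutoff_exists:
  assumes "0 < a" "a < b"
  obtains \<eta> :: "complex \<Rightarrow> real" where "C1_on UNIV (\<lambda>z. of_real (\<eta> z))"
    "\<And>z. 0 \<le> \<eta> z" "\<And>z. \<eta> z \<le> 1" "\<And>z. norm z \<le> a \<Longrightarrow> \<eta> z = 1" "\<And>z. b \<le> norm z \<Longrightarrow> \<eta> z = 0"
proof -
  define m :: "real \<Rightarrow> real" where "m x = (max 0 x)\<^sup>2" for x
  have m: "(m has_real_derivative 2 * max 0 x) (at x)" for x
    unfolding m_def by (rule DERIV_pos_part_square)
  have cm: "continuous_on S m" for S using m by (meson DERIV_isCont continuous_at_imp_continuous_on)
  have pos: "0 < b\<^sup>2 - a\<^sup>2" using assms by (simp add: power_strict_mono)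
  define l where "l t = (t - a\<^sup>2) / (b\<^sup>2 - a\<^sup>2)" for t :: real
  define g where "g t = m (1 - m (l t))" for t
  define g' where "g' t = 2 * max 0 (1 - m (l t)) * (- (2 * max 0 (l t) / (b\<^sup>2 - a\<^sup>2)))" for t
  define \<eta> where "\<eta> z = g ((norm z)\<^sup>2)" for z :: complex
  have l: "(l has_real_derivative 1 / (b\<^sup>2 - a\<^sup>2)) (at t)" for t
  proof -
    have "((\<lambda>t. (t - a\<^sup>2) * inverse (b\<^sup>2 - a\<^sup>2)) has_real_derivative 1 / (b\<^sup>2 - a\<^sup>2)) (at t)"
      by (auto intro!: derivative_eq_intros simp: divide_inverse)
    then show ?thesis by (simp add: l_def[abs_def] divide_inverse)
  qed
  have ml: "((\<lambda>t. 1 - m (l t)) has_real_derivative - (2 * max 0 (l t) / (b\<^sup>2 - a\<^sup>2))) (at t)" for t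
    using DERIV_diff[OF DERIV_const[of 1] DERIV_chain'[OF l m]] by simp
  have g: "(g has_real_derivative g' t) (at t)" for t
    unfolding g_def g'_def by (rule DERIV_chain'[OF ml m])
  have cg: "continuous_on UNIV g'"
    unfolding g'_def l_def using pos
    by (intro continuous_intros continuous_on_compose2[OF cm[of UNIV]]) auto
  show ?thesis
  proof (rule that[of \<eta>])
    show "C1_on UNIV (\<lambda>z. of_real (\<eta> z))"
      unfolding \<eta>_def by (rule C1_on_real_compose[OF C1_on_norm_square cg g])
    show "0 \<le> \<eta> z" for z by (simp add: \<eta>_def g_def m_def)
    show "\<eta> z \<le> 1" for z unfolding \<eta>_def g_def m_def
      by (rule power_le_one) auto
    show "\<eta> z = 1" if "norm z \<le> a" for z
    proof -
      have "(norm z)\<^sup>2 \<le> a\<^sup>2" using that by (simp add: power_mono)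
      then have "l ((norm z)\<^sup>2) \<le> 0" using pos by (simp add: l_def divide_nonpos_pos)
      then show ?thesis by (simp add: \<eta>_def g_def m_def)
    qed
    show "\<eta> z = 0" if "b \<le> norm z" for z
    proof -
      have "b\<^sup>2 \<le> (norm z)\<^sup>2" using that assms by (simp add: power_mono)
      then have "l ((norm z)\<^sup>2) \<ge> 1" using pos by (simp add: l_def)
      then have "m (l ((norm z)\<^sup>2)) \<ge> 1" by (simp add: m_def)
      then show ?thesis by (simp add: \<eta>_def g_def m_def[of "1 - _"])
    qed
  qed
qed

section \<open>Convolutions and the kernel \<open>1/|z|\<close>\<close>

lemma lborel_integral_affine:
  fixes f :: "'a::euclidean_space \<Rightarrow> 'b::{banach, second_countable_topology}"
  assumes "f \<in> borel_measurable borel" "c \<noteq> 0"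
  shows "(LINT x|lborel. f x) = \<bar>c\<bar> ^ DIM('a) *\<^sub>R (LINT x|lborel. f (t + c *\<^sub>R x))"
proof -
  have "(LINT x|lborel. f x) =
      integral\<^sup>L (density (distr lborel borel (\<lambda>x. t + c *\<^sub>R x)) (\<lambda>_. \<bar>c\<bar> ^ DIM('a))) f"
    using lborel_affine[OF assms(2), of t] by simp
  also have "\<dots> = (LINT x|distr lborel borel (\<lambda>x. t + c *\<^sub>R x). \<bar>c\<bar> ^ DIM('a) *\<^sub>R f x)"
    using assms by (intro integral_density) auto
  also have "\<dots> = (LINT x|lborel. \<bar>c\<bar> ^ DIM('a) *\<^sub>R f (t + c *\<^sub>R x))"
    using assms by (intro integral_distr) auto
  finally show ?thesis by simp
qed

lemma lborel_integrable_affine: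
  fixes f :: "'a::euclidean_space \<Rightarrow> 'b::{banach, second_countable_topology}"
  assumes "integrable lborel f" "c \<noteq> 0"
  shows "integrable lborel (\<lambda>x. f (t + c *\<^sub>R x))"
proof -
  have [measurable]: "f \<in> borel_measurable borel" using assms by simp
  have "integrable (density (distr lborel borel (\<lambda>x. t + c *\<^sub>R x)) (\<lambda>_. \<bar>c\<bar> ^ DIM('a))) f"
    using lborel_affine[OF assms(2), of t] assms by simp
  then have "integrable (distr lborel borel (\<lambda>x. t + c *\<^sub>R x)) (\<lambda>x. \<bar>c\<bar> ^ DIM('a) *\<^sub>R f x)"
    using assms by (subst (asm) integrable_density) auto
  then have "integrable lborel (\<lambda>x. \<bar>c\<bar> ^ DIM('a) *\<^sub>R f (t + c *\<^sub>R x))"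
    by (subst (asm) integrable_distr_eq) auto
  from integrable_scaleR_right[OF this, of "inverse (\<bar>c\<bar> ^ DIM('a))"] show ?thesis
    using assms(2) by simp
qed

lemma lborel_integral_reflect:
  fixes f :: "complex \<Rightarrow> 'b::{banach, second_countable_topology}"
  assumes "f \<in> borel_measurable borel"
  shows "(LINT x|lborel. f (z - x)) = (LINT x|lborel. f x)"
  using lborel_integral_affine[OF assms, of "-1" z] by simp

text \<open>
  Dyadic annuli: on \<open>M / 2\<^sup>k\<^sup>+\<^sup>1 \<le> |w| < M / 2\<^sup>k\<close> the function is at most \<open>2\<^sup>k\<^sup>+\<^sup>1 / M\<close>, while the disc of
  radius \<open>M / 2\<^sup>k\<close> has area of order \<open>4\<^sup>-\<^sup>k M\<^sup>2\<close>, so the series converges geometrically.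
\<close>

lemma integrable_inverse_norm_on_ball:
  "integrable lborel (\<lambda>w::complex. indicator (ball 0 M) w / norm w :: real)"
proof (cases "M > 0")
  case False
  then have "(\<lambda>w::complex. indicator (ball 0 M) w / norm w :: real) = (\<lambda>_. 0)"
    by (auto simp: fun_eq_iff indicator_def not_less intro: order_trans[OF _ norm_ge_zero])
  then show ?thesis by simp
next
  case M: True
  define u where "u k w = (2 ^ Suc k / M) * indicator (ball 0 (M / 2 ^ k)) w" for k and w :: complex
  have meas [measurable]: "u k \<in> borel_measurable borel" for k
    unfolding u_def by (intro borel_measurable_times borel_measurable_const borel_measurable_indicator) simp
  have pt: "ennreal (indicator (ball 0 M) w / norm w) \<le> (\<Sum>k. ennreal (u k w))" for w :: complex
  proof (cases "w \<noteq> 0 \<and> norm w < M")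
    case True
    obtain n where "(1/2::real) ^ n < norm w / M"
      using real_arch_pow_inv[of "norm w / M" "1/2"] True M by auto
    then have ex: "M / 2 ^ n \<le> norm w" using M by (simp add: field_simps)
    define n where "n = (LEAST n. M / 2 ^ n \<le> norm w)"
    have n: "M / 2 ^ n \<le> norm w" unfolding n_def by (rule LeastI[of "\<lambda>n. M / 2 ^ n \<le> norm w", OF ex])
    then have "n \<noteq> 0" using True by (intro notI) simp
    then obtain k where k: "n = Suc k" by (cases n) auto
    have "norm w < M / 2 ^ k"
      using not_less_Least[of k "\<lambda>n. M / 2 ^ n \<le> norm w"] k unfolding n_def by auto
    then have "u k w = 2 ^ Suc k / M" by (simp add: u_def)
    moreover have "1 / norm w \<le> 2 ^ Suc k / M"
      using n k M True by (simp add: field_simps)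
    ultimately have "ennreal (indicator (ball 0 M) w / norm w) \<le> ennreal (u k w)"
      using True by (intro ennreal_leI) simp
    also have "\<dots> \<le> (\<Sum>k. ennreal (u k w))"
      using sum_le_suminf[of "\<lambda>k. ennreal (u k w)" "{k}"] by simp
    finally show ?thesis .
  qed (auto simp: indicator_def)
  have int: "(\<integral>\<^sup>+w. ennreal (u k w) \<partial>lborel) = ennreal (2 * M * unit_ball_vol 2 * (1/2) ^ k)" for k
  proof -
    have "(\<integral>\<^sup>+w. ennreal (u k w) \<partial>lborel) =
        (\<integral>\<^sup>+w. ennreal (2 ^ Suc k / M) * indicator (ball 0 (M / 2 ^ k) :: complex set) w \<partial>lborel)"
      by (intro nn_integral_cong) (auto simp: u_def indicator_def)
    also have "\<dots> = ennreal (2 ^ Suc k / M) * emeasure lborel (ball 0 (M / 2 ^ k) :: complex set)"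
      by (subst nn_integral_cmult_indicator) auto
    also have "\<dots> = ennreal (2 ^ Suc k / M * (unit_ball_vol 2 * (M / 2 ^ k)\<^sup>2))"
      using M by (subst emeasure_ball) (auto simp: ennreal_mult[symmetric])
    also have "2 ^ Suc k / M * (unit_ball_vol 2 * (M / 2 ^ k)\<^sup>2) = 2 * M * unit_ball_vol 2 * (1/2) ^ k"
      using M by (simp add: field_simps power2_eq_square power_divide)
    finally show ?thesis .
  qed
  have "(\<integral>\<^sup>+w. ennreal (indicator (ball 0 M) (w::complex) / norm w) \<partial>lborel) \<le>
      (\<integral>\<^sup>+w. (\<Sum>k. ennreal (u k w)) \<partial>lborel)"
    by (intro nn_integral_mono pt)
  also have "\<dots> = (\<Sum>k. \<integral>\<^sup>+w. ennreal (u k w) \<partial>lborel)"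
    by (intro nn_integral_suminf) simp
  also have "\<dots> = (\<Sum>k. ennreal (2 * M * unit_ball_vol 2 * (1/2) ^ k))" by (simp only: int)
  also have "\<dots> < \<infinity>"
    using M by (subst suminf_ennreal2) (auto intro!: summable_mult summable_geometric)
  finally show ?thesis
    by (intro integrableI_nonneg) (auto intro!: borel_measurable_divide borel_measurable_indicator)
qed

text \<open>
  The integral of \<open>1 / |w|\<close> over the unit disc, that is, \<open>2 \<pi>\<close>.
\<close>

definition planar_riesz :: real where
  "planar_riesz = (LINT w|lborel. indicator (ball (0::complex) 1) w / norm w)"

lemma integral_inverse_norm_ball:
  assumes "0 < r"
  shows "(LINT w|lborel. indicator (ball (0::complex) r) w / norm w) = r * planar_riesz"
proof -
  have "(LINT w|lborel. indicator (ball (0::complex) r) w / norm w) =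
      \<bar>r\<bar> ^ DIM(complex) *\<^sub>R (LINT w|lborel. indicator (ball (0::complex) r) (0 + r *\<^sub>R w) / norm (0 + r *\<^sub>R w))"
    using assms borel_measurable_integrable[OF integrable_inverse_norm_on_ball]
    by (intro lborel_integral_affine) auto
  also have "(\<lambda>w::complex. indicator (ball 0 r) (0 + r *\<^sub>R w) / norm (0 + r *\<^sub>R w)) =
      (\<lambda>w. (1 / r) * (indicator (ball 0 1) w / norm w))"
    using assms by (auto simp: indicator_def fun_eq_iff)
  finally show ?thesis using assms
    unfolding integral_mult_right_zero planar_riesz_def[symmetric] by (simp add: power2_eq_square)
qed

lemma planar_riesz_nonneg: "0 \<le> planar_riesz"
  unfolding planar_riesz_def by (rule Bochner_Integration.integral_nonneg) simp

lemma convolution_integrable: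
  fixes f g :: "complex \<Rightarrow> complex"
  assumes "continuous_on UNIV f" "integrable lborel g" "\<And>w. M \<le> norm w \<Longrightarrow> g w = 0"
  shows "integrable lborel (\<lambda>w. f (z - w) * g w)"
proof -
  have "compact ((\<lambda>w. f (z - w)) ` cball 0 M)"
    by (intro compact_continuous_image continuous_on_compose2[OF assms(1)] continuous_intros) auto
  then obtain C where C: "\<And>w. w \<in> cball 0 M \<Longrightarrow> norm (f (z - w)) \<le> C"
    using compact_imp_bounded bounded_iff by (metis (no_types, lifting) imageI)
  have [measurable]: "f \<in> borel_measurable borel" "g \<in> borel_measurable borel"
    using assms by (auto intro: borel_measurable_continuous_onI)
  show ?thesis
  proof (rule Bochner_Integration.integrable_bound[of _ "\<lambda>w. C *\<^sub>R g w"])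
    show "integrable lborel (\<lambda>w. C *\<^sub>R g w)" using assms by simp
    show "AE w in lborel. norm (f (z - w) * g w) \<le> norm (C *\<^sub>R g w)"
    proof (rule AE_I2)
      fix w
      show "norm (f (z - w) * g w) \<le> norm (C *\<^sub>R g w)"
        using C[of w] assms(3)[of w]
        by (cases "norm w \<le> M") (auto simp: norm_mult intro!: mult_right_mono)
    qed
  qed measurable
qed

text \<open>
  Only the values of \<open>f\<close> on a compact disc enter, where it is uniformly continuous.
\<close>

lemma convolution_uniformly_close:
  fixes f :: "complex \<Rightarrow> complex"
  assumes "continuous_on UNIV f" "0 < e"
  shows "\<exists>d>0. \<forall>w h. norm w \<le> M \<longrightarrow> norm h < d \<longrightarrow> norm (f (z + h - w) - f (z - w)) < e"
proof -
  have "uniformly_continuous_on (cball 0 (norm z + 1 + M)) f"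
    by (intro compact_uniformly_continuous continuous_on_subset[OF assms(1)]) auto
  then obtain d where "d > 0" and d': "\<And>x y. x \<in> cball 0 (norm z + 1 + M) \<Longrightarrow> y \<in> cball 0 (norm z + 1 + M)
      \<Longrightarrow> dist y x < d \<Longrightarrow> dist (f y) (f x) < e"
    using assms(2) unfolding uniformly_continuous_on_def by meson
  have d: "d > 0" "norm (f y - f x) < e"
    if "norm x \<le> norm z + 1 + M" "norm y \<le> norm z + 1 + M" "norm (y - x) < d" for x y
    using that \<open>d > 0\<close> d'[of x y] by (simp_all add: dist_norm)
  show ?thesis
  proof (intro exI[of _ "min d 1"] conjI allI impI)
    fix w h :: complex assume *: "norm w \<le> M" "norm h < min d 1"
    have "norm (z + h - w) \<le> norm z + norm h + norm w" "norm (z - w) \<le> norm z + norm w"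
      using norm_triangle_ineq4[of "z + h" w] norm_triangle_ineq[of z h] norm_triangle_ineq4[of z w] by linarith+
    then show "norm (f (z + h - w) - f (z - w)) < e"
      using * d(2)[of "z - w" "z + h - w"] by auto
  qed (use \<open>d > 0\<close> in auto)
qed

lemma convolution_continuous:
  fixes f g :: "complex \<Rightarrow> complex"
  assumes f: "continuous_on UNIV f" and g: "integrable lborel g" "\<And>w. M \<le> norm w \<Longrightarrow> g w = 0"
  shows "continuous_on UNIV (\<lambda>z. LINT w|lborel. f (z - w) * g w)"
  unfolding continuous_on_iff
proof (intro ballI allI impI)
  fix z :: complex and e :: real assume "e > 0"
  define G where "G = (LINT w|lborel. norm (g w))"
  have G: "G \<ge> 0" unfolding G_def by (rule Bochner_Integration.integral_nonneg) simp
  define e' where "e' = e / (G + 1)"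
  have e': "e' > 0" using \<open>e > 0\<close> G by (simp add: e'_def)
  from convolution_uniformly_close[OF f e', of M z] obtain d where d: "d > 0"
    "\<And>w h. norm w \<le> M \<Longrightarrow> norm h < d \<Longrightarrow> norm (f (z + h - w) - f (z - w)) < e'" by auto
  show "\<exists>d>0. \<forall>x'\<in>UNIV. dist x' z < d \<longrightarrow>
      dist (LINT w|lborel. f (x' - w) * g w) (LINT w|lborel. f (z - w) * g w) < e"
  proof (intro exI[of _ d] conjI ballI impI d)
    fix y assume y: "dist y z < d"
    note I = convolution_integrable[OF f g]
    have "norm ((LINT w|lborel. f (y - w) * g w) - (LINT w|lborel. f (z - w) * g w)) =
        norm (LINT w|lborel. f (y - w) * g w - f (z - w) * g w)"
      by (subst Bochner_Integration.integral_diff) (auto intro: I)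
    also have "\<dots> \<le> (LINT w|lborel. e' * norm (g w))"
    proof (rule Bochner_Integration.integral_norm_bound_integral)
      fix w
      show "norm (f (y - w) * g w - f (z - w) * g w) \<le> e' * norm (g w)"
        using d(2)[of w "y - z"] y g(2)[of w]
        by (cases "norm w \<le> M") (auto simp: dist_norm norm_mult left_diff_distrib[symmetric] intro!: mult_right_mono)
    qed (use I g in \<open>auto intro!: Bochner_Integration.integrable_diff\<close>)
    also have "\<dots> = e' * G" by (simp add: G_def)
    also have "\<dots> < e" using \<open>e > 0\<close> G by (simp add: e'_def field_simps)
    finally show "dist (LINT w|lborel. f (y - w) * g w) (LINT w|lborel. f (z - w) * g w) < e"
      by (simp add: dist_norm)
  qed
qed

text \<open>
  Differentiation under the integral sign. By the mean value inequality the difference quotient of \<open>f\<close>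
  converges uniformly on the translates of the bounded support of \<open>g\<close>. All derivatives fall on \<open>f\<close>, so
  that \<open>g\<close> may be the singular kernel \<open>1/w\<close>.
\<close>

lemma has_wirtinger_convolution:
  fixes f g :: "complex \<Rightarrow> complex"
  assumes A: "continuous_on UNIV A" and B: "continuous_on UNIV B"
    and f: "\<And>z. has_wirtinger f (A z) (B z) z"
    and g: "integrable lborel g" "\<And>w. M \<le> norm w \<Longrightarrow> g w = 0"
  shows "has_wirtinger (\<lambda>z. LINT w|lborel. f (z - w) * g w)
    (LINT w|lborel. A (z - w) * g w) (LINT w|lborel. B (z - w) * g w) z"
  unfolding has_wirtinger_def has_derivative_at_alt
proof (intro conjI allI impI)
  have fc: "continuous_on UNIV f"
    by (intro continuous_at_imp_continuous_on ballI has_wirtinger_continuous[OF f])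
  note I = convolution_integrable[OF _ g]
  show "bounded_linear (\<lambda>h. (LINT w|lborel. A (z - w) * g w) * h + (LINT w|lborel. B (z - w) * g w) * cnj h)"
    by (intro bounded_linear_add bounded_linear_mult_right
      bounded_linear_compose[OF bounded_linear_mult_right bounded_linear_cnj])
  fix e :: real assume "e > 0"
  define G where "G = (LINT w|lborel. norm (g w))"
  have G: "G \<ge> 0" unfolding G_def by (rule Bochner_Integration.integral_nonneg) simp
  define e' where "e' = e / (G + 1)"
  have e': "e' / 2 > 0" using \<open>e > 0\<close> G by (simp add: e'_def)
  from convolution_uniformly_close[OF A e', of M z] obtain d1 where d1: "d1 > 0"
    "\<And>w h. norm w \<le> M \<Longrightarrow> norm h < d1 \<Longrightarrow> norm (A (z + h - w) - A (z - w)) < e'/2" by auto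
  from convolution_uniformly_close[OF B e', of M z] obtain d2 where d2: "d2 > 0"
    "\<And>w h. norm w \<le> M \<Longrightarrow> norm h < d2 \<Longrightarrow> norm (B (z + h - w) - B (z - w)) < e'/2" by auto
  define d where "d = min d1 d2"
  have lin: "norm (f (y - w) - f (z - w) - (A (z - w) * (y - z) + B (z - w) * cnj (y - z))) \<le> e' * norm (y - z)"
    if "norm w \<le> M" "norm (y - z) < d" for w y
  proof -
    let ?S = "ball (z - w) d"
    have "norm (f (y - w) - f (z - w) - ((A (z - w) * ((y - w) - (z - w)) + B (z - w) * cnj ((y - w) - (z - w)))))
        \<le> norm ((y - w) - (z - w)) * e'"
    proof (rule differentiable_bound_linearization[where S="?S" and f'="\<lambda>u h. A u * h + B u * cnj h"])
      fix t :: real assume t: "t \<in> {0..1}"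
      have "norm (t *\<^sub>R (y - z)) \<le> norm (y - z)" using t by (simp add: mult_left_le_one_le)
      then show "(z - w) + t *\<^sub>R ((y - w) - (z - w)) \<in> ball (z - w) d"
        using that(2) by (simp add: dist_norm)
    next
      fix u assume "u \<in> ?S"
      show "(f has_derivative (\<lambda>h. A u * h + B u * cnj h)) (at u within ?S)"
        using f[of u] unfolding has_wirtinger_def by (rule has_derivative_at_withinI)
      have u: "norm (u - (z - w)) < d" using \<open>u \<in> ?S\<close> by (simp add: dist_norm norm_minus_commute)
      have ab: "norm (A u - A (z - w)) \<le> e'/2" "norm (B u - B (z - w)) \<le> e'/2"
        using d1(2)[OF that(1), of "u - (z - w)"] d2(2)[OF that(1), of "u - (z - w)"] u by (auto simp: d_def)
      show "onorm ((\<lambda>h. A u * h + B u * cnj h) - (\<lambda>h. A (z - w) * h + B (z - w) * cnj h)) \<le> e'"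
      proof (rule onorm_le)
        fix h
        have "((\<lambda>h. A u * h + B u * cnj h) - (\<lambda>h. A (z - w) * h + B (z - w) * cnj h)) h =
           (A u - A (z - w)) * h + (B u - B (z - w)) * cnj h" by (simp add: algebra_simps)
        also have "norm \<dots> \<le> norm (A u - A (z - w)) * norm h + norm (B u - B (z - w)) * norm h"
          by (rule order_trans[OF norm_triangle_ineq]) (simp add: norm_mult)
        also have "\<dots> \<le> e'/2 * norm h + e'/2 * norm h"
          by (intro add_mono mult_right_mono ab) auto
        finally show "norm (((\<lambda>h. A u * h + B u * cnj h) - (\<lambda>h. A (z - w) * h + B (z - w) * cnj h)) h) \<le> e' * norm h"
          by simp
      qed
    qed (use d1 d2 in \<open>auto simp: d_def\<close>)
    then show ?thesis by (simp add: mult.commute)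
  qed
  show "\<exists>d>0. \<forall>y. norm (y - z) < d \<longrightarrow>
       norm ((LINT w|lborel. f (y - w) * g w) - (LINT w|lborel. f (z - w) * g w) -
         ((LINT w|lborel. A (z - w) * g w) * (y - z) + (LINT w|lborel. B (z - w) * g w) * cnj (y - z)))
       \<le> e * norm (y - z)"
  proof (intro exI[of _ d] conjI allI impI)
    show "d > 0" using d1 d2 by (simp add: d_def)
    fix y assume y: "norm (y - z) < d"
    let ?L = "\<lambda>w. (f (y - w) * g w - f (z - w) * g w) - ((A (z - w) * g w) * (y - z) + (B (z - w) * g w) * cnj (y - z))"
    have i1: "integrable lborel (\<lambda>w. f (y - w) * g w)" and i2: "integrable lborel (\<lambda>w. f (z - w) * g w)"
      and i3: "integrable lborel (\<lambda>w. A (z - w) * g w * (y - z))"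
      and i4: "integrable lborel (\<lambda>w. B (z - w) * g w * cnj (y - z))"
      by (intro integrable_mult_left I fc A B; assumption)+
    note i12 = Bochner_Integration.integrable_diff[OF i1 i2] and i34 = Bochner_Integration.integrable_add[OF i3 i4]
    have iL: "integrable lborel ?L" by (rule Bochner_Integration.integrable_diff[OF i12 i34])
    have eq: "(LINT w|lborel. f (y - w) * g w) - (LINT w|lborel. f (z - w) * g w) -
         ((LINT w|lborel. A (z - w) * g w) * (y - z) + (LINT w|lborel. B (z - w) * g w) * cnj (y - z)) =
         (LINT w|lborel. ?L w)"
      by (simp only: Bochner_Integration.integral_diff[OF i12 i34] Bochner_Integration.integral_diff[OF i1 i2]
        Bochner_Integration.integral_add[OF i3 i4] integral_mult_left_zero)
    have "norm (LINT w|lborel. ?L w) \<le> (LINT w|lborel. (e' * norm (y - z)) * norm (g w))"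
    proof (rule Bochner_Integration.integral_norm_bound_integral[OF iL])
      fix w
      have "?L w = (f (y - w) - f (z - w) - (A (z - w) * (y - z) + B (z - w) * cnj (y - z))) * g w"
        by (simp add: algebra_simps)
      then show "norm (?L w) \<le> (e' * norm (y - z)) * norm (g w)"
        using lin[OF _ y, of w] g(2)[of w] by (cases "norm w \<le> M") (auto simp: norm_mult intro!: mult_right_mono)
    qed (use g in auto)
    also have "\<dots> = (e' * norm (y - z)) * G"
      unfolding integral_mult_right_zero G_def ..
    also have "\<dots> = (e' * G) * norm (y - z)" by simp
    also have "\<dots> \<le> e * norm (y - z)"
      using \<open>e > 0\<close> G by (intro mult_right_mono) (auto simp: e'_def field_simps)
    finally show "norm ((LINT w|lborel. f (y - w) * g w) - (LINT w|lborel. f (z - w) * g w) -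
         ((LINT w|lborel. A (z - w) * g w) * (y - z) + (LINT w|lborel. B (z - w) * g w) * cnj (y - z)))
       \<le> e * norm (y - z)" unfolding eq .
  qed
qed

section \<open>The Cauchy transform\<close>

text \<open>
  A \<open>C\<^sup>1\<close> function that agrees with \<open>t\<close> for \<open>t \<ge> \<epsilon>\<^sup>2\<close> and stays positive at \<open>0\<close>.
\<close>

definition kernel_denom :: "real \<Rightarrow> real \<Rightarrow> real" where
  "kernel_denom \<epsilon> t = t + (max 0 (\<epsilon>\<^sup>2 - t))\<^sup>2 / \<epsilon>\<^sup>2"

text \<open>
  A \<open>C\<^sup>1\<close> regularisation of the kernel \<open>1 / z = cnj z / |z|\<^sup>2\<close>, equal to it for \<open>|z| \<ge> \<epsilon>\<close>.
\<close>

definition cauchy_kernel :: "real \<Rightarrow> complex \<Rightarrow> complex" where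
  "cauchy_kernel \<epsilon> z = cnj z * inverse (of_real (kernel_denom \<epsilon> ((norm z)\<^sup>2)))"

text \<open>
  The derivative \<open>\<partial>/\<partial>zbar\<close> of the regularised kernel. It is nonnegative and supported in \<open>|z| \<le> \<epsilon>\<close>.
\<close>

definition kernel_bump :: "real \<Rightarrow> complex \<Rightarrow> real" where
  "kernel_bump \<epsilon> z = max 0 (\<epsilon>\<^sup>2 - (norm z)\<^sup>2) * (\<epsilon>\<^sup>2 + (norm z)\<^sup>2) / \<epsilon>\<^sup>2
     / (kernel_denom \<epsilon> ((norm z)\<^sup>2))\<^sup>2"

lemma kernel_denom_pos:
  assumes "\<epsilon> > 0" "0 \<le> t" shows "kernel_denom \<epsilon> t > 0"
proof (cases "t = 0")
  case True
  then show ?thesis using assms by (simp add: kernel_denom_def max_def)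
next
  case False
  then have "t > 0" using assms by simp
  then show ?thesis unfolding kernel_denom_def by (intro add_pos_nonneg) auto
qed

lemma kernel_denom_ge: "t \<le> kernel_denom \<epsilon> t"
  unfolding kernel_denom_def by simp

lemma DERIV_kernel_denom:
  assumes "\<epsilon> > 0"
  shows "(kernel_denom \<epsilon> has_real_derivative 1 - 2 * max 0 (\<epsilon>\<^sup>2 - t) / \<epsilon>\<^sup>2) (at t)"
proof -
  have "((\<lambda>t. \<epsilon>\<^sup>2 - t) has_real_derivative -1) (at t)" by (auto intro!: derivative_eq_intros)
  from DERIV_chain'[OF this DERIV_pos_part_square]
  have "((\<lambda>t. t + (max 0 (\<epsilon>\<^sup>2 - t))\<^sup>2 * inverse (\<epsilon>\<^sup>2)) has_real_derivative
      1 + (2 * max 0 (\<epsilon>\<^sup>2 - t) * -1) * inverse (\<epsilon>\<^sup>2)) (at t)"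
    by (intro DERIV_add DERIV_ident DERIV_cmult_right)
  then show ?thesis by (simp add: kernel_denom_def[abs_def] divide_inverse)
qed

lemma cauchy_kernel_C1:
  assumes "\<epsilon> > 0"
  obtains A where "continuous_on UNIV A" "continuous_on UNIV (kernel_bump \<epsilon>)"
    "\<And>z. has_wirtinger (cauchy_kernel \<epsilon>) (A z) (of_real (kernel_bump \<epsilon> z)) z"
proof -
  define d' where "d' t = 1 - 2 * max 0 (\<epsilon>\<^sup>2 - t) / \<epsilon>\<^sup>2" for t
  define D where "D z = kernel_denom \<epsilon> ((norm z)\<^sup>2)" for z :: complex
  have pos: "D z > 0" for z unfolding D_def by (rule kernel_denom_pos) (use assms in auto)
  have D: "has_wirtinger (\<lambda>z. of_real (D z)) (d' ((norm z)\<^sup>2) * cnj z) (d' ((norm z)\<^sup>2) * z) z" for z :: complex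
    unfolding D_def d'_def
    by (rule has_wirtinger_real_compose[OF has_wirtinger_norm_square DERIV_kernel_denom[OF assms]])
  define A where "A z = - (cnj z * (d' ((norm z)\<^sup>2) * cnj z)) / (of_real (D z))\<^sup>2" for z
  have cD: "continuous_on UNIV D"
    unfolding D_def kernel_denom_def using assms by (intro continuous_intros) auto
  have cd: "continuous_on UNIV (\<lambda>z::complex. d' ((norm z)\<^sup>2))"
    unfolding d'_def using assms by (intro continuous_intros) auto
  have "has_wirtinger (cauchy_kernel \<epsilon>) (A z) (of_real (kernel_bump \<epsilon> z)) z" for z
  proof -
    have inv: "has_wirtinger (\<lambda>z. inverse (of_real (D z)))
      (- (inverse (of_real (D z)) ^ Suc (Suc 0)) * (d' ((norm z)\<^sup>2) * cnj z))
      (- (inverse (of_real (D z)) ^ Suc (Suc 0)) * (d' ((norm z)\<^sup>2) * z)) z"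
      by (rule has_wirtinger_holomorphic_compose[OF D DERIV_inverse]) (use pos[of z] in auto)
    let ?i = "inverse (of_real (D z)) :: complex"
    have 1: "0 * ?i + cnj z * (- (?i ^ Suc (Suc 0)) * (d' ((norm z)\<^sup>2) * cnj z)) = A z"
      by (simp add: A_def power2_eq_square divide_inverse)
    define t where "t = (norm z)\<^sup>2"
    have zz: "cnj z * z = of_real t" unfolding t_def complex_norm_square by (simp add: mult.commute)
    have Dp: "D z \<noteq> 0" using pos[of z] by simp
    have num: "D z - t * d' t = max 0 (\<epsilon>\<^sup>2 - t) * (\<epsilon>\<^sup>2 + t) / \<epsilon>\<^sup>2"
      unfolding D_def t_def[symmetric] kernel_denom_def d'_def using assms
      by (simp add: field_simps power2_eq_square max_def)
    have "cnj 1 * ?i + cnj z * (- (?i ^ Suc (Suc 0)) * (d' ((norm z)\<^sup>2) * z)) =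
        ?i - (cnj z * z) * of_real (d' t) * ?i\<^sup>2"
      by (simp add: power2_eq_square algebra_simps t_def)
    also have "\<dots> = of_real (inverse (D z) - t * d' t * (inverse (D z))\<^sup>2)"
      unfolding zz by simp
    also have "inverse (D z) - t * d' t * (inverse (D z))\<^sup>2 = (D z - t * d' t) / (D z)\<^sup>2"
      using Dp by (simp add: field_simps power2_eq_square)
    also have "\<dots> = kernel_bump \<epsilon> z"
      unfolding num unfolding kernel_bump_def D_def t_def ..
    finally have 2: "cnj 1 * ?i + cnj z * (- (?i ^ Suc (Suc 0)) * (d' ((norm z)\<^sup>2) * z)) = of_real (kernel_bump \<epsilon> z)" .
    have 3: "cauchy_kernel \<epsilon> = (\<lambda>z. cnj z * inverse (of_real (D z)))"
      by (simp add: fun_eq_iff cauchy_kernel_def D_def)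
    show ?thesis
      unfolding 3
      by (rule has_wirtinger_eq_rhs[OF has_wirtinger_mult[OF has_wirtinger_cnj[OF has_wirtinger_ident] inv]])
        (use 1 2 in simp_all)
  qed
  moreover have "continuous_on UNIV A"
    unfolding A_def using pos by (intro continuous_intros cD cd) (auto simp: less_imp_neq[symmetric])
  moreover have "continuous_on UNIV (kernel_bump \<epsilon>)"
    unfolding kernel_bump_def D_def[symmetric] using pos assms
    by (intro continuous_intros cD) (auto simp: less_imp_neq[symmetric])
  ultimately show ?thesis by (rule that[rotated -1])
qed

lemma cauchy_kernel_outside:
  assumes "\<epsilon> > 0" "\<epsilon> \<le> norm z"
  shows "cauchy_kernel \<epsilon> z = 1 / z" "kernel_bump \<epsilon> z = 0"
proof -
  have t: "\<epsilon>\<^sup>2 \<le> (norm z)\<^sup>2" using assms by (simp add: power_mono)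
  then have "kernel_denom \<epsilon> ((norm z)\<^sup>2) = (norm z)\<^sup>2" by (simp add: kernel_denom_def max_def)
  then show "cauchy_kernel \<epsilon> z = 1 / z"
    using assms by (simp only: cauchy_kernel_def complex_norm_square) (auto simp: field_simps)
  show "kernel_bump \<epsilon> z = 0" using t by (simp add: kernel_bump_def)
qed

lemma cauchy_kernel_bound:
  assumes "\<epsilon> > 0"
  shows "norm (cauchy_kernel \<epsilon> z) \<le> 1 / norm z"
proof (cases "z = 0")
  case False
  have "norm (cauchy_kernel \<epsilon> z) = norm z / kernel_denom \<epsilon> ((norm z)\<^sup>2)"
    using kernel_denom_pos[OF assms, of "(norm z)\<^sup>2"]
    by (simp add: cauchy_kernel_def norm_mult norm_inverse divide_inverse)
  also have "\<dots> \<le> norm z / (norm z)\<^sup>2"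
    by (intro divide_left_mono kernel_denom_ge mult_pos_pos kernel_denom_pos assms) (use False in auto)
  finally show ?thesis using False by (simp add: power2_eq_square)
qed (simp add: cauchy_kernel_def)

lemma kernel_bump_nonneg: "0 \<le> kernel_bump \<epsilon> z"
  by (simp add: kernel_bump_def)

text \<open>
  Homogeneity, which makes the mass of the bump independent of \<open>\<epsilon>\<close>.
\<close>

lemma kernel_bump_scale:
  assumes "\<epsilon> > 0"
  shows "kernel_bump \<epsilon> (\<epsilon> *\<^sub>R z) = kernel_bump 1 z / \<epsilon>\<^sup>2"
proof -
  have e: "(norm (\<epsilon> *\<^sub>R z))\<^sup>2 = \<epsilon>\<^sup>2 * (norm z)\<^sup>2"
    by (simp add: power_mult_distrib)
  have m: "max 0 (\<epsilon>\<^sup>2 - \<epsilon>\<^sup>2 * x) = \<epsilon>\<^sup>2 * max 0 (1 - x)"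
    "\<epsilon>\<^sup>2 + \<epsilon>\<^sup>2 * x = \<epsilon>\<^sup>2 * (1 + x)" for x
  proof -
    have "max 0 (\<epsilon>\<^sup>2 * (1 - x)) = \<epsilon>\<^sup>2 * max 0 (1 - x)"
      using assms by (auto simp: max_def mult_le_0_iff zero_le_mult_iff)
    then show "max 0 (\<epsilon>\<^sup>2 - \<epsilon>\<^sup>2 * x) = \<epsilon>\<^sup>2 * max 0 (1 - x)"
      by (simp only: right_diff_distrib mult_1_right)
  qed (simp add: distrib_left)
  have k: "kernel_denom \<epsilon> (\<epsilon>\<^sup>2 * t) = \<epsilon>\<^sup>2 * kernel_denom 1 t" for t
    unfolding kernel_denom_def m using assms
    by (simp add: power_mult_distrib field_simps power2_eq_square)
  have alg: "(s * X) * (s * Y) / s / (s * K)\<^sup>2 = X * Y / K\<^sup>2 / s" if "s \<noteq> 0" for s X Y K :: real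
    using that by (cases "K = 0") (auto simp: field_simps power2_eq_square)
  show ?thesis
    unfolding kernel_bump_def e k one_power2 m by (subst alg) (use assms in auto)
qed

lemma kernel_bump_integrable:
  assumes "\<epsilon> > 0"
  shows "integrable lborel (kernel_bump \<epsilon>)"
proof -
  obtain A where "continuous_on UNIV (kernel_bump \<epsilon>)" using cauchy_kernel_C1[OF assms] by metis
  then have "integrable lborel (\<lambda>x. indicator (cball 0 \<epsilon>) x *\<^sub>R kernel_bump \<epsilon> x)"
    by (intro borel_integrable_compact) (auto intro: continuous_on_subset)
  also have "(\<lambda>x. indicator (cball 0 \<epsilon>) x *\<^sub>R kernel_bump \<epsilon> x) = kernel_bump \<epsilon>"
    using cauchy_kernel_outside(2)[OF assms] by (auto simp: fun_eq_iff indicator_def)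
  finally show ?thesis .
qed

text \<open>
  The constant that normalises the Cauchy kernel, that is, \<open>\<pi>\<close>.
\<close>

definition cauchy_mass :: real where
  "cauchy_mass = (LINT w|lborel. kernel_bump 1 w)"

lemma kernel_bump_integral:
  assumes "\<epsilon> > 0"
  shows "(LINT w|lborel. kernel_bump \<epsilon> w) = cauchy_mass"
proof -
  have "(LINT w|lborel. kernel_bump \<epsilon> w) =
      \<bar>\<epsilon>\<bar> ^ DIM(complex) *\<^sub>R (LINT w|lborel. kernel_bump \<epsilon> (0 + \<epsilon> *\<^sub>R w))"
    using assms borel_measurable_integrable[OF kernel_bump_integrable[OF assms]]
    by (intro lborel_integral_affine) auto
  also have "(\<lambda>w. kernel_bump \<epsilon> (0 + \<epsilon> *\<^sub>R w)) = (\<lambda>w. kernel_bump 1 w / \<epsilon>\<^sup>2)"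
    using kernel_bump_scale[OF assms] by (simp add: fun_eq_iff)
  finally show ?thesis using assms by (simp add: cauchy_mass_def)
qed

lemma cauchy_mass_pos: "0 < cauchy_mass"
proof -
  obtain A where c: "continuous_on UNIV (kernel_bump 1)" using cauchy_kernel_C1[of 1] by (metis zero_less_one)
  have "kernel_bump 1 0 > 0" by (simp add: kernel_bump_def kernel_denom_def)
  have "cauchy_mass \<noteq> 0"
  proof
    assume "cauchy_mass = 0"
    then have "AE w in lborel. kernel_bump 1 w = 0"
      unfolding cauchy_mass_def
      by (subst (asm) integral_nonneg_eq_0_iff_AE) (auto simp: kernel_bump_integrable kernel_bump_nonneg)
    then have "AE w in lborel. w \<in> {w. kernel_bump 1 w = 0}" by simp
    moreover have "closed {w. kernel_bump 1 w = 0}"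
      using c by (intro closed_Collect_eq) auto
    ultimately have "kernel_bump 1 w = 0" for w
      using mem_closed_if_AE_lebesgue[of "{w. kernel_bump 1 w = 0}" w] by (auto dest: AE_completion)
    with \<open>kernel_bump 1 0 > 0\<close> show False by simp
  qed
  moreover have "cauchy_mass \<ge> 0" unfolding cauchy_mass_def
    by (rule Bochner_Integration.integral_nonneg) (rule kernel_bump_nonneg)
  ultimately show ?thesis by simp
qed

text \<open>
  The convolution of \<open>f\<close> with \<open>1 / (\<pi> w)\<close>. The difference \<open>z - w\<close> is put into \<open>f\<close> so
  that derivatives fall on \<open>f\<close>.
\<close>

definition cauchy_transform :: "(complex \<Rightarrow> complex) \<Rightarrow> complex \<Rightarrow> complex" where
  "cauchy_transform f z = (LINT w|lborel. f (z - w) * (1 / w)) / cauchy_mass"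

lemma cauchy_transform_eq_convolution:
  assumes "\<And>z. r \<le> norm z \<Longrightarrow> f z = 0" "norm z \<le> s"
  shows "cauchy_transform f z =
    (LINT w|lborel. f (z - w) * (of_real (indicator (ball 0 (r + s)) w / cauchy_mass) / w))"
proof -
  have "f (z - w) * (of_real (indicator (ball 0 (r + s)) w / cauchy_mass) / w) = f (z - w) * (1 / w) / cauchy_mass" for w
  proof (cases "norm w < r + s")
    case False
    then have "f (z - w) = 0"
      using norm_triangle_ineq2[of w z] assms(2) by (intro assms(1)) (simp add: norm_minus_commute)
    then show ?thesis by simp
  qed simp
  then show ?thesis by (simp only: cauchy_transform_def integral_divide_zero)
qed

lemma indicator_ball_measurable:
  "(\<lambda>w::complex. of_real (indicator (ball 0 M) w) :: complex) \<in> borel_measurable borel"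
  by (rule measurable_compose[OF borel_measurable_indicator borel_measurable_of_real]) auto

lemma truncated_cauchy_kernel_integrable:
  "integrable lborel (\<lambda>w::complex. of_real (indicator (ball 0 M) w / c) / w)"
proof (rule Bochner_Integration.integrable_bound)
  show "integrable lborel (\<lambda>w::complex. (1 / c) * (indicator (ball 0 M) w / norm w))"
    by (intro integrable_mult_right integrable_inverse_norm_on_ball)
  show "(\<lambda>w::complex. of_real (indicator (ball 0 M) w / c) / w :: complex) \<in> borel_measurable lborel"
    by (auto intro!: borel_measurable_divide indicator_ball_measurable)
  show "AE w in lborel. norm (of_real (indicator (ball 0 M) w / c) / w :: complex) \<le>
      norm ((1 / c) * (indicator (ball 0 M) w / norm w))"
    by (rule AE_I2) (auto simp: norm_divide norm_mult indicator_def abs_mult)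
qed

lemma compact_support_derivatives_zero:
  assumes "\<And>z. r \<le> norm z \<Longrightarrow> f z = 0" "has_wirtinger f A B z" "r < norm z"
  shows "A = 0" "B = 0"
proof -
  have "has_wirtinger f 0 0 z"
    by (rule has_wirtinger_transform[OF has_wirtinger_const, of "- cball 0 r" _ 0])
      (use assms in \<open>auto simp: open_Compl\<close>)
  then show "A = 0" "B = 0" using has_wirtinger_unique assms(2) by blast+
qed

lemma compact_support_bounded:
  fixes f :: "complex \<Rightarrow> complex"
  assumes "continuous_on UNIV f" "\<And>z. r \<le> norm z \<Longrightarrow> f z = 0"
  obtains C where "0 \<le> C" "\<And>z. norm (f z) \<le> C"
proof -
  have "compact (f ` cball 0 r)"
    by (intro compact_continuous_image continuous_on_subset[OF assms(1)]) auto
  then obtain C where C: "\<And>w. w \<in> cball 0 r \<Longrightarrow> norm (f w) \<le> C"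
    using compact_imp_bounded bounded_iff by (metis (no_types, lifting) imageI)
  have "norm (f z) \<le> max 0 C" for z using C[of z] assms(2)[of z] by (cases "norm z \<le> r") auto
  with that[of "max 0 C"] show thesis by simp
qed

lemma cauchy_transform_has_wirtinger_aux:
  fixes f A B :: "complex \<Rightarrow> complex"
  assumes A: "continuous_on UNIV A" and B: "continuous_on UNIV B"
    and f: "\<And>z. has_wirtinger f (A z) (B z) z" and supp: "\<And>z. r \<le> norm z \<Longrightarrow> f z = 0"
  shows "has_wirtinger (cauchy_transform f) (cauchy_transform A z) (cauchy_transform B z) z"
    "continuous_on UNIV (cauchy_transform A)"
proof -
  have supp': "r + 1 \<le> norm z \<Longrightarrow> f z = 0" "r + 1 \<le> norm z \<Longrightarrow> A z = 0" "r + 1 \<le> norm z \<Longrightarrow> B z = 0" for z :: complex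
    using supp[of z] compact_support_derivatives_zero[OF supp f] by auto
  define g where "g s w = (of_real (indicator (ball 0 (r + 1 + s)) w / cauchy_mass) / w :: complex)" for s w
  have g: "integrable lborel (g s)" "\<And>w. r + 1 + s \<le> norm w \<Longrightarrow> g s w = 0" for s
    unfolding g_def by (rule truncated_cauchy_kernel_integrable) auto
  have conv: "cauchy_transform F z = (LINT w|lborel. F (z - w) * g s w)"
    if "F \<in> {f, A, B}" "norm z \<le> s" for F z s
    unfolding g_def by (rule cauchy_transform_eq_convolution) (use that supp' in auto)
  define s where "s = norm z + 1"
  have "has_wirtinger (\<lambda>z. LINT w|lborel. f (z - w) * g s w)
      (LINT w|lborel. A (z - w) * g s w) (LINT w|lborel. B (z - w) * g s w) z"
    by (rule has_wirtinger_convolution[OF A B f g])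
  then have "has_wirtinger (\<lambda>z. LINT w|lborel. f (z - w) * g s w) (cauchy_transform A z) (cauchy_transform B z) z"
    using conv[of A z s] conv[of B z s] by (simp add: s_def)
  then show "has_wirtinger (cauchy_transform f) (cauchy_transform A z) (cauchy_transform B z) z"
    by (rule has_wirtinger_transform[of _ _ _ _ "ball 0 s"]) (use conv[of f _ s] in \<open>auto simp: s_def\<close>)
  show "continuous_on UNIV (cauchy_transform A)"
  proof (rule continuous_at_imp_continuous_on, rule ballI)
    fix z :: complex
    have "continuous_on (ball 0 (norm z + 1)) (\<lambda>x. LINT w|lborel. A (x - w) * g (norm z + 1) w)"
      by (rule continuous_on_subset[OF convolution_continuous[OF A g]]) auto
    then have "continuous_on (ball 0 (norm z + 1)) (cauchy_transform A)"
      by (rule continuous_on_eq) (use conv[of A _ "norm z + 1"] in auto)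
    then show "isCont (cauchy_transform A) z"
      by (rule continuous_on_interior) (simp add: interior_open)
  qed
qed

text \<open>
  The Cauchy-Pompeiu formula for compactly supported functions. Let \<open>k\<close> be the regularised kernel. The
  convolution of \<open>f\<close> and \<open>k\<close> can be differentiated in two ways: with the derivative on \<open>f\<close>, its
  \<open>\<partial>/\<partial>zbar\<close> is \<open>\<integral> B (z - w) k w\<close>, and with the derivative on \<open>k\<close>, it is \<open>\<integral> f (z - w) bump w\<close>. As \<open>\<epsilon>\<close> tends
  to \<open>0\<close>, the former tends to \<open>\<integral> B (z - w) / w\<close> and the latter, since the bump concentrates at \<open>0\<close>, to
  \<open>f z\<close> times the mass of the bump.
\<close>

theorem cauchy_transform_dbar_inverse:
  fixes f A B :: "complex \<Rightarrow> complex"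
  assumes A: "continuous_on UNIV A" and B: "continuous_on UNIV B"
    and f: "\<And>z. has_wirtinger f (A z) (B z) z" and supp: "\<And>z. r \<le> norm z \<Longrightarrow> f z = 0"
  shows "cauchy_transform B z = f z"
proof -
  have fc: "continuous_on UNIV f" by (intro continuous_at_imp_continuous_on ballI has_wirtinger_continuous[OF f])
  have suppB: "r + 1 \<le> norm z \<Longrightarrow> B z = 0" for z :: complex
    using compact_support_derivatives_zero[OF supp f] by auto
  obtain b where b: "0 \<le> b" "\<And>z. norm (B z) \<le> b" using compact_support_bounded[OF B suppB] by metis
  define M where "M = \<bar>r\<bar> + norm z + 2"
  define X where "X = (LINT w|lborel. B (z - w) * (of_real (indicator (ball 0 M) w / 1) / w))"
  have X: "cauchy_transform B z = X / cauchy_mass"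
  proof -
    have "B (z - w) * (of_real (indicator (ball 0 M) w / 1) / w) = B (z - w) * (1 / w)" for w
    proof (cases "norm w < M")
      case False
      then have "B (z - w) = 0"
        using norm_triangle_ineq2[of w z] by (intro suppB) (simp add: norm_minus_commute M_def)
      then show ?thesis by simp
    qed simp
    then show ?thesis by (simp only: cauchy_transform_def X_def)
  qed
  \<comment> \<open>the error of regularisation, estimated by \<open>\<epsilon>\<close> and the oscillation \<open>\<omega>\<close> of \<open>f\<close> on the disc of radius \<open>\<epsilon>\<close> about \<open>z\<close>\<close>
  have est: "norm (X - f z * cauchy_mass) \<le> 2 * b * (\<epsilon> * planar_riesz) + \<omega> * cauchy_mass"
    if \<epsilon>: "0 < \<epsilon>" and \<omega>: "\<And>w. norm w < \<epsilon> \<Longrightarrow> norm (f (z - w) - f z) \<le> \<omega>" for \<epsilon> \<omega>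
  proof -
    obtain A' where k: "continuous_on UNIV A'" "continuous_on UNIV (kernel_bump \<epsilon>)"
      "\<And>z. has_wirtinger (cauchy_kernel \<epsilon>) (A' z) (of_real (kernel_bump \<epsilon> z)) z"
      by (rule cauchy_kernel_C1[OF \<epsilon>]) blast
    have kb: "continuous_on UNIV (\<lambda>z. of_real (kernel_bump \<epsilon> z) :: complex)"
      by (intro continuous_intros k)
    have kc: "continuous_on UNIV (cauchy_kernel \<epsilon>)"
      by (intro continuous_at_imp_continuous_on ballI has_wirtinger_continuous[OF k(3)])
    define g where "g w = of_real (indicator (ball 0 M) w) * cauchy_kernel \<epsilon> w" for w
    have gm: "g \<in> borel_measurable lborel"
      unfolding g_def using borel_measurable_continuous_onI[OF kc]
      by (auto intro!: borel_measurable_times indicator_ball_measurable)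
    have gi: "integrable lborel g"
    proof (rule Bochner_Integration.integrable_bound[OF integrable_inverse_norm_on_ball[of M] gm])
      show "AE w in lborel. norm (g w) \<le> norm (indicator (ball 0 M) w / norm w :: real)"
        using cauchy_kernel_bound[OF \<epsilon>] by (auto simp: g_def norm_mult indicator_def)
    qed
    have g0: "\<And>w. M \<le> norm w \<Longrightarrow> g w = 0" by (simp add: g_def)
    have fi: "integrable lborel f"
    proof -
      have "integrable lborel (\<lambda>x. indicator (cball 0 r) x *\<^sub>R f x)"
        by (intro borel_integrable_compact) (auto intro: continuous_on_subset[OF fc])
      also have "(\<lambda>x. indicator (cball 0 r) x *\<^sub>R f x) = f"
        using supp by (auto simp: fun_eq_iff indicator_def)
      finally show ?thesis .
    qed
    have 1: "has_wirtinger (\<lambda>z. LINT w|lborel. f (z - w) * g w)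
        (LINT w|lborel. A (z - w) * g w) (LINT w|lborel. B (z - w) * g w) z"
      by (rule has_wirtinger_convolution[OF A B f gi g0])
    have 2: "has_wirtinger (\<lambda>z. LINT w|lborel. cauchy_kernel \<epsilon> (z - w) * f w)
        (LINT w|lborel. A' (z - w) * f w) (LINT w|lborel. of_real (kernel_bump \<epsilon> (z - w)) * f w) z"
      by (rule has_wirtinger_convolution[OF k(1) kb k(3) fi supp])
    \<comment> \<open>the two forms of the convolution, related by the substitution of \<open>x - w\<close> for \<open>w\<close>\<close>
    have same: "(LINT w|lborel. cauchy_kernel \<epsilon> (x - w) * f w) = (LINT w|lborel. f (x - w) * g w)"
      if "x \<in> ball 0 (norm z + 1)" for x
    proof -
      have "(LINT w|lborel. cauchy_kernel \<epsilon> (x - w) * f w) =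
          (LINT w|lborel. cauchy_kernel \<epsilon> (x - (x - w)) * f (x - w))"
        by (rule lborel_integral_reflect[symmetric])
          (intro borel_measurable_continuous_onI continuous_on_mult fc continuous_on_compose2[OF kc] continuous_intros, auto)
      also have "\<dots> = (LINT w|lborel. f (x - w) * g w)"
      proof (rule Bochner_Integration.integral_cong[OF refl])
        fix w
        show "cauchy_kernel \<epsilon> (x - (x - w)) * f (x - w) = f (x - w) * g w"
        proof (cases "norm w < M")
          case False
          then have "f (x - w) = 0"
            using norm_triangle_ineq2[of w x] that by (intro supp) (simp add: norm_minus_commute M_def)
          then show ?thesis by simp
        qed (simp add: g_def)
      qed
      finally show ?thesis .
    qed
    have "(LINT w|lborel. B (z - w) * g w) = (LINT w|lborel. of_real (kernel_bump \<epsilon> (z - w)) * f w)"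
      by (rule has_wirtinger_unique(2)[OF 1 has_wirtinger_transform[OF 2, of "ball 0 (norm z + 1)"]])
        (use same in auto)
    also have "\<dots> = (LINT w|lborel. of_real (kernel_bump \<epsilon> (z - (z - w))) * f (z - w))"
      by (rule lborel_integral_reflect[symmetric])
        (intro borel_measurable_continuous_onI continuous_on_mult fc continuous_on_compose2[OF kb] continuous_intros, auto)
    finally have eq: "(LINT w|lborel. B (z - w) * g w) = (LINT w|lborel. f (z - w) * of_real (kernel_bump \<epsilon> w))"
      by (simp add: mult.commute)
    have bi: "integrable lborel (\<lambda>w. f (z - w) * of_real (kernel_bump \<epsilon> w))"
      by (rule convolution_integrable[OF fc, of _ \<epsilon>])
        (auto intro: kernel_bump_integrable[OF \<epsilon>] simp: cauchy_kernel_outside[OF \<epsilon>])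
    have ci: "integrable lborel (\<lambda>w. f z * of_real (kernel_bump \<epsilon> w))"
      using kernel_bump_integrable[OF \<epsilon>] by simp
    have Ai: "integrable lborel (\<lambda>w. B (z - w) * (of_real (indicator (ball 0 M) w / 1) / w))"
      by (rule convolution_integrable[where M=M, OF B truncated_cauchy_kernel_integrable]) auto
    have Bi: "integrable lborel (\<lambda>w. B (z - w) * g w)"
      by (rule convolution_integrable[OF B gi g0])
    have p1: "norm ((LINT w|lborel. f (z - w) * of_real (kernel_bump \<epsilon> w)) - f z * cauchy_mass) \<le> \<omega> * cauchy_mass"
    proof -
      have "(LINT w|lborel. f (z - w) * of_real (kernel_bump \<epsilon> w)) - f z * cauchy_mass =
        (LINT w|lborel. f (z - w) * of_real (kernel_bump \<epsilon> w) - f z * of_real (kernel_bump \<epsilon> w))"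
        unfolding Bochner_Integration.integral_diff[OF bi ci]
        by (simp add: kernel_bump_integral[OF \<epsilon>])
      moreover have "norm (LINT w|lborel. f (z - w) * of_real (kernel_bump \<epsilon> w) - f z * of_real (kernel_bump \<epsilon> w))
        \<le> (LINT w|lborel. \<omega> * kernel_bump \<epsilon> w)"
      proof (rule Bochner_Integration.integral_norm_bound_integral)
        show "integrable lborel (\<lambda>w. \<omega> * kernel_bump \<epsilon> w)" using kernel_bump_integrable[OF \<epsilon>] by simp
        fix w
        have "norm (f (z - w) * of_real (kernel_bump \<epsilon> w) - f z * of_real (kernel_bump \<epsilon> w)) =
          norm (f (z - w) - f z) * kernel_bump \<epsilon> w"
          by (simp add: left_diff_distrib[symmetric] norm_mult kernel_bump_nonneg)
        also have "\<dots> \<le> \<omega> * kernel_bump \<epsilon> w"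
          using \<omega>[of w] cauchy_kernel_outside(2)[OF \<epsilon>, of w]
          by (cases "norm w < \<epsilon>") (auto intro: mult_right_mono kernel_bump_nonneg)
        finally show "norm (f (z - w) * of_real (kernel_bump \<epsilon> w) - f z * of_real (kernel_bump \<epsilon> w)) \<le> \<omega> * kernel_bump \<epsilon> w" .
      qed (rule Bochner_Integration.integrable_diff[OF bi ci])
      ultimately show ?thesis by (simp add: kernel_bump_integral[OF \<epsilon>])
    qed
    have p2: "norm (X - (LINT w|lborel. B (z - w) * g w)) \<le> 2 * b * (\<epsilon> * planar_riesz)"
    proof -
      have "X - (LINT w|lborel. B (z - w) * g w) =
        (LINT w|lborel. B (z - w) * (of_real (indicator (ball 0 M) w / 1) / w) - B (z - w) * g w)"
        unfolding X_def Bochner_Integration.integral_diff[OF Ai Bi] ..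
      moreover have "norm (LINT w|lborel. B (z - w) * (of_real (indicator (ball 0 M) w / 1) / w) - B (z - w) * g w)
        \<le> (LINT w|lborel. (2 * b) * (indicator (ball (0::complex) \<epsilon>) w / norm w))"
      proof (rule Bochner_Integration.integral_norm_bound_integral)
        show "integrable lborel (\<lambda>w::complex. (2 * b) * (indicator (ball 0 \<epsilon>) w / norm w))"
          by (intro integrable_mult_right integrable_inverse_norm_on_ball)
        fix w
        show "norm (B (z - w) * (of_real (indicator (ball 0 M) w / 1) / w) - B (z - w) * g w) \<le>
          (2 * b) * (indicator (ball 0 \<epsilon>) w / norm w)"
        proof (cases "norm w < \<epsilon>")
          case True
          have "norm (of_real (indicator (ball 0 M) w / 1) / w - g w) \<le>
              norm (of_real (indicator (ball 0 M) w / 1) / w :: complex) + norm (g w)"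
            by (rule norm_triangle_ineq4)
          also have "\<dots> \<le> 1 / norm w + 1 / norm w"
            using cauchy_kernel_bound[OF \<epsilon>, of w]
            by (intro add_mono) (auto simp: g_def norm_divide norm_mult indicator_def)
          finally have n: "norm (of_real (indicator (ball 0 M) w / 1) / w - g w) \<le> 2 / norm w" by simp
          have "norm (B (z - w) * (of_real (indicator (ball 0 M) w / 1) / w) - B (z - w) * g w) =
            norm (B (z - w)) * norm (of_real (indicator (ball 0 M) w / 1) / w - g w)"
            by (simp only: right_diff_distrib[symmetric] norm_mult)
          also have "\<dots> \<le> b * (2 / norm w)"
            by (intro mult_mono b n) auto
          also have "\<dots> = (2 * b) * (indicator (ball 0 \<epsilon>) w / norm w)" using True by simp
          finally show ?thesis .
        next
          case False
          then have "of_real (indicator (ball 0 M) w / 1) / w = g w"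
            using cauchy_kernel_outside(1)[OF \<epsilon>, of w] by (simp add: g_def)
          then show ?thesis using False by simp
        qed
      qed (rule Bochner_Integration.integrable_diff[OF Ai Bi])
      moreover have "(LINT w|lborel. (2 * b) * (indicator (ball (0::complex) \<epsilon>) w / norm w)) = 2 * b * (\<epsilon> * planar_riesz)"
        unfolding integral_mult_right_zero integral_inverse_norm_ball[OF \<epsilon>] ..
      ultimately show ?thesis by simp
    qed
    have "norm (X - f z * cauchy_mass) \<le> norm (X - (LINT w|lborel. B (z - w) * g w)) +
        norm ((LINT w|lborel. B (z - w) * g w) - f z * cauchy_mass)"
      using dist_triangle[of X "f z * cauchy_mass" "LINT w|lborel. B (z - w) * g w"] unfolding dist_norm .
    also have "\<dots> \<le> 2 * b * (\<epsilon> * planar_riesz) + \<omega> * cauchy_mass"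
      using p1 p2 unfolding eq by linarith
    finally show ?thesis .
  qed
  have "norm (X - f z * cauchy_mass) \<le> 0 + e" if "e > 0" for e
  proof -
    define \<omega> where "\<omega> = e / (2 * cauchy_mass)"
    have \<omega>: "\<omega> > 0" using that cauchy_mass_pos by (simp add: \<omega>_def)
    obtain d where d: "d > 0" "\<And>x. dist x z < d \<Longrightarrow> dist (f x) (f z) < \<omega>"
      using fc \<omega> unfolding continuous_on_iff by (metis UNIV_I)
    define \<epsilon> where "\<epsilon> = min d (e / (4 * b * planar_riesz + 1))"
    have P: "0 \<le> b * planar_riesz" using b planar_riesz_nonneg by simp
    have \<epsilon>: "\<epsilon> > 0" using d that P by (simp add: \<epsilon>_def)
    have "norm (X - f z * cauchy_mass) \<le> 2 * b * (\<epsilon> * planar_riesz) + \<omega> * cauchy_mass"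
      by (rule est[OF \<epsilon>]) (use d(2)[of "z - _"] in \<open>force simp: \<epsilon>_def dist_norm\<close>)
    also have "\<omega> * cauchy_mass = e / 2" using cauchy_mass_pos by (simp add: \<omega>_def)
    also have "2 * b * (\<epsilon> * planar_riesz) = 2 * (b * planar_riesz) * \<epsilon>" by simp
    also have "\<dots> \<le> 2 * (b * planar_riesz) * (e / (4 * b * planar_riesz + 1))"
      using P by (intro mult_left_mono) (auto simp: \<epsilon>_def)
    also have "\<dots> \<le> e / 2" using P that by (simp add: field_simps)
    finally show ?thesis by simp
  qed
  then have "norm (X - f z * cauchy_mass) \<le> 0" by (rule field_le_epsilon)
  then have "X = f z * cauchy_mass" by simp
  then show ?thesis unfolding X using cauchy_mass_pos by simp
qed

text \<open>
  The Cauchy transform solves \<open>\<partial>u/\<partial>zbar = f\<close>: differentiation passes to \<open>f\<close>, and the Cauchy transform of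
  \<open>\<partial>f/\<partial>zbar\<close> is \<open>f\<close>.
\<close>

lemma cauchy_transform_has_wirtinger:
  assumes "C1_on UNIV f" "\<And>z. r \<le> norm z \<Longrightarrow> f z = 0"
  obtains A where "continuous_on UNIV A" "\<And>z. has_wirtinger (cauchy_transform f) (A z) (f z) z"
proof -
  obtain A B where AB: "continuous_on UNIV A" "continuous_on UNIV B"
    "\<And>z. z \<in> UNIV \<Longrightarrow> has_wirtinger f (A z) (B z) z" using assms(1) by (rule C1_onE) blast
  have "cauchy_transform B z = f z" for z
    by (rule cauchy_transform_dbar_inverse[OF AB(1,2) AB(3)[OF UNIV_I] assms(2)])
  with that[of "cauchy_transform A"] cauchy_transform_has_wirtinger_aux[OF AB(1,2) AB(3)[OF UNIV_I] assms(2)]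
  show thesis by (metis (no_types, lifting))
qed

lemma cauchy_transform_C1:
  assumes "C1_on UNIV f" "\<And>z. r \<le> norm z \<Longrightarrow> f z = 0"
  shows "C1_on UNIV (cauchy_transform f)"
proof -
  obtain A where "continuous_on UNIV A" "\<And>z. has_wirtinger (cauchy_transform f) (A z) (f z) z"
    using cauchy_transform_has_wirtinger[OF assms] by metis
  then show ?thesis using C1_on_continuous[OF assms(1)] by (intro C1_onI[of _ A f])
qed

lemma cauchy_transform_diff:
  assumes "continuous_on UNIV f" "continuous_on UNIV g"
    and "\<And>z. r \<le> norm z \<Longrightarrow> f z = 0" "\<And>z. r \<le> norm z \<Longrightarrow> g z = 0"
  shows "cauchy_transform f z - cauchy_transform g z = cauchy_transform (\<lambda>z. f z - g z) z"
proof -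
  let ?k = "\<lambda>w. of_real (indicator (ball 0 (r + norm z)) w / cauchy_mass) / w :: complex"
  have I: "integrable lborel (\<lambda>w. F (z - w) * ?k w)" if "continuous_on UNIV F" for F
    by (rule convolution_integrable[where M="r + norm z", OF that truncated_cauchy_kernel_integrable]) auto
  have e: "cauchy_transform F z = (LINT w|lborel. F (z - w) * ?k w)"
    if "\<And>z. r \<le> norm z \<Longrightarrow> F z = 0" for F
    by (rule cauchy_transform_eq_convolution) (use that in auto)
  have "cauchy_transform (\<lambda>z. f z - g z) z = (LINT w|lborel. (f (z - w) - g (z - w)) * ?k w)"
    by (rule e) (use assms(3,4) in simp)
  also have "\<dots> = (LINT w|lborel. f (z - w) * ?k w) - (LINT w|lborel. g (z - w) * ?k w)"
    unfolding left_diff_distrib by (rule Bochner_Integration.integral_diff[OF I[OF assms(1)] I[OF assms(2)]])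
  also have "\<dots> = cauchy_transform f z - cauchy_transform g z"
    using e[of f, OF assms(3)] e[of g, OF assms(4)] by (simp only:)
  finally show ?thesis by (rule sym)
qed

lemma cauchy_transform_bound:
  assumes "continuous_on UNIV f" "\<And>z. r \<le> norm z \<Longrightarrow> f z = 0"
    and "\<And>z. norm (f z) \<le> b" "norm z \<le> s" "0 < r + s"
  shows "norm (cauchy_transform f z) \<le> (r + s) * planar_riesz / cauchy_mass * b"
proof -
  let ?k = "\<lambda>w. of_real (indicator (ball 0 (r + s)) w / cauchy_mass) / w :: complex"
  have "norm (cauchy_transform f z) = norm (LINT w|lborel. f (z - w) * ?k w)"
    by (subst cauchy_transform_eq_convolution[OF assms(2) assms(4)]) auto
  also have "\<dots> \<le> (LINT w|lborel. (b / cauchy_mass) * (indicator (ball (0::complex) (r + s)) w / norm w))"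
  proof (rule Bochner_Integration.integral_norm_bound_integral)
    show "integrable lborel (\<lambda>w. f (z - w) * ?k w)"
      by (rule convolution_integrable[where M="r + s", OF assms(1) truncated_cauchy_kernel_integrable]) auto
    show "integrable lborel (\<lambda>w::complex. (b / cauchy_mass) * (indicator (ball 0 (r + s)) w / norm w))"
      by (intro integrable_mult_right integrable_inverse_norm_on_ball)
    fix w
    have "norm (f (z - w) * ?k w) = norm (f (z - w)) * (indicator (ball 0 (r + s)) w / cauchy_mass / norm w)"
      using cauchy_mass_pos by (simp add: norm_mult norm_divide indicator_def)
    also have "\<dots> \<le> b * (indicator (ball 0 (r + s)) w / cauchy_mass / norm w)"
      using cauchy_mass_pos by (intro mult_right_mono assms(3)) auto
    finally show "norm (f (z - w) * ?k w) \<le> (b / cauchy_mass) * (indicator (ball 0 (r + s)) w / norm w)"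
      by simp
  qed
  also have "\<dots> = (r + s) * planar_riesz / cauchy_mass * b"
    unfolding integral_mult_right_zero integral_inverse_norm_ball[OF assms(5)] by simp
  finally show ?thesis .
qed

text \<open>
  Away from the support of \<open>f\<close> the kernel is bounded, so that the integral of \<open>|f|\<close> suffices.
\<close>

lemma cauchy_transform_bound_away:
  assumes "integrable lborel f" "0 < \<rho>" "\<And>w. norm (z - w) < \<rho> \<Longrightarrow> f w = 0"
  shows "norm (cauchy_transform f z) \<le> (LINT w|lborel. norm (f w)) / (\<rho> * cauchy_mass)"
proof -
  have fm: "f \<in> borel_measurable borel" using assms(1) by simp
  have i: "integrable lborel (\<lambda>w. f (z - w))"
    using lborel_integrable_affine[OF assms(1), of "-1" z] by simp
  have pt: "norm (f (z - w) * (1 / w)) \<le> (1 / \<rho>) * norm (f (z - w))" for w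
  proof (cases "norm w < \<rho>")
    case True
    then show ?thesis using assms(3)[of "z - w"] by simp
  next
    case False
    then have "inverse (norm w) \<le> inverse \<rho>" using assms(2) by (intro le_imp_inverse_le) auto
    then show ?thesis by (simp add: norm_mult norm_inverse divide_inverse mult.commute mult_right_mono)
  qed
  have "norm (LINT w|lborel. f (z - w) * (1 / w)) \<le> (LINT w|lborel. (1 / \<rho>) * norm (f (z - w)))"
  proof (rule Bochner_Integration.integral_norm_bound_integral)
    show "integrable lborel (\<lambda>w. (1 / \<rho>) * norm (f (z - w)))" using i by simp
    have [measurable]: "f \<in> borel_measurable borel" by (rule fm)
    show "integrable lborel (\<lambda>w. f (z - w) * (1 / w))"
    proof (rule Bochner_Integration.integrable_bound[OF \<open>integrable lborel (\<lambda>w. (1 / \<rho>) * norm (f (z - w)))\<close>])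
      show "AE w in lborel. norm (f (z - w) * (1 / w)) \<le> norm ((1 / \<rho>) * norm (f (z - w)))"
        using pt assms(2) by (intro AE_I2) simp
    qed measurable
  qed (rule pt)
  also have "\<dots> = (1 / \<rho>) * (LINT w|lborel. norm (f w))"
    unfolding integral_mult_right_zero using lborel_integral_reflect[of "\<lambda>w. norm (f w)" z] fm by simp
  finally show ?thesis
    using cauchy_mass_pos assms(2)
    by (simp add: cauchy_transform_def norm_divide field_simps)
qed

text \<open>
  Integration by parts: \<open>\<integral> f (z - w)\<close> does not depend on \<open>z\<close>, hence its derivative \<open>\<integral> B (z - w)\<close> is zero.
\<close>

lemma integral_dbar_compact_support:
  fixes f A B :: "complex \<Rightarrow> complex"
  assumes A: "continuous_on UNIV A" and B: "continuous_on UNIV B"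
    and f: "\<And>z. has_wirtinger f (A z) (B z) z" and supp: "\<And>z. r \<le> norm z \<Longrightarrow> f z = 0"
  shows "(LINT w|lborel. B w) = 0"
proof -
  have fc: "continuous_on UNIV f" by (intro continuous_at_imp_continuous_on ballI has_wirtinger_continuous[OF f])
  define M where "M = \<bar>r\<bar> + 1"
  define g where "g w = (of_real (indicator (ball 0 M) w) :: complex)" for w :: complex
  have gi: "integrable lborel g"
    unfolding g_def using emeasure_lborel_ball_finite[of "0::complex" M]
    by (intro integrable_of_real integrable_real_indicator) auto
  have g0: "\<And>w. M \<le> norm w \<Longrightarrow> g w = 0" by (simp add: g_def)
  have 1: "has_wirtinger (\<lambda>z. LINT w|lborel. f (z - w) * g w)
        (LINT w|lborel. A (0 - w) * g w) (LINT w|lborel. B (0 - w) * g w) 0"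
    by (rule has_wirtinger_convolution[OF A B f gi g0])
  have e: "(LINT w|lborel. F (z - w) * g w) = (LINT w|lborel. F w)"
    if "F \<in> borel_measurable borel" "\<And>z. \<bar>r\<bar> < norm z \<Longrightarrow> F z = 0" "norm z < 1" for F z
  proof -
    have "F (z - w) * g w = F (z - w)" for w
    proof (cases "norm w < M")
      case False
      then have "F (z - w) = 0"
        using norm_triangle_ineq2[of w z] that by (intro that) (simp add: norm_minus_commute M_def)
      then show ?thesis by simp
    qed (simp add: g_def)
    then show ?thesis using lborel_integral_reflect[OF that(1), of z] by (simp only:)
  qed
  have "has_wirtinger (\<lambda>_. LINT w|lborel. f w) (LINT w|lborel. A (0 - w) * g w) (LINT w|lborel. B (0 - w) * g w) 0"
    by (rule has_wirtinger_transform[OF 1, of "ball 0 1"])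
      (auto intro!: e borel_measurable_continuous_onI fc supp)
  then have "(LINT w|lborel. B (0 - w) * g w) = 0"
    using has_wirtinger_unique(2) has_wirtinger_const by blast
  moreover have "(LINT w|lborel. B (0 - w) * g w) = (LINT w|lborel. B w)"
    by (rule e) (use compact_support_derivatives_zero(2)[OF supp f] borel_measurable_continuous_onI[OF B] in auto)
  ultimately show ?thesis by simp
qed

section \<open>The Riccati equation and the similarity principle\<close>

lemma C1_on_cutoff_mult:
  assumes "C1_on UNIV (\<lambda>z. of_real (\<eta> z))" "\<And>z. b \<le> norm z \<Longrightarrow> \<eta> z = 0" "b < r"
    "C1_on (ball 0 r) f"
  shows "C1_on UNIV (\<lambda>z. of_real (\<eta> z) * f z)"
proof (rule C1_on_zero_extension)
  show "C1_on (ball 0 r) (\<lambda>z. of_real (\<eta> z) * f z)"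
    by (intro C1_on_mult C1_on_subset[OF assms(1)] assms(4)) auto
  show "cball 0 b \<subseteq> ball (0::complex) r" using assms(3) by auto
qed (use assms(2) in auto)

lemma cutoff_mult_bound:
  assumes "\<And>z. 0 \<le> \<eta> z" "\<And>z. \<eta> z \<le> (1::real)" "\<And>z. b \<le> norm z \<Longrightarrow> \<eta> z = 0" "0 \<le> c"
    "\<And>z. norm z \<le> b \<Longrightarrow> norm (f z) \<le> c"
  shows "norm (of_real (\<eta> z) * f z :: complex) \<le> c"
proof (cases "norm z \<le> b")
  case True
  have "norm (of_real (\<eta> z) * f z) = \<eta> z * norm (f z)" using assms(1) by (simp add: norm_mult)
  also have "\<dots> \<le> 1 * c" by (intro mult_mono assms True) auto
  finally show ?thesis by simp
qed (use assms in auto)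

text \<open>
  The quotient \<open>cnj G / G\<close>, which is undefined at zeros of \<open>G\<close>, is replaced by
  \<open>(cnj G)\<^sup>2 / (|G|\<^sup>2 + d\<^sup>2)\<close>. The first bound is the one that \<open>cnj G / G\<close> would satisfy, the second one bounds
  the error \<open>cnj G - G (cnj G)\<^sup>2 / (|G|\<^sup>2 + d\<^sup>2)\<close> that is made.
\<close>

lemma damped_quotient_bound:
  fixes G :: complex and d :: real
  assumes "d > 0"
  shows "norm (cnj G * cnj G / (G * cnj G + of_real (d\<^sup>2))) \<le> 1"
    "norm (cnj G * of_real (d\<^sup>2) / (G * cnj G + of_real (d\<^sup>2))) \<le> d"
proof -
  have e: "G * cnj G + of_real (d\<^sup>2) = of_real ((norm G)\<^sup>2 + d\<^sup>2)"
    by (simp only: complex_norm_square of_real_add)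
  have pos: "(norm G)\<^sup>2 + d\<^sup>2 > 0" using assms by (intro add_nonneg_pos) auto
  have n: "norm (of_real ((norm G)\<^sup>2 + d\<^sup>2) :: complex) = (norm G)\<^sup>2 + d\<^sup>2"
    using pos by (simp only: norm_of_real abs_of_pos)
  show "norm (cnj G * cnj G / (G * cnj G + of_real (d\<^sup>2))) \<le> 1"
    unfolding e norm_divide n using pos by (simp add: norm_mult power2_eq_square)
  have "2 * (norm G * d) \<le> (norm G)\<^sup>2 + d\<^sup>2" "0 \<le> norm G * d"
    using sum_squares_bound[of "norm G" d] assms by (simp_all add: mult.assoc)
  then have "norm G * d \<le> (norm G)\<^sup>2 + d\<^sup>2" by linarith
  then have "norm G * d\<^sup>2 \<le> d * ((norm G)\<^sup>2 + d\<^sup>2)"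
    using mult_left_mono[of "norm G * d" "(norm G)\<^sup>2 + d\<^sup>2" d] assms by (simp add: power2_eq_square mult_ac)
  then show "norm (cnj G * of_real (d\<^sup>2) / (G * cnj G + of_real (d\<^sup>2))) \<le> d"
    unfolding e norm_divide n using pos assms by (simp add: norm_mult norm_power field_simps)
qed

text \<open>
  The right-hand side of \<open>\<partial>l/\<partial>zbar = - q/4 - |l|\<^sup>2\<close>, cut off.
\<close>

definition riccati_source :: "(complex \<Rightarrow> real) \<Rightarrow> (complex \<Rightarrow> real) \<Rightarrow> (complex \<Rightarrow> complex) \<Rightarrow> complex \<Rightarrow> complex" where
  "riccati_source \<eta> q l z = of_real (\<eta> z) * (- of_real (q z) / 4 - l z * cnj (l z))"

primrec riccati_iterate :: "(complex \<Rightarrow> real) \<Rightarrow> (complex \<Rightarrow> real) \<Rightarrow> nat \<Rightarrow> complex \<Rightarrow> complex" where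
  "riccati_iterate \<eta> q 0 = (\<lambda>_. 0)"
| "riccati_iterate \<eta> q (Suc n) = cauchy_transform (riccati_source \<eta> q (riccati_iterate \<eta> q n))"

definition disc_constant :: real where
  "disc_constant = 6 * planar_riesz / cauchy_mass"

lemma disc_constant_nonneg: "0 \<le> disc_constant"
  using planar_riesz_nonneg cauchy_mass_pos by (simp add: disc_constant_def)

lemma cauchy_transform_disc_bound:
  assumes "continuous_on UNIV f" "\<And>z. b \<le> norm z \<Longrightarrow> f z = 0" "b \<le> 3"
    and "\<And>z. norm (f z) \<le> c" "norm z \<le> 3"
  shows "norm (cauchy_transform f z) \<le> disc_constant * c"
proof -
  have "norm (cauchy_transform f z) \<le> (3 + 3) * planar_riesz / cauchy_mass * c"
    by (rule cauchy_transform_bound) (use assms in auto)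
  then show ?thesis by (simp add: disc_constant_def)
qed

text \<open>
  Picard iteration for the Riccati equation. As the norm of the Cauchy transform on the disc of radius 3
  is at most \<open>disc_constant\<close>, the ball of radius \<open>\<Lambda>\<close> is preserved, and on it the map is a contraction with factor
  \<open>2 \<Lambda> disc_constant \<le> 1/2\<close> in the supremum norm. The Cauchy transform preserves \<open>C\<^sup>1\<close>, hence
  so does the iteration, although its limit is only a uniform one.
\<close>

lemma
  assumes \<eta>: "C1_on UNIV (\<lambda>z. of_real (\<eta> z))" "\<And>z. 0 \<le> \<eta> z" "\<And>z. \<eta> z \<le> 1" "\<And>z. b \<le> norm z \<Longrightarrow> \<eta> z = 0" "b < 3"
    and q: "C1_on (ball 0 3) (\<lambda>z. of_real (q z))" "\<And>z. z \<in> ball 0 3 \<Longrightarrow> \<bar>q z\<bar> \<le> \<epsilon>" "0 \<le> \<epsilon>"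
    and \<Lambda>: "0 < \<Lambda>" "disc_constant * \<Lambda> \<le> 1/10" "disc_constant * (\<epsilon> / 4) \<le> \<Lambda> / 2"
  shows riccati_iterate_C1: "C1_on UNIV (riccati_iterate \<eta> q n)" (is ?A)
    and riccati_iterate_bound: "z \<in> ball 0 3 \<Longrightarrow> norm (riccati_iterate \<eta> q n z) \<le> \<Lambda>" (is "_ \<Longrightarrow> ?B")
    and riccati_iterate_step:
      "z \<in> ball 0 3 \<Longrightarrow> norm (riccati_iterate \<eta> q (Suc n) z - riccati_iterate \<eta> q n z) \<le> \<Lambda> * (1/2) ^ n" (is "_ \<Longrightarrow> ?C")
    and riccati_iterate_dbar: "\<exists>A. has_wirtinger (riccati_iterate \<eta> q (Suc n)) A (riccati_source \<eta> q (riccati_iterate \<eta> q n) z) z"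
      (is ?D)
proof -
  let ?s = "riccati_source \<eta> q" and ?l = "riccati_iterate \<eta> q"
  have C1: "C1_on UNIV (?s l)" if "C1_on UNIV l" for l
    unfolding riccati_source_def[abs_def] minus_divide_left[symmetric] divide_inverse
    by (intro C1_on_cutoff_mult[OF \<eta>(1) \<eta>(4) \<eta>(5)] C1_on_intros q C1_on_subset[OF that]) auto
  have supp: "b \<le> norm z \<Longrightarrow> ?s l z = 0" for l and z :: complex
    using \<eta>(4) by (simp add: riccati_source_def)
  have bound: "norm (?s l z) \<le> \<epsilon> / 4 + \<Lambda> * \<Lambda>" if "\<And>z. z \<in> ball 0 3 \<Longrightarrow> norm (l z) \<le> \<Lambda>" for l and z :: complex
    unfolding riccati_source_def
  proof (rule cutoff_mult_bound[where f="\<lambda>z. - of_real (q z) / 4 - l z * cnj (l z)", OF \<eta>(2,3,4)])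
    fix z :: complex assume "norm z \<le> b"
    then have z: "z \<in> ball 0 3" using \<eta> by simp
    have "norm (- of_real (q z) / 4 - l z * cnj (l z)) \<le> norm (- of_real (q z) / 4 :: complex) + norm (l z * cnj (l z))"
      by (rule norm_triangle_ineq4)
    also have "\<dots> \<le> \<epsilon> / 4 + \<Lambda> * \<Lambda>"
      using q(2)[OF z] that[OF z] \<Lambda>(1) by (intro add_mono) (auto simp: norm_mult intro!: mult_mono)
    finally show "norm (- of_real (q z) / 4 - l z * cnj (l z)) \<le> \<epsilon> / 4 + \<Lambda> * \<Lambda>" .
  qed (use q \<Lambda> in auto)
  have KL: "disc_constant * \<Lambda> * \<Lambda> \<le> 1/10 * \<Lambda>" using \<Lambda> by (intro mult_right_mono) auto
  have main: "C1_on UNIV (?l n) \<and> (\<forall>z\<in>ball 0 3. norm (?l n z) \<le> \<Lambda>)" for n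
  proof (induction n)
    case 0 then show ?case using \<Lambda> by (simp add: C1_on_const)
  next
    case (Suc n)
    have 1: "C1_on UNIV (?l (Suc n))"
      using cauchy_transform_C1[OF C1 supp] Suc by simp
    have "norm (?l (Suc n) z) \<le> disc_constant * (\<epsilon> / 4 + \<Lambda> * \<Lambda>)" if "z \<in> ball 0 3" for z
      unfolding riccati_iterate.simps
      by (rule cauchy_transform_disc_bound[OF C1_on_continuous[OF C1] supp _ bound])
        (use Suc that \<eta> in auto)
    also have "disc_constant * (\<epsilon> / 4 + \<Lambda> * \<Lambda>) \<le> \<Lambda>"
      unfolding distrib_left mult.assoc[symmetric] using KL \<Lambda> by linarith
    finally show ?case using 1 by simp
  qed
  show ?A using main by blast
  show ?B if "z \<in> ball 0 3" using main that by blast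
  obtain A where "\<And>z. has_wirtinger (cauchy_transform (?s (?l n))) (A z) (?s (?l n) z) z"
    using cauchy_transform_has_wirtinger[OF C1 supp] main by metis
  then show ?D by auto
  have step: "\<forall>z\<in>ball 0 3. norm (?l (Suc n) z - ?l n z) \<le> \<Lambda> * (1/2) ^ n" for n
  proof (induction n)
    case 0
    show ?case using conjunct2[OF main[of "Suc 0"]] by simp
  next
    case (Suc n)
    let ?f = "?l (Suc n)" and ?g = "?l n"
    have fb: "norm (?f z) \<le> \<Lambda>" and gb: "norm (?g z) \<le> \<Lambda>" if "z \<in> ball 0 3" for z
      using main that by blast+
    have fC: "C1_on UNIV (?s ?f)" and gC: "C1_on UNIV (?s ?g)" using main C1 by blast+
    have ds: "?s ?f z - ?s ?g z = of_real (\<eta> z) * (?g z * cnj (?g z) - ?f z * cnj (?f z))" for z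
      by (simp add: riccati_source_def algebra_simps)
    have d: "norm (?s ?f z - ?s ?g z) \<le> 2 * \<Lambda> * (\<Lambda> * (1/2) ^ n)" for z
      unfolding ds
    proof (rule cutoff_mult_bound[where f="\<lambda>z. ?g z * cnj (?g z) - ?f z * cnj (?f z)", OF \<eta>(2,3,4)])
      fix z :: complex assume "norm z \<le> b"
      then have z: "z \<in> ball 0 3" using \<eta> by simp
      have "?g z * cnj (?g z) - ?f z * cnj (?f z) = - (cnj (?g z) * (?f z - ?g z) + ?f z * cnj (?f z - ?g z))"
        by (simp only: complex_cnj_diff ring_distribs minus_diff_eq) simp
      then have "norm (?g z * cnj (?g z) - ?f z * cnj (?f z)) \<le>
          norm (?g z) * norm (?f z - ?g z) + norm (?f z) * norm (?f z - ?g z)"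
        using norm_triangle_ineq[of "cnj (?g z) * (?f z - ?g z)" "?f z * cnj (?f z - ?g z)"]
        by (simp only: norm_minus_cancel norm_mult complex_mod_cnj)
      also have "\<dots> \<le> \<Lambda> * (\<Lambda> * (1/2) ^ n) + \<Lambda> * (\<Lambda> * (1/2) ^ n)"
        using Suc z fb[OF z] gb[OF z] \<Lambda> by (intro add_mono mult_mono) auto
      finally show "norm (?g z * cnj (?g z) - ?f z * cnj (?f z)) \<le> 2 * \<Lambda> * (\<Lambda> * (1/2) ^ n)" by simp
    qed (use \<Lambda> in auto)
    have "norm (?l (Suc (Suc n)) z - ?l (Suc n) z) \<le> \<Lambda> * (1/2) ^ Suc n" if z: "z \<in> ball 0 3" for z
    proof -
      have "?l (Suc (Suc n)) z - ?l (Suc n) z = cauchy_transform (?s ?f) z - cauchy_transform (?s ?g) z"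
        by simp
      also have "\<dots> = cauchy_transform (\<lambda>z. ?s ?f z - ?s ?g z) z"
        by (rule cauchy_transform_diff[where r=b, OF C1_on_continuous[OF fC] C1_on_continuous[OF gC] supp supp])
      finally have eq: "?l (Suc (Suc n)) z - ?l (Suc n) z = cauchy_transform (\<lambda>z. ?s ?f z - ?s ?g z) z" .
      have "norm (?l (Suc (Suc n)) z - ?l (Suc n) z) \<le> disc_constant * (2 * \<Lambda> * (\<Lambda> * (1/2) ^ n))"
        unfolding eq
        by (rule cauchy_transform_disc_bound[OF C1_on_continuous[OF C1_on_diff[OF fC gC]] _ _ d])
          (use supp \<eta> z in auto)
      also have "\<dots> = (2 * disc_constant * \<Lambda>) * (\<Lambda> * (1/2) ^ n)" by simp
      also have "\<dots> \<le> (1/2) * (\<Lambda> * (1/2) ^ n)" using \<Lambda> by (intro mult_right_mono) auto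
      finally show ?thesis by simp
    qed
    then show ?case by blast
  qed
  then show ?C if "z \<in> ball 0 3" using that by blast
qed

text \<open>
  A solution of \<open>\<Delta>F + q F = 0\<close> in the disc of radius 3 as a first-order system: \<open>P\<close> is \<open>\<partial>F/\<partial>z\<close> and
  \<open>\<Delta> = 4 \<partial>\<^sup>2/\<partial>z\<partial>zbar\<close>.
\<close>

locale schroedinger_disc =
  fixes F q :: "complex \<Rightarrow> real" and P :: "complex \<Rightarrow> complex"
  assumes q_C1: "C1_on (ball 0 3) (\<lambda>z. of_real (q z))"
    and q_bound: "\<And>z. z \<in> ball 0 3 \<Longrightarrow> \<bar>q z\<bar> \<le> 1"
    and F_deriv: "\<And>z. z \<in> ball 0 3 \<Longrightarrow> has_wirtinger (\<lambda>z. of_real (F z)) (P z) (cnj (P z)) z"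
    and P_C1: "C1_on (ball 0 3) P"
    and P_dbar: "\<And>z. z \<in> ball 0 3 \<Longrightarrow> \<exists>A. has_wirtinger P A (of_real (- q z * F z / 4)) z"

lemma (in schroedinger_disc) F_C1: "C1_on (ball 0 3) (\<lambda>z. of_real (F z))"
  by (rule C1_onI[of _ P "\<lambda>z. cnj (P z)"])
    (use F_deriv C1_on_continuous[OF P_C1] in \<open>auto intro: continuous_intros\<close>)

text \<open>
  Let \<open>l\<close> be an iterate of the Riccati equation and \<open>G = P - l F\<close>. Then \<open>\<partial>G/\<partial>zbar\<close> is \<open>- l cnj G\<close> up to the error
  of the iterate. Let \<open>s\<close> be the Cauchy transform of \<open>- l (cnj G)\<^sup>2 / (|G|\<^sup>2 + d\<^sup>2)\<close>, which is small because
  \<open>|l|\<close> is. Then \<open>exp (- s) G\<close> has \<open>\<partial>/\<partial>zbar\<close> equal to a function \<open>E\<close> that tends uniformly to zero as the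
  iteration proceeds and \<open>d\<close> decreases, and subtracting the Cauchy transform of \<open>E\<close> makes it holomorphic.
  These holomorphic functions are bounded, so a subsequence converges to \<open>H\<close>; at each point, a further
  subsequence of the values of \<open>s\<close> converges.
\<close>

theorem (in schroedinger_disc) similarity_representation:
  assumes \<Lambda>: "0 < \<Lambda>" "\<Lambda> \<le> 1/10" "disc_constant * \<Lambda> \<le> 1/10" "disc_constant * (\<epsilon> / 4) \<le> \<Lambda> / 2"
    and q: "\<And>z. z \<in> ball 0 3 \<Longrightarrow> \<bar>q z\<bar> \<le> \<epsilon>" "0 \<le> \<epsilon>"
    and R: "0 < R" "R < 3"
  obtains H l s :: "complex \<Rightarrow> complex" where "H holomorphic_on ball 0 R"
    "\<And>z. z \<in> ball 0 R \<Longrightarrow> norm (l z) \<le> \<Lambda>" "\<And>z. z \<in> ball 0 R \<Longrightarrow> norm (s z) \<le> 1/10"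
    "\<And>z. z \<in> ball 0 R \<Longrightarrow> P z - l z * of_real (F z) = exp (s z) * H z"
proof -
  define R' where "R' = (R + 3) / 2"
  have R': "R < R'" "R' < 3" using R by (auto simp: R'_def)
  obtain \<eta> :: "complex \<Rightarrow> real" where \<eta>: "C1_on UNIV (\<lambda>z. of_real (\<eta> z))" "\<And>z. 0 \<le> \<eta> z" "\<And>z. \<eta> z \<le> 1"
      "\<And>z. norm z \<le> R \<Longrightarrow> \<eta> z = 1" "\<And>z. R' \<le> norm z \<Longrightarrow> \<eta> z = 0"
    using C1_cutoff_exists[OF R(1) R'(1)] by metis
  define l where "l = riccati_iterate \<eta> q"
  note hyps = \<eta>(1-3,5) R'(2) q_C1 q \<Lambda>(1,3,4)
  have l_0: "l 0 z = 0" for z by (simp add: l_def)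
  have l_C1: "C1_on UNIV (l n)" for n
    unfolding l_def by (rule riccati_iterate_C1[OF hyps])
  have l_bound: "norm (l n z) \<le> \<Lambda>" if "z \<in> ball 0 3" for n z
    unfolding l_def by (rule riccati_iterate_bound[OF hyps]) (use that in auto)
  have l_step: "norm (l (Suc n) z - l n z) \<le> \<Lambda> * (1/2) ^ n" if "z \<in> ball 0 3" for n z
    unfolding l_def by (rule riccati_iterate_step[OF hyps]) (use that in auto)
  have l_dbar: "\<exists>A. has_wirtinger (l (Suc n)) A (riccati_source \<eta> q (l n) z) z" for n z
    unfolding l_def by (rule riccati_iterate_dbar[OF hyps])
  have lim: "\<exists>L. (\<lambda>n. l n z) \<longlonglongrightarrow> L" if z: "z \<in> ball 0 3" for z
  proof -
    have "summable (\<lambda>n. norm (l (Suc n) z - l n z))"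
      by (rule summable_comparison_test'[where N=0 and g="\<lambda>n. \<Lambda> * (1/2) ^ n"])
        (use l_step[OF z] in \<open>auto intro!: summable_mult summable_geometric\<close>)
    then have "summable (\<lambda>n. l (Suc n) z - l n z)" by (rule summable_norm_cancel)
    then have "(\<lambda>n. \<Sum>k<n. l (Suc k) z - l k z) \<longlonglongrightarrow> (\<Sum>k. l (Suc k) z - l k z)"
      by (rule summable_LIMSEQ)
    moreover have "(\<Sum>k<n. l (Suc k) z - l k z) = l n z" for n
      using sum_lessThan_telescope[of "\<lambda>k. l k z" n] l_0 by simp
    ultimately show ?thesis by auto
  qed
  then obtain L where L: "\<And>z. z \<in> ball 0 3 \<Longrightarrow> (\<lambda>n. l n z) \<longlonglongrightarrow> L z" by metis
  have L_bound: "norm (L z) \<le> \<Lambda>" if "z \<in> ball 0 3" for z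
    by (rule Lim_bounded[OF tendsto_norm[OF L[OF that]]]) (use l_bound[OF that] in auto)
  \<comment> \<open>bounds on the compact support of the cutoff\<close>
  have sub: "cball 0 R' \<subseteq> ball (0::complex) 3" using R' by auto
  obtain M where M: "0 \<le> M" "\<And>z. z \<in> cball 0 R' \<Longrightarrow> norm (P z) \<le> M" "\<And>z. z \<in> cball 0 R' \<Longrightarrow> \<bar>F z\<bar> \<le> M"
  proof -
    have "compact (P ` cball 0 R')" "compact ((\<lambda>z. of_real (F z) :: complex) ` cball 0 R')"
      by (intro compact_continuous_image continuous_on_subset[OF _ sub] C1_on_continuous P_C1 F_C1 compact_cball)+
    then obtain a b where "\<And>z. z \<in> cball 0 R' \<Longrightarrow> norm (P z) \<le> a"
      "\<And>z. z \<in> cball 0 R' \<Longrightarrow> norm (of_real (F z) :: complex) \<le> b"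
      using compact_imp_bounded bounded_iff by (metis (no_types, lifting) imageI)
    then show thesis
      by (intro that[of "max 0 (max a b)"]) (auto simp: le_max_iff_disj)
  qed
  \<comment> \<open>the damping decreases at the rate at which the iterates converge\<close>
  define d where "d n = (1/2 :: real) ^ n" for n :: nat
  have d: "d n > 0" for n by (simp add: d_def)
  define G where "G n z = P z - l (Suc n) z * of_real (F z)" for n z
  define D where "D n z = G n z * cnj (G n z) + of_real ((d n)\<^sup>2)" for n z
  have D0: "D n z \<noteq> 0" for n z
  proof -
    have "D n z = of_real ((norm (G n z))\<^sup>2 + (d n)\<^sup>2)"
      unfolding D_def by (simp only: complex_norm_square of_real_add)
    moreover have "(norm (G n z))\<^sup>2 + (d n)\<^sup>2 > 0" using d[of n] by (intro add_nonneg_pos) auto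
    ultimately show ?thesis by (metis less_irrefl of_real_eq_0_iff)
  qed
  define \<nu> where "\<nu> n z = - (l (Suc n) z * (cnj (G n z) * cnj (G n z) * inverse (D n z)))" for n z
  define s where "s n = cauchy_transform (\<lambda>z. of_real (\<eta> z) * \<nu> n z)" for n
  \<comment> \<open>the derivative \<open>\<partial>/\<partial>zbar\<close> of \<open>exp (- s) G\<close> where the cutoff is \<open>1\<close>: the first summand comes from the
    Riccati iterate, the second one from the damping\<close>
  define E where "E n z = exp (- s n z) * ((l n z * cnj (l n z) - l (Suc n) z * cnj (l (Suc n) z)) * of_real (F z)
      - l (Suc n) z * (cnj (G n z) * of_real ((d n)\<^sup>2) * inverse (D n z)))" for n z
  define H where "H n z = exp (- s n z) * G n z - cauchy_transform (\<lambda>z. of_real (\<eta> z) * E n z) z" for n z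
  have lC: "C1_on (ball 0 3) (l n)" for n by (rule C1_on_subset[OF l_C1]) simp
  have G_C1: "C1_on (ball 0 3) (G n)" for n
    unfolding G_def[abs_def] by (intro C1_on_intros P_C1 F_C1 lC)
  have D_C1: "C1_on (ball 0 3) (\<lambda>z. inverse (D n z))" for n
    by (rule C1_on_inverse[OF _ D0]) (unfold D_def[abs_def], intro C1_on_intros G_C1)
  have \<nu>_C1: "C1_on (ball 0 3) (\<nu> n)" for n
    unfolding \<nu>_def[abs_def] by (intro C1_on_intros G_C1 lC D_C1)
  have \<eta>\<nu>_C1: "C1_on UNIV (\<lambda>z. of_real (\<eta> z) * \<nu> n z)" for n
    by (rule C1_on_cutoff_mult[OF \<eta>(1,5) R'(2) \<nu>_C1])
  have \<nu>_supp: "of_real (\<eta> z) * \<nu> n z = 0" and E_supp: "of_real (\<eta> z) * E n z = 0"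
    if "R' \<le> norm z" for n z using \<eta>(5)[OF that] by simp_all
  have \<nu>_bound: "norm (of_real (\<eta> z) * \<nu> n z) \<le> \<Lambda>" for n z
  proof (rule cutoff_mult_bound[where f="\<nu> n", OF \<eta>(2,3,5)])
    fix z :: complex assume "norm z \<le> R'"
    then have z: "z \<in> ball 0 3" using R' by simp
    have "norm (\<nu> n z) = norm (l (Suc n) z) * norm (cnj (G n z) * cnj (G n z) / D n z)"
      unfolding \<nu>_def norm_minus_cancel norm_mult[of "l (Suc n) z"] divide_inverse ..
    also have "\<dots> \<le> \<Lambda> * 1"
      unfolding D_def by (intro mult_mono l_bound[OF z] damped_quotient_bound(1)[OF d]) (use \<Lambda> in auto)
    finally show "norm (\<nu> n z) \<le> \<Lambda>" by simp
  qed (use \<Lambda> in auto)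
  have s_bound: "norm (s n z) \<le> 1/10" if "z \<in> ball 0 3" for n z
  proof -
    have "norm (s n z) \<le> disc_constant * \<Lambda>"
      unfolding s_def
      by (rule cauchy_transform_disc_bound[where b=R' and c=\<Lambda>], rule C1_on_continuous[OF \<eta>\<nu>_C1],
          erule \<nu>_supp) (use that R' \<nu>_bound in auto)
    then show ?thesis using \<Lambda> by simp
  qed
  have s_C1: "C1_on UNIV (s n)" for n
    unfolding s_def by (rule cauchy_transform_C1[OF \<eta>\<nu>_C1 \<nu>_supp])
  have exp_bound: "norm (exp (- s n z)) \<le> 2" if "z \<in> ball 0 3" for n z
  proof -
    have "norm (exp (- s n z)) \<le> exp (norm (- s n z))" by (rule norm_exp)
    also have "\<dots> \<le> exp (1/2)" using s_bound[OF that, of n] by simp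
    also have "\<dots> \<le> 2" using exp_bound_half[of "1/2::real"] by simp
    finally show ?thesis .
  qed
  have E_C1: "C1_on (ball 0 3) (E n)" for n
    unfolding E_def[abs_def] by (intro C1_on_intros G_C1 lC D_C1 F_C1 C1_on_subset[OF s_C1]) auto
  have \<eta>E_C1: "C1_on UNIV (\<lambda>z. of_real (\<eta> z) * E n z)" for n
    by (rule C1_on_cutoff_mult[OF \<eta>(1,5) R'(2) E_C1])
  have E_bound: "norm (of_real (\<eta> z) * E n z) \<le> 2 * (M + 1) * d n" for n z
  proof (rule cutoff_mult_bound[where f="E n", OF \<eta>(2,3,5)])
    fix z :: complex assume zR: "norm z \<le> R'"
    then have z: "z \<in> ball 0 3" using R' by simp
    let ?f = "l (Suc n) z" and ?g = "l n z"
    have fg: "norm ?f \<le> \<Lambda>" "norm ?g \<le> \<Lambda>" "norm (?f - ?g) \<le> \<Lambda> * d n"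
      using l_bound[OF z] l_step[OF z] by (auto simp: d_def)
    have "?g * cnj ?g - ?f * cnj ?f = - (cnj ?g * (?f - ?g) + ?f * cnj (?f - ?g))"
      by (simp add: algebra_simps)
    then have "norm (?g * cnj ?g - ?f * cnj ?f) \<le> norm ?g * norm (?f - ?g) + norm ?f * norm (?f - ?g)"
      using norm_triangle_ineq[of "cnj ?g * (?f - ?g)" "?f * cnj (?f - ?g)"]
      by (simp only: norm_minus_cancel norm_mult complex_mod_cnj)
    also have "\<dots> \<le> \<Lambda> * (\<Lambda> * d n) + \<Lambda> * (\<Lambda> * d n)"
      using fg \<Lambda> by (intro add_mono mult_mono) auto
    also have "\<dots> = (2 * \<Lambda> * \<Lambda>) * d n" by simp
    also have "\<dots> \<le> 1 * d n"
    proof (intro mult_right_mono)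
      have "\<Lambda> * \<Lambda> \<le> 1/10 * (1/10)" using \<Lambda> by (intro mult_mono) auto
      then show "2 * \<Lambda> * \<Lambda> \<le> 1" by simp
    qed (use d[of n] in simp)
    finally have 1: "norm (?g * cnj ?g - ?f * cnj ?f) \<le> d n" by simp
    have 2: "norm (cnj (G n z) * of_real ((d n)\<^sup>2) * inverse (D n z)) \<le> d n"
      using damped_quotient_bound(2)[OF d, of "G n z" n] unfolding D_def divide_inverse .
    have "norm ((?g * cnj ?g - ?f * cnj ?f) * of_real (F z) - ?f * (cnj (G n z) * of_real ((d n)\<^sup>2) * inverse (D n z)))
        \<le> norm ((?g * cnj ?g - ?f * cnj ?f) * of_real (F z)) + norm (?f * (cnj (G n z) * of_real ((d n)\<^sup>2) * inverse (D n z)))"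
      by (rule norm_triangle_ineq4)
    also have "\<dots> \<le> d n * M + 1 * d n"
      unfolding norm_mult[of "_ - _"] norm_mult[of ?f]
      using 1 2 M(3)[of z] zR fg \<Lambda> d[of n] by (intro add_mono mult_mono) auto
    finally have 3: "norm ((?g * cnj ?g - ?f * cnj ?f) * of_real (F z) - ?f * (cnj (G n z) * of_real ((d n)\<^sup>2) * inverse (D n z)))
        \<le> (M + 1) * d n" by (simp add: algebra_simps)
    have "norm (E n z) \<le> 2 * ((M + 1) * d n)"
      unfolding E_def norm_mult[of "exp _"]
      by (intro mult_mono exp_bound[OF z] 3) auto
    then show "norm (E n z) \<le> 2 * (M + 1) * d n" by (simp only: mult.assoc)
  qed (use M d[of n] in auto)
  have TE_bound: "norm (cauchy_transform (\<lambda>z. of_real (\<eta> z) * E n z) z) \<le> disc_constant * (2 * (M + 1) * d n)"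
    if "z \<in> ball 0 3" for n z
    by (rule cauchy_transform_disc_bound[where b=R'], rule C1_on_continuous[OF \<eta>E_C1],
        erule E_supp, use R' in simp, rule E_bound) (use that in simp)
  have hol: "H n holomorphic_on ball 0 R" for n
    unfolding holomorphic_on_open[OF open_ball]
  proof (rule ballI)
    fix z :: complex assume "z \<in> ball 0 R"
    then have z: "z \<in> ball 0 3" and \<eta>1: "\<eta> z = 1" using R \<eta>(4) by auto
    obtain A1 where A1: "has_wirtinger P A1 (of_real (- q z * F z / 4)) z" using P_dbar[OF z] by blast
    obtain A2 where A2: "has_wirtinger (l (Suc n)) A2 (riccati_source \<eta> q (l n) z) z"
      using l_dbar by blast
    have G1: "has_wirtinger (G n) (A1 - (A2 * of_real (F z) + l (Suc n) z * P z))
      (of_real (- q z * F z / 4) - (riccati_source \<eta> q (l n) z * of_real (F z) + l (Suc n) z * cnj (P z))) z"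
      unfolding G_def[abs_def] by (intro has_wirtinger_diff has_wirtinger_mult A1 A2 F_deriv z)
    obtain A3 where A3: "has_wirtinger (s n) A3 (of_real (\<eta> z) * \<nu> n z) z"
      using cauchy_transform_has_wirtinger[OF \<eta>\<nu>_C1 \<nu>_supp] unfolding s_def by metis
    obtain A4 where A4: "has_wirtinger (cauchy_transform (\<lambda>z. of_real (\<eta> z) * E n z)) A4 (of_real (\<eta> z) * E n z) z"
      using cauchy_transform_has_wirtinger[OF \<eta>E_C1 E_supp] by metis
    have e1: "has_wirtinger (\<lambda>z. exp (- s n z)) (exp (- s n z) * - A3) (exp (- s n z) * - (of_real (\<eta> z) * \<nu> n z)) z"
      by (rule has_wirtinger_holomorphic_compose[OF has_wirtinger_minus[OF A3] DERIV_exp])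
    note H1 = has_wirtinger_diff[OF has_wirtinger_mult[OF e1 G1] A4]
    have Heq: "H n = (\<lambda>z. exp (- s n z) * G n z - cauchy_transform (\<lambda>z. of_real (\<eta> z) * E n z) z)"
      by (simp add: H_def fun_eq_iff)
    have PG: "cnj (P z) = cnj (G n z) + cnj (l (Suc n) z) * of_real (F z)"
      unfolding G_def by simp
    have cancel: "cnj g * cnj g * i * g = cnj g - cnj g * x * i" if "(g * cnj g + x) * i = 1" for g i x :: complex
    proof -
      have "cnj g * ((g * cnj g + x) * i) = cnj g" using that by simp
      then show ?thesis by (simp add: algebra_simps)
    qed
    have nuG: "cnj (G n z) * cnj (G n z) * inverse (D n z) * G n z =
        cnj (G n z) - cnj (G n z) * of_real ((d n)\<^sup>2) * inverse (D n z)"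
      by (rule cancel) (use D0[of n z] in \<open>simp add: D_def\<close>)
    have dbarG: "of_real (- q z * F z / 4) - (riccati_source \<eta> q (l n) z * of_real (F z) + l (Suc n) z * cnj (P z)) =
      (l n z * cnj (l n z) - l (Suc n) z * cnj (l (Suc n) z)) * of_real (F z) - l (Suc n) z * cnj (G n z)"
      unfolding riccati_source_def \<eta>1 PG by (simp add: algebra_simps)
    have nuG': "- (of_real (\<eta> z) * \<nu> n z) * G n z =
       l (Suc n) z * (cnj (G n z) - cnj (G n z) * of_real ((d n)\<^sup>2) * inverse (D n z))"
      unfolding \<nu>_def \<eta>1 nuG[symmetric] by (simp add: mult_ac)
    have "exp (- s n z) * - (of_real (\<eta> z) * \<nu> n z) * G n z + exp (- s n z) *
      (of_real (- q z * F z / 4) - (riccati_source \<eta> q (l n) z * of_real (F z) + l (Suc n) z * cnj (P z))) = E n z"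
      unfolding dbarG mult.assoc[of "exp _"] nuG' E_def distrib_left[symmetric]
      by (simp add: algebra_simps)
    then have "has_wirtinger (H n) (exp (- s n z) * - A3 * G n z +
         exp (- s n z) * (A1 - (A2 * of_real (F z) + l (Suc n) z * P z)) - A4) 0 z"
      unfolding Heq by (intro has_wirtinger_eq_rhs[OF H1 refl]) (simp add: \<eta>1)
    from has_field_derivative_if_dbar_zero[OF this]
    show "\<exists>f'. (H n has_field_derivative f') (at z)" by blast
  qed
  define B where "B = 2 * (M + M) + disc_constant * (2 * (M + 1) * 1)"
  have H_bound: "norm (H n z) \<le> B" if "z \<in> ball 0 R" for n z
  proof -
    have z: "z \<in> ball 0 3" "z \<in> cball 0 R'" using that R R' by auto
    have "norm (G n z) \<le> norm (P z) + norm (l (Suc n) z * of_real (F z))"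
      unfolding G_def by (rule norm_triangle_ineq4)
    also have "\<dots> \<le> M + 1 * M"
      unfolding norm_mult using M z l_bound[OF z(1), of "Suc n"] \<Lambda> by (intro add_mono mult_mono) auto
    finally have g: "norm (G n z) \<le> M + M" by simp
    have "d n \<le> 1" by (simp add: d_def power_le_one)
    then have t: "norm (cauchy_transform (\<lambda>z. of_real (\<eta> z) * E n z) z) \<le> disc_constant * (2 * (M + 1) * 1)"
      using M disc_constant_nonneg by (intro order_trans[OF TE_bound[OF z(1)]] mult_left_mono) auto
    have "norm (H n z) \<le> norm (exp (- s n z)) * norm (G n z) + norm (cauchy_transform (\<lambda>z. of_real (\<eta> z) * E n z) z)"
      unfolding H_def by (rule order_trans[OF norm_triangle_ineq4]) (simp add: norm_mult)
    also have "\<dots> \<le> B" unfolding B_def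
      by (intro add_mono mult_mono exp_bound z g t) auto
    finally show ?thesis .
  qed
  obtain g r where g: "g holomorphic_on ball 0 R" and r: "strict_mono (r :: nat \<Rightarrow> nat)"
    and gr: "\<And>z. z \<in> ball 0 R \<Longrightarrow> (\<lambda>n. H (r n) z) \<longlonglongrightarrow> g z"
  proof (rule Montel[of "ball 0 R" "range H" H])
    show "\<exists>B. \<forall>h\<in>range H. \<forall>z\<in>K. norm (h z) \<le> B" if "compact K" "K \<subseteq> ball 0 R" for K
      using H_bound that by blast
  qed (use hol in auto)
  \<comment> \<open>only the values of \<open>s\<close> at a single point need to converge, and they lie in a compact disc\<close>
  have "\<exists>t. norm t \<le> 1/10 \<and> P z - L z * of_real (F z) = exp t * g z" if "z \<in> ball 0 R" for z
  proof -
    have z: "z \<in> ball 0 3" using that R by auto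
    have "compact (cball (0::complex) (1/10))" by simp
    moreover have "\<forall>n. s (r n) z \<in> cball 0 (1/10)" using s_bound[OF z] by simp
    ultimately obtain t v where t: "t \<in> cball 0 (1/10)" "strict_mono v" "((\<lambda>n. s (r n) z) \<circ> v) \<longlonglongrightarrow> t"
      unfolding compact_def by metis
    have rv: "strict_mono (\<lambda>n. r (v n))" using r t(2) by (simp add: strict_mono_def)
    have 1: "(\<lambda>n. H (r (v n)) z) \<longlonglongrightarrow> g z"
      using LIMSEQ_subseq_LIMSEQ[OF gr[OF that] t(2)] by (simp add: comp_def)
    have "(\<lambda>n. cauchy_transform (\<lambda>z. of_real (\<eta> z) * E n z) z) \<longlonglongrightarrow> 0"
    proof (rule Lim_null_comparison)
      show "\<forall>\<^sub>F n in sequentially. norm (cauchy_transform (\<lambda>z. of_real (\<eta> z) * E n z) z) \<le> disc_constant * (2 * (M + 1) * d n)"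
        using TE_bound[OF z] by simp
      have "d \<longlonglongrightarrow> 0" unfolding d_def by (rule LIMSEQ_power_zero) simp
      then show "(\<lambda>n. disc_constant * (2 * (M + 1) * d n)) \<longlonglongrightarrow> 0"
        by (intro tendsto_mult_right_zero)
    qed
    from LIMSEQ_subseq_LIMSEQ[OF this rv]
    have 2: "(\<lambda>n. cauchy_transform (\<lambda>z. of_real (\<eta> z) * E (r (v n)) z) z) \<longlonglongrightarrow> 0" by (simp add: comp_def)
    have "(\<lambda>n. G n z) \<longlonglongrightarrow> P z - L z * of_real (F z)"
      unfolding G_def by (intro tendsto_intros LIMSEQ_Suc[OF L[OF z]])
    from LIMSEQ_subseq_LIMSEQ[OF this rv]
    have 3: "(\<lambda>n. G (r (v n)) z) \<longlonglongrightarrow> P z - L z * of_real (F z)" by (simp add: comp_def)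
    have 4: "(\<lambda>n. s (r (v n)) z) \<longlonglongrightarrow> t" using t(3) by (simp add: comp_def)
    have "(\<lambda>n. H (r (v n)) z) \<longlonglongrightarrow> exp (- t) * (P z - L z * of_real (F z)) - 0"
      unfolding H_def by (intro tendsto_intros 2 3 4)
    from LIMSEQ_unique[OF this 1] have "exp t * (exp (- t) * (P z - L z * of_real (F z))) = exp t * g z" by simp
    then have "P z - L z * of_real (F z) = exp t * g z"
      by (simp only: mult.assoc[symmetric] exp_minus_inverse mult_1_left)
    then show ?thesis using t(1) by (intro exI[of _ t]) simp
  qed
  then obtain t where "\<And>z. z \<in> ball 0 R \<Longrightarrow> norm (t z) \<le> 1/10 \<and> P z - L z * of_real (F z) = exp (t z) * g z"
    by metis
  with that[OF g, of L t] L_bound R show thesis by auto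
qed

section \<open>Comparison of the solution with its holomorphic factor\<close>

text \<open>
  The outcome of the similarity principle: \<open>P\<close> is \<open>exp s * H\<close> up to a small multiple of \<open>F\<close>.
\<close>

locale similarity_disc = schroedinger_disc +
  fixes R :: real and H l s :: "complex \<Rightarrow> complex"
  assumes R: "5/2 < R" "R < 3"
    and H_hol: "H holomorphic_on ball 0 R"
    and l_bound: "\<And>z. z \<in> ball 0 R \<Longrightarrow> norm (l z) \<le> 1/10"
    and s_bound: "\<And>z. z \<in> ball 0 R \<Longrightarrow> norm (s z) \<le> 1/10"
    and rep: "\<And>z. z \<in> ball 0 R \<Longrightarrow> P z - l z * of_real (F z) = exp (s z) * H z"

lemma norm_exp_small: "norm (exp (z::complex)) \<le> 2" if "norm z \<le> 1/10"
proof -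
  have "norm (exp z) \<le> exp (norm z)" by (rule norm_exp)
  also have "\<dots> \<le> exp (1/2)" using that by simp
  also have "\<dots> \<le> 2" using exp_bound_half[of "1/2::real"] by simp
  finally show ?thesis .
qed

lemma (in similarity_disc)
  assumes "z \<in> ball 0 R"
  shows norm_P_le: "norm (P z) \<le> \<bar>F z\<bar> / 10 + 2 * norm (H z)"
    and norm_H_le: "norm (H z) \<le> 2 * (norm (P z) + \<bar>F z\<bar>)"
proof -
  have P: "P z = l z * of_real (F z) + exp (s z) * H z" using rep[OF assms] by (simp add: algebra_simps)
  have "norm (P z) \<le> norm (l z * of_real (F z)) + norm (exp (s z) * H z)"
    unfolding P by (rule norm_triangle_ineq)
  also have "\<dots> \<le> 1/10 * \<bar>F z\<bar> + 2 * norm (H z)"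
    unfolding norm_mult norm_of_real
    by (intro add_mono mult_right_mono l_bound assms norm_exp_small s_bound) auto
  finally show "norm (P z) \<le> \<bar>F z\<bar> / 10 + 2 * norm (H z)" by simp
  have H: "H z = exp (- s z) * (P z - l z * of_real (F z))"
    unfolding rep[OF assms] by (simp add: mult.assoc[symmetric] exp_minus field_simps)
  have "norm (H z) \<le> 2 * (norm (P z) + norm (l z) * \<bar>F z\<bar>)"
    unfolding H norm_mult
    using norm_triangle_ineq4[of "P z" "l z * of_real (F z)"] norm_exp_small[of "- s z"] s_bound[OF assms]
    by (intro mult_mono) (auto simp: norm_mult)
  also have "\<dots> \<le> 2 * (norm (P z) + 1 * \<bar>F z\<bar>)"
    using l_bound[OF assms] by (intro mult_left_mono add_left_mono mult_right_mono) auto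
  finally show "norm (H z) \<le> 2 * (norm (P z) + \<bar>F z\<bar>)" by simp
qed

text \<open>
  Integrate \<open>\<partial>(\<eta>\<^sup>2 F P)/\<partial>zbar = \<eta>\<^sup>2 |P|\<^sup>2 - \<eta>\<^sup>2 q F\<^sup>2 / 4 + 2 \<eta> (\<partial>\<eta>/\<partial>zbar) F P\<close> over the plane, where \<open>\<eta>\<close> is a
  cutoff, and absorb half of \<open>\<eta>\<^sup>2 |P|\<^sup>2\<close> by the Cauchy inequality.
\<close>

theorem caccioppoli:
  obtains C where "0 \<le> C" "\<And>F q P M. schroedinger_disc F q P \<Longrightarrow> (\<And>z. z \<in> ball 0 (5/2) \<Longrightarrow> \<bar>F z\<bar> \<le> M) \<Longrightarrow>
    integrable lborel (\<lambda>z. indicator (cball 0 (9/4)) z * (norm (P z))\<^sup>2) \<and>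
    (LINT z|lborel. indicator (cball 0 (9/4)) z * (norm (P z))\<^sup>2) \<le> C * M\<^sup>2"
proof -
  obtain \<eta> :: "complex \<Rightarrow> real" where \<eta>: "C1_on UNIV (\<lambda>z. of_real (\<eta> z))" "\<And>z. 0 \<le> \<eta> z" "\<And>z. \<eta> z \<le> 1"
      "\<And>z. norm z \<le> 9/4 \<Longrightarrow> \<eta> z = 1" "\<And>z. 12/5 \<le> norm z \<Longrightarrow> \<eta> z = 0"
  proof -
    have "0 < (9/4::real)" "(9/4::real) < 12/5" by simp_all
    from C1_cutoff_exists[OF this] that show thesis by metis
  qed
  obtain e' e where e: "continuous_on UNIV e'" "continuous_on UNIV e" "\<And>z. z \<in> UNIV \<Longrightarrow> has_wirtinger (\<lambda>z. of_real (\<eta> z)) (e' z) (e z) z"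
    using \<eta>(1) by (rule C1_onE) blast
  have "e z = 0" if "3 \<le> norm z" for z
    by (rule compact_support_derivatives_zero(2)[of "12/5" "\<lambda>z. of_real (\<eta> z)" "e' z" "e z" z])
      (use \<eta>(5) e(3) that in auto)
  then obtain c where c: "0 \<le> c" "\<And>z. norm (e z) \<le> c" using compact_support_bounded[OF e(2), of 3] by metis
  define V where "V = measure lborel (ball (0::complex) (5/2))"
  have V: "0 \<le> V" by (simp add: V_def)
  show thesis
  proof (rule that[of "2 * (2 * c\<^sup>2 + 1) * V"])
    show "0 \<le> 2 * (2 * c\<^sup>2 + 1) * V" using V by simp
    fix F q P M assume "schroedinger_disc F q P" and M: "\<And>z. z \<in> ball 0 (5/2) \<Longrightarrow> \<bar>F z\<bar> \<le> M"
    then interpret schroedinger_disc F q P by simp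
    have M0: "0 \<le> M" using M[of 0] by simp
    define v where "v z = of_real (\<eta> z) * (of_real (\<eta> z) * (of_real (F z) * P z))" for z
    have v_C1: "C1_on UNIV v"
      unfolding v_def[abs_def]
    proof (rule C1_on_cutoff_mult[where b="12/5" and r=3, OF \<eta>(1,5)])
      show "C1_on (ball 0 3) (\<lambda>z. of_real (\<eta> z) * (of_real (F z) * P z))"
        by (intro C1_on_mult F_C1 P_C1 C1_on_subset[OF \<eta>(1)]) simp
    qed auto
    have v0: "v z = 0" if "12/5 \<le> norm z" for z using \<eta>(5)[OF that] by (simp add: v_def)
    obtain A B where AB: "continuous_on UNIV A" "continuous_on UNIV B" "\<And>z. z \<in> UNIV \<Longrightarrow> has_wirtinger v (A z) (B z) z"
      using v_C1 by (rule C1_onE) blast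
    have B0: "B z = 0" if "12/5 < norm z" for z
      by (rule compact_support_derivatives_zero(2)[where r="12/5" and f=v, OF _ AB(3)[OF UNIV_I] that]) (rule v0)
    have int0: "(LINT z|lborel. B z) = 0"
      by (rule integral_dbar_compact_support[OF AB(1,2) AB(3)[OF UNIV_I] v0])
    have ReB: "(1/2) * ((\<eta> z)\<^sup>2 * (norm (P z))\<^sup>2) \<le> Re (B z) + (2 * c\<^sup>2 + 1) * M\<^sup>2 * indicator (ball 0 (5/2)) z" for z
    proof (cases "norm z < 5/2")
      case False
      then have "B z = 0"
        by (intro B0) simp
      then show ?thesis using False \<eta>(5)[of z] by simp
    next
      case True
      then have z: "z \<in> ball 0 3" by simp
      obtain A1 where A1: "has_wirtinger P A1 (of_real (- q z * F z / 4)) z" using P_dbar[OF z] by blast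
      note W = has_wirtinger_mult[OF e(3)[OF UNIV_I] has_wirtinger_mult[OF e(3)[OF UNIV_I]
          has_wirtinger_mult[OF F_deriv[OF z] A1]], folded v_def[abs_def]]
      let ?x = "of_real (\<eta> z) * e z * of_real (F z) * P z :: complex"
      have "B z = 2 * ?x + of_real ((\<eta> z)\<^sup>2) * (P z * cnj (P z)) - of_real ((\<eta> z)\<^sup>2 * q z * (F z)\<^sup>2 / 4)"
        unfolding has_wirtinger_unique(2)[OF AB(3)[OF UNIV_I] W]
        by (simp add: algebra_simps power2_eq_square)
      then have B: "B z = 2 * ?x + of_real ((\<eta> z)\<^sup>2 * (norm (P z))\<^sup>2 - (\<eta> z)\<^sup>2 * q z * (F z)\<^sup>2 / 4)"
        by (simp only: complex_norm_square[symmetric] of_real_mult of_real_diff) simp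
      have Fb: "\<bar>F z\<bar> \<le> M" using M[of z] True by simp
      have F2: "(F z)\<^sup>2 \<le> M\<^sup>2" using Fb M0 by (simp add: abs_le_square_iff[symmetric])
      have "norm ?x \<le> (\<eta> z * norm (P z)) * (c * M)"
      proof -
        have "norm ?x = (\<eta> z * norm (P z)) * (norm (e z) * \<bar>F z\<bar>)" using \<eta>(2) by (simp add: norm_mult)
        also have "\<dots> \<le> (\<eta> z * norm (P z)) * (c * M)"
          using \<eta>(2) c Fb M0 by (intro mult_left_mono mult_mono) auto
        finally show ?thesis .
      qed
      then have x: "- ((\<eta> z * norm (P z)) * (c * M)) \<le> Re ?x"
        using abs_Re_le_cmod[of ?x] by linarith
      \<comment> \<open>the Cauchy inequality that absorbs half of \<open>\<eta>\<^sup>2 |P|\<^sup>2\<close>\<close>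
      have y: "2 * ((\<eta> z * norm (P z)) * (c * M)) \<le> (1/2) * (\<eta> z * norm (P z))\<^sup>2 + 2 * (c * M)\<^sup>2"
        using zero_le_power2[of "\<eta> z * norm (P z) - 2 * (c * M)"] by (simp add: power2_eq_square algebra_simps)
      have "(\<eta> z)\<^sup>2 * q z * (F z)\<^sup>2 \<le> (1 * 1) * M\<^sup>2"
      proof -
        have "(\<eta> z)\<^sup>2 * q z * (F z)\<^sup>2 \<le> \<bar>(\<eta> z)\<^sup>2 * q z\<bar> * (F z)\<^sup>2" by (intro mult_right_mono) auto
        also have "\<dots> \<le> (1 * 1) * M\<^sup>2"
          unfolding abs_mult using \<eta>(2,3)[of z] q_bound[OF z] F2
          by (intro mult_mono) (auto simp: power_le_one)
        finally show ?thesis .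
      qed
      then have w: "(\<eta> z)\<^sup>2 * q z * (F z)\<^sup>2 / 4 \<le> M\<^sup>2" using zero_le_power2[of M] by linarith
      have "Re (B z) = 2 * Re ?x + ((\<eta> z * norm (P z))\<^sup>2 - (\<eta> z)\<^sup>2 * q z * (F z)\<^sup>2 / 4)"
        unfolding B by (simp only: plus_complex.sel Re_complex_of_real power_mult_distrib) simp
      moreover have "(2 * c\<^sup>2 + 1) * M\<^sup>2 = 2 * (c * M)\<^sup>2 + M\<^sup>2" by (simp add: power_mult_distrib algebra_simps)
      ultimately have "(1/2) * (\<eta> z * norm (P z))\<^sup>2 \<le> Re (B z) + (2 * c\<^sup>2 + 1) * M\<^sup>2"
        using x y w by linarith
      then show ?thesis using True by (simp add: power_mult_distrib)
    qed
    have cP: "continuous_on (cball 0 r) P" if "r < 3" for r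
      by (rule continuous_on_subset[OF C1_on_continuous[OF P_C1]]) (use that in auto)
    have c\<eta>: "continuous_on UNIV \<eta>"
      using continuous_on_Re[OF C1_on_continuous[OF \<eta>(1)]] by simp
    have i1: "integrable lborel (\<lambda>z. indicator (cball 0 (9/4)) z * (norm (P z))\<^sup>2)"
    proof -
      have "continuous_on (cball 0 (9/4)) (\<lambda>z. (norm (P z))\<^sup>2)" by (intro continuous_intros cP) simp
      from borel_integrable_compact[OF compact_cball this] show ?thesis by simp
    qed
    have i2: "integrable lborel (\<lambda>z. (\<eta> z)\<^sup>2 * (norm (P z))\<^sup>2)"
    proof -
      have "integrable lborel (\<lambda>z. indicator (cball 0 (12/5)) z *\<^sub>R ((\<eta> z)\<^sup>2 * (norm (P z))\<^sup>2))"
        by (intro borel_integrable_compact continuous_intros cP continuous_on_subset[OF c\<eta>]) auto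
      also have "(\<lambda>z. indicator (cball 0 (12/5)) z *\<^sub>R ((\<eta> z)\<^sup>2 * (norm (P z))\<^sup>2)) = (\<lambda>z. (\<eta> z)\<^sup>2 * (norm (P z))\<^sup>2)"
        using \<eta>(5) by (auto simp: fun_eq_iff indicator_def)
      finally show ?thesis .
    qed
    have iB: "integrable lborel B"
    proof -
      have "integrable lborel (\<lambda>z. indicator (cball 0 3) z *\<^sub>R B z)"
        by (intro borel_integrable_compact continuous_on_subset[OF AB(2)]) auto
      also have "(\<lambda>z. indicator (cball 0 3) z *\<^sub>R B z) = B"
        using B0 by (auto simp: fun_eq_iff indicator_def)
      finally show ?thesis .
    qed
    have iV: "integrable lborel (\<lambda>z::complex. (2 * c\<^sup>2 + 1) * M\<^sup>2 * indicator (ball 0 (5/2)) z)"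
      using emeasure_lborel_ball_finite[of "0::complex" "5/2"]
      by (intro integrable_mult_right integrable_real_indicator) auto
    have "(LINT z|lborel. (1/2) * ((\<eta> z)\<^sup>2 * (norm (P z))\<^sup>2)) \<le>
        (LINT z|lborel. Re (B z) + (2 * c\<^sup>2 + 1) * M\<^sup>2 * indicator (ball 0 (5/2)) z)"
      by (intro integral_mono ReB integrable_mult_right i2 Bochner_Integration.integrable_add integrable_Re iB iV)
    also have "\<dots> = (LINT z|lborel. Re (B z)) + (LINT z|lborel. (2 * c\<^sup>2 + 1) * M\<^sup>2 * indicator (ball (0::complex) (5/2)) z)"
      by (rule Bochner_Integration.integral_add[OF integrable_Re[OF iB] iV])
    also have "(LINT z|lborel. Re (B z)) = 0" using integral_Re[OF iB] int0 by simp
    also have "(LINT z|lborel. (2 * c\<^sup>2 + 1) * M\<^sup>2 * indicator (ball (0::complex) (5/2)) z) = (2 * c\<^sup>2 + 1) * M\<^sup>2 * V"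
      by (simp add: V_def)
    finally have up: "(1/2) * (LINT z|lborel. (\<eta> z)\<^sup>2 * (norm (P z))\<^sup>2) \<le> (2 * c\<^sup>2 + 1) * M\<^sup>2 * V"
      unfolding integral_mult_right_zero by simp
    have "(LINT z|lborel. indicator (cball 0 (9/4)) z * (norm (P z))\<^sup>2) \<le> (LINT z|lborel. (\<eta> z)\<^sup>2 * (norm (P z))\<^sup>2)"
      by (intro integral_mono i1 i2) (use \<eta>(4) in \<open>auto simp: indicator_def\<close>)
    with up have "(LINT z|lborel. indicator (cball 0 (9/4)) z * (norm (P z))\<^sup>2) \<le> 2 * ((2 * c\<^sup>2 + 1) * M\<^sup>2 * V)"
      by linarith
    also have "\<dots> = 2 * (2 * c\<^sup>2 + 1) * V * M\<^sup>2" by simp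
    finally have "(LINT z|lborel. indicator (cball 0 (9/4)) z * (norm (P z))\<^sup>2) \<le> 2 * (2 * c\<^sup>2 + 1) * V * M\<^sup>2" .
    with i1 show "integrable lborel (\<lambda>z. indicator (cball 0 (9/4)) z * (norm (P z))\<^sup>2) \<and>
      (LINT z|lborel. indicator (cball 0 (9/4)) z * (norm (P z))\<^sup>2) \<le> 2 * (2 * c\<^sup>2 + 1) * V * M\<^sup>2" ..
  qed
qed

text \<open>
  The previous bound controls the integral of \<open>|P|\<close>, hence that of \<open>|H|\<close>, over a disc. For holomorphic
  \<open>H\<close> and a cutoff \<open>\<eta>\<close> the Cauchy-Pompeiu formula recovers \<open>H\<close> from \<open>(\<partial>\<eta>/\<partial>zbar) H\<close>, which is supported away
  from the point of evaluation; this bounds \<open>|H|\<close> pointwise by its integral.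
\<close>

theorem representation_factor_bound:
  obtains C where "0 \<le> C" "\<And>F q P R H l s M z. similarity_disc F q P R H l s \<Longrightarrow>
    (\<And>z. z \<in> ball 0 (5/2) \<Longrightarrow> \<bar>F z\<bar> \<le> M) \<Longrightarrow> 0 < M \<Longrightarrow> z \<in> ball 0 2 \<Longrightarrow> norm (H z) \<le> C * M"
proof -
  obtain C1 where C1: "0 \<le> C1" "\<And>F q P M. schroedinger_disc F q P \<Longrightarrow> (\<And>z. z \<in> ball 0 (5/2) \<Longrightarrow> \<bar>F z\<bar> \<le> M) \<Longrightarrow>
    integrable lborel (\<lambda>z. indicator (cball 0 (9/4)) z * (norm (P z))\<^sup>2) \<and>
    (LINT z|lborel. indicator (cball 0 (9/4)) z * (norm (P z))\<^sup>2) \<le> C1 * M\<^sup>2"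
    by (rule caccioppoli) blast
  obtain \<eta> :: "complex \<Rightarrow> real" where \<eta>: "C1_on UNIV (\<lambda>z. of_real (\<eta> z))" "\<And>z. 0 \<le> \<eta> z" "\<And>z. \<eta> z \<le> 1"
      "\<And>z. norm z \<le> 17/8 \<Longrightarrow> \<eta> z = 1" "\<And>z. 9/4 \<le> norm z \<Longrightarrow> \<eta> z = 0"
  proof -
    have "0 < (17/8::real)" "(17/8::real) < 9/4" by simp_all
    from C1_cutoff_exists[OF this] that show thesis by metis
  qed
  obtain e' e where e: "continuous_on UNIV e'" "continuous_on UNIV e" "\<And>z. z \<in> UNIV \<Longrightarrow> has_wirtinger (\<lambda>z. of_real (\<eta> z)) (e' z) (e z) z"
    using \<eta>(1) by (rule C1_onE) blast
  have "e z = 0" if "3 \<le> norm z" for z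
    by (rule compact_support_derivatives_zero(2)[of "9/4" "\<lambda>z. of_real (\<eta> z)" "e' z" "e z" z])
      (use \<eta>(5) e(3) that in auto)
  then obtain c where c: "0 \<le> c" "\<And>z. norm (e z) \<le> c" using compact_support_bounded[OF e(2), of 3] by metis
  have e_in: "e z = 0" if "norm z < 17/8" for z
  proof -
    have "has_wirtinger (\<lambda>z. of_real (\<eta> z)) 0 0 z"
      by (rule has_wirtinger_transform[OF has_wirtinger_const, of "ball 0 (17/8)" _ 1])
        (use \<eta>(4) that in auto)
    then show ?thesis using has_wirtinger_unique(2)[OF e(3)[OF UNIV_I]] by blast
  qed
  define V where "V = measure lborel (cball (0::complex) (9/4))"
  have V: "0 \<le> V" by (simp add: V_def)
  define C2 where "C2 = C1 + V + 2 * V"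
  have C2: "0 \<le> C2" using C1 V by (simp add: C2_def)
  show thesis
  proof (rule that[of "c * C2 / (1/8 * cauchy_mass)"])
    show "0 \<le> c * C2 / (1/8 * cauchy_mass)" using c C2 cauchy_mass_pos by simp
    fix F q P R H l s M and z :: complex
    assume "similarity_disc F q P R H l s" and M: "\<And>z. z \<in> ball 0 (5/2) \<Longrightarrow> \<bar>F z\<bar> \<le> M" "0 < M"
      and z: "z \<in> ball 0 2"
    then interpret similarity_disc F q P R H l s by simp
    note cacc = C1(2)[OF schroedinger_disc_axioms M(1)]
    have sub: "cball 0 (9/4) \<subseteq> ball (0::complex) R" using R by auto
    have iV: "integrable lborel (\<lambda>z::complex. indicator (cball 0 (9/4)) z :: real)"
      using emeasure_lborel_cball_finite[of "0::complex" "9/4"] by (intro integrable_real_indicator) auto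
    have iH: "integrable lborel (\<lambda>z. indicator (cball 0 (9/4)) z * norm (H z))"
      using borel_integrable_compact[of "cball 0 (9/4)" "\<lambda>z. norm (H z)"]
        continuous_on_subset[OF holomorphic_on_imp_continuous_on[OF H_hol] sub]
      by (auto intro: continuous_intros)
    have pt: "indicator (cball 0 (9/4)) w * norm (H w) \<le>
        (1 / M) * (indicator (cball 0 (9/4)) w * (norm (P w))\<^sup>2) + (3 * M) * indicator (cball 0 (9/4)) w" for w
    proof (cases "norm w \<le> 9/4")
      case True
      then have w: "w \<in> ball 0 R" "w \<in> ball 0 (5/2)" using R by auto
      have "2 * norm (P w) \<le> (1 / M) * (norm (P w))\<^sup>2 + M"
        using M(2) zero_le_power2[of "norm (P w) - M"] by (simp add: field_simps power2_eq_square)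
      then show ?thesis using norm_H_le[OF w(1)] M(1)[OF w(2)] True by simp
    qed simp
    have "(LINT w|lborel. indicator (cball 0 (9/4)) w * norm (H w)) \<le>
       (LINT w|lborel. (1 / M) * (indicator (cball 0 (9/4)) w * (norm (P w))\<^sup>2) + (3 * M) * indicator (cball 0 (9/4)) w)"
      by (intro integral_mono pt iH Bochner_Integration.integrable_add integrable_mult_right iV) (use cacc in blast)
    also have "\<dots> = (1 / M) * (LINT w|lborel. indicator (cball 0 (9/4)) w * (norm (P w))\<^sup>2) + (3 * M) * V"
      unfolding V_def using cacc iV by (subst Bochner_Integration.integral_add) auto
    also have "\<dots> \<le> (1 / M) * (C1 * M\<^sup>2) + (3 * M) * V"
      using cacc M(2) by (intro add_right_mono mult_left_mono) auto
    also have "\<dots> = C2 * M" using M(2) by (simp add: C2_def power2_eq_square algebra_simps)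
    finally have L1: "(LINT w|lborel. indicator (cball 0 (9/4)) w * norm (H w)) \<le> C2 * M" .
    have H_C1: "C1_on (ball 0 R) H"
    proof (rule C1_onI[of _ "deriv H" "\<lambda>_. 0"])
      show "continuous_on (ball 0 R) (deriv H)"
        by (intro holomorphic_on_imp_continuous_on holomorphic_deriv H_hol) simp
      show "has_wirtinger H (deriv H w) 0 w" if "w \<in> ball 0 R" for w
        by (rule has_wirtinger_holomorphic) (rule holomorphic_derivI[OF H_hol open_ball that])
    qed simp
    define v where "v w = of_real (\<eta> w) * H w" for w
    have v_C1: "C1_on UNIV v"
      unfolding v_def[abs_def] by (rule C1_on_cutoff_mult[where b="9/4", OF \<eta>(1) _ _ H_C1]) (use \<eta>(5) R in auto)
    have v0: "v w = 0" if "9/4 \<le> norm w" for w using \<eta>(5)[OF that] by (simp add: v_def)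
    obtain A B where AB: "continuous_on UNIV A" "continuous_on UNIV B" "\<And>z. z \<in> UNIV \<Longrightarrow> has_wirtinger v (A z) (B z) z"
      using v_C1 by (rule C1_onE) blast
    have B0: "B w = 0" if "9/4 < norm w" for w
      by (rule compact_support_derivatives_zero(2)[where r="9/4" and f=v, OF _ AB(3)[OF UNIV_I] that]) (rule v0)
    have B: "B w = (if norm w \<le> 9/4 then e w * H w else 0)" for w
    proof (cases "norm w \<le> 9/4")
      case True
      then have w: "w \<in> ball 0 R" using R by auto
      have "has_wirtinger H (deriv H w) 0 w"
        by (rule has_wirtinger_holomorphic) (rule holomorphic_derivI[OF H_hol open_ball w])
      from has_wirtinger_mult[OF e(3)[OF UNIV_I] this, folded v_def[abs_def]]
      have "B w = e w * H w + of_real (\<eta> w) * 0" by (rule has_wirtinger_unique(2)[OF AB(3)[OF UNIV_I]])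
      then show ?thesis using True by simp
    next
      case False
      then show ?thesis
        using B0[of w] by simp
    qed
    have iB: "integrable lborel B"
    proof -
      have "integrable lborel (\<lambda>z. indicator (cball 0 (9/4)) z *\<^sub>R B z)"
        by (intro borel_integrable_compact continuous_on_subset[OF AB(2)]) auto
      also have "(\<lambda>z. indicator (cball 0 (9/4)) z *\<^sub>R B z) = B"
        using B by (auto simp: fun_eq_iff indicator_def)
      finally show ?thesis .
    qed
    have "H z = v z" using \<eta>(4)[of z] z by (simp add: v_def)
    also have "v z = cauchy_transform B z"
      by (rule cauchy_transform_dbar_inverse[OF AB(1,2) AB(3)[OF UNIV_I] v0, symmetric])
    finally have HT: "H z = cauchy_transform B z" .
    have "norm (H z) \<le> (LINT w|lborel. norm (B w)) / (1/8 * cauchy_mass)"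
    proof -
      have "B w = 0" if "norm (z - w) < 1/8" for w
      proof -
        have "norm w \<le> norm z + norm (z - w)" using norm_triangle_ineq4[of z "z - w"] by simp
        then have "norm w < 17/8" using that z by simp
        then show ?thesis using B e_in by simp
      qed
      then show ?thesis
        using cauchy_transform_bound_away[OF iB, of "1/8" z] HT by simp
    qed
    also have "\<dots> \<le> c * (C2 * M) / (1/8 * cauchy_mass)"
    proof (intro divide_right_mono)
      have "(LINT w|lborel. norm (B w)) \<le> (LINT w|lborel. c * (indicator (cball 0 (9/4)) w * norm (H w)))"
      proof (intro integral_mono integrable_mult_right iH)
        show "norm (B w) \<le> c * (indicator (cball 0 (9/4)) w * norm (H w))" for w
          using B[of w] c by (auto simp: norm_mult intro!: mult_right_mono)
      qed (use iB in simp)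
      also have "\<dots> = c * (LINT w|lborel. indicator (cball 0 (9/4)) w * norm (H w))"
        by (rule integral_mult_right_zero)
      also have "\<dots> \<le> c * (C2 * M)" by (intro mult_left_mono L1 c)
      finally show "(LINT w|lborel. norm (B w)) \<le> c * (C2 * M)" .
    qed (use cauchy_mass_pos in simp)
    finally show "norm (H z) \<le> c * C2 / (1/8 * cauchy_mass) * M"
      by (simp add: mult_ac)
  qed
qed

lemma has_derivative_along_line:
  assumes "has_wirtinger (\<lambda>z. of_real (F z)) a (cnj a) (p + of_real t * v)"
  shows "((\<lambda>t. F (p + of_real t * v)) has_real_derivative 2 * Re (a * v)) (at t)"
proof -
  have "((\<lambda>t. p + of_real t * v) has_derivative (\<lambda>h. of_real h * v)) (at t)"
    by (auto intro!: derivative_eq_intros)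
  from has_derivative_compose[OF this assms[unfolded has_wirtinger_def]]
  have "((\<lambda>t. Re (of_real (F (p + of_real t * v)))) has_derivative
      (\<lambda>h. Re (a * (of_real h * v) + cnj a * cnj (of_real h * v)))) (at t)"
    by (rule bounded_linear.has_derivative[OF bounded_linear_Re])
  then have "((\<lambda>t. F (p + of_real t * v)) has_derivative
      (\<lambda>h. Re (a * (of_real h * v) + cnj a * cnj (of_real h * v)))) (at t)" by simp
  also have "(\<lambda>h. Re (a * (of_real h * v) + cnj a * cnj (of_real h * v))) = (*) (2 * Re (a * v))"
    by (rule ext) (simp add: algebra_simps)
  finally show ?thesis by (simp add: has_field_derivative_def)
qed

context similarity_disc
begin

lemma F_line:
  assumes "p + of_real t * v \<in> ball 0 R"
  shows "((\<lambda>t. F (p + of_real t * v)) has_real_derivative 2 * Re (P (p + of_real t * v) * v)) (at t)"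
  by (rule has_derivative_along_line) (rule F_deriv, use assms R in auto)

lemma ball_segment:
  fixes p z :: complex
  assumes "p \<in> ball 0 r" "z \<in> ball 0 r" "0 \<le> t" "t \<le> 1"
  shows "p + of_real t * (z - p) \<in> ball 0 r"
proof -
  have "(1 - t) *\<^sub>R p + t *\<^sub>R z \<in> ball 0 r"
    using convexD[OF convex_ball[of 0 r] assms(1,2), of "1 - t" t] assms(3,4) by simp
  then show ?thesis by (simp add: scaleR_conv_of_real algebra_simps)
qed

lemma increment_bound:
  assumes "p \<in> ball 0 r" "z \<in> ball 0 r" "r \<le> R" "\<And>w. w \<in> ball 0 r \<Longrightarrow> norm (P w) \<le> b"
  shows "\<bar>F z - F p\<bar> \<le> 2 * norm (z - p) * b"
proof -
  have seg: "p + of_real t * (z - p) \<in> ball 0 r" if "0 \<le> t" "t \<le> 1" for t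
    by (rule ball_segment[OF assms(1,2) that])
  have der: "((\<lambda>t. F (p + of_real t * (z - p))) has_real_derivative 2 * Re (P (p + of_real t * (z - p)) * (z - p))) (at t)"
    if "0 \<le> t" "t \<le> 1" for t
    by (rule F_line) (use seg[OF that] assms(3) in auto)
  obtain t where t: "0 < t" "t < 1" and
    eq: "F (p + of_real 1 * (z - p)) - F (p + of_real 0 * (z - p)) = (1 - 0) * (2 * Re (P (p + of_real t * (z - p)) * (z - p)))"
    using MVT2[of 0 1 "\<lambda>t. F (p + of_real t * (z - p))" "\<lambda>t. 2 * Re (P (p + of_real t * (z - p)) * (z - p))"] der
    by auto
  have "F z - F p = 2 * Re (P (p + of_real t * (z - p)) * (z - p))" using eq by simp
  then have "\<bar>F z - F p\<bar> = 2 * \<bar>Re (P (p + of_real t * (z - p)) * (z - p))\<bar>"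
    by (simp only: abs_mult abs_numeral)
  also have "\<dots> \<le> 2 * (norm (P (p + of_real t * (z - p))) * norm (z - p))"
    using abs_Re_le_cmod[of "P (p + of_real t * (z - p)) * (z - p)"] by (simp add: norm_mult)
  also have "\<dots> \<le> 2 * (b * norm (z - p))"
    using seg[of t] t by (intro mult_left_mono mult_right_mono assms(4)) auto
  finally show ?thesis by (simp add: mult_ac)
qed

text \<open>
  Along a segment of length less than \<open>1/2\<close> from the zero \<open>p\<close>, the derivative of \<open>F\<close> is at most
  \<open>2 |P| \<le> m / 5 + 4 h\<close>.
\<close>

lemma F_bound_by_factor:
  assumes "p \<in> ball 0 (1/60)" "F p = 0" "z \<in> ball 0 (1/4)"
    and m: "\<And>w. w \<in> ball 0 (1/4) \<Longrightarrow> \<bar>F w\<bar> \<le> m" and h: "\<And>w. w \<in> ball 0 (1/4) \<Longrightarrow> norm (H w) \<le> h"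
  shows "\<bar>F z\<bar> \<le> 2 * h + m / 2"
proof -
  have "norm (P w) \<le> m / 10 + 2 * h" if "w \<in> ball 0 (1/4)" for w
    using norm_P_le[of w] m[OF that] h[OF that] that R by simp
  then have "\<bar>F z - F p\<bar> \<le> 2 * norm (z - p) * (m / 10 + 2 * h)"
    by (intro increment_bound[of _ "1/4"]) (use assms R in auto)
  also have "\<dots> \<le> 2 * (1/2) * (m / 10 + 2 * h)"
  proof (intro mult_right_mono mult_left_mono)
    show "norm (z - p) \<le> 1/2" using norm_triangle_ineq4[of z p] assms(1,3) by simp
    have "\<bar>F 0\<bar> \<le> m" "norm (H 0) \<le> h" by (auto intro: m h)
    then show "0 \<le> m / 10 + 2 * h" using abs_ge_zero[of "F 0"] norm_ge_zero[of "H 0"] by linarith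
  qed auto
  finally show ?thesis using assms(2) m[of 0] by simp
qed

text \<open>
  Unique continuation. If \<open>F\<close> vanishes on a disc, so does \<open>H\<close>, and therefore \<open>H = 0\<close>. Then \<open>P = l F\<close>, so that
  along a ray from the origin \<open>|F'| \<le> 2 * (1/10) * 3 * |F|\<close>. At the maximum of \<open>|F|\<close> on the ray this
  gives \<open>|F| \<le> (6/10) |F|\<close>.
\<close>

lemma vanishing_on_small_disc:
  assumes "\<And>z. z \<in> ball 0 (1/4) \<Longrightarrow> F z = 0" "z \<in> ball 0 R"
  shows "F z = 0"
proof -
  have "H w = 0" if "w \<in> ball 0 (1/4)" for w
  proof -
    have "has_wirtinger (\<lambda>z. of_real (F z)) 0 0 w"
      by (rule has_wirtinger_transform[OF has_wirtinger_const, of "ball 0 (1/4)" _ 0])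
        (use that assms(1) in auto)
    then have "P w = 0" using has_wirtinger_unique(1)[OF F_deriv] that by auto
    then show ?thesis using norm_H_le[of w] assms(1)[OF that] that R by simp
  qed
  then have H0: "H w = 0" if "w \<in> ball 0 R" for w
  proof -
    have "ball (0::complex) (1/4) \<subseteq> ball 0 R" by (rule subset_ball) (use R in simp)
    then show ?thesis
      using analytic_continuation_open[of "ball 0 (1/4)" "ball 0 R" H "\<lambda>_. 0" w] H_hol that
        \<open>\<And>w. w \<in> ball 0 (1/4) \<Longrightarrow> H w = 0\<close>
      by auto
  qed
  have seg: "of_real t * z \<in> ball 0 R" if "0 \<le> t" "t \<le> 1" for t
    using ball_segment[of 0 R z t] assms(2) R that by simp
  have der: "((\<lambda>t. F (of_real t * z)) has_real_derivative 2 * Re (P (of_real t * z) * z)) (at t)"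
    if "0 \<le> t" "t \<le> 1" for t
    using F_line[of 0 t z] seg[OF that] by simp
  have "continuous_on {0..1} (\<lambda>t. \<bar>F (of_real t * z)\<bar>)"
    by (intro continuous_intros continuous_at_imp_continuous_on ballI DERIV_isCont[OF der]) auto
  then obtain t0 where t0: "t0 \<in> {0..1}" "\<And>t. t \<in> {0..1} \<Longrightarrow> \<bar>F (of_real t * z)\<bar> \<le> \<bar>F (of_real t0 * z)\<bar>"
    using continuous_attains_sup[of "{0..1::real}" "\<lambda>t. \<bar>F (of_real t * z)\<bar>"] by auto
  have "\<bar>F (of_real t0 * z)\<bar> \<le> (6/10) * \<bar>F (of_real t0 * z)\<bar>"
  proof (cases "t0 = 0")
    case True
    then show ?thesis using assms(1)[of 0] by simp
  next
    case False
    then have "0 < t0" using t0 by simp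
    then obtain t where t: "0 < t" "t < t0" and
      eq: "F (of_real t0 * z) - F (of_real 0 * z) = (t0 - 0) * (2 * Re (P (of_real t * z) * z))"
      using MVT2[of 0 t0 "\<lambda>t. F (of_real t * z)" "\<lambda>t. 2 * Re (P (of_real t * z) * z)"] der t0(1) by auto
    have t1: "0 \<le> t" "t \<le> 1" using t t0 by auto
    have "F (of_real t0 * z) = t0 * (2 * Re (P (of_real t * z) * z))"
      using eq assms(1)[of 0] by simp
    then have "\<bar>F (of_real t0 * z)\<bar> = t0 * (2 * \<bar>Re (P (of_real t * z) * z)\<bar>)"
      using t0(1) by (simp only: abs_mult abs_numeral) simp
    also have "\<dots> \<le> 1 * (2 * (norm (P (of_real t * z)) * norm z))"
      using abs_Re_le_cmod[of "P (of_real t * z) * z"] t0(1)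
      by (intro mult_mono) (auto simp: norm_mult)
    also have "\<dots> \<le> 1 * (2 * ((\<bar>F (of_real t0 * z)\<bar> / 10) * 3))"
      using norm_P_le[OF seg[OF t1]] H0[OF seg[OF t1]] t0(2)[of t] t1 assms(2) R
      by (intro mult_mono) auto
    finally show ?thesis by simp
  qed
  then show ?thesis using t0(2)[of 1] by simp
qed

end

section \<open>Zeros of holomorphic functions of controlled growth\<close>

lemma norm_prod_list_ge_power:
  fixes xs :: "complex list"
  assumes "\<And>x. x \<in> set xs \<Longrightarrow> c \<le> norm x" "0 \<le> c"
  shows "c ^ length xs \<le> norm (prod_list xs)"
  using assms(1)
proof (induction xs)
  case (Cons x xs)
  then show ?case using assms(2) by (auto simp: norm_mult intro!: mult_mono)
qed simp

lemma norm_prod_list_le_power: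
  fixes xs :: "complex list"
  assumes "\<And>x. x \<in> set xs \<Longrightarrow> norm x \<le> c" "0 \<le> c"
  shows "norm (prod_list xs) \<le> c ^ length xs"
  using assms(1)
proof (induction xs)
  case (Cons x xs)
  then show ?case using assms(2) by (auto simp: norm_mult intro!: mult_mono)
qed simp

text \<open>
  The slack \<open>t\<close> leaves room for one factor \<open>w\<close> that is close to \<open>1\<close> for a different reason.
\<close>

lemma norm_prod_list_minus_one:
  fixes w :: complex
  assumes "norm (w - 1) \<le> exp t - 1"
  shows "norm ((\<Prod>x\<leftarrow>xs. 1 + x) * w - 1) \<le> exp ((\<Sum>x\<leftarrow>xs. norm x) + t) - 1"
proof (induction xs)
  case Nil
  then show ?case using assms by simp
next
  case (Cons x xs)
  define v where "v = (\<Prod>x\<leftarrow>xs. 1 + x) * w"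
  define T where "T = (\<Sum>x\<leftarrow>xs. norm x) + t"
  have v: "norm (v - 1) \<le> exp T - 1" using Cons by (simp add: v_def T_def)
  have "(1 + x) * v - 1 = (v - 1) * (1 + x) + x" by (simp add: algebra_simps)
  then have "norm ((1 + x) * v - 1) \<le> norm (v - 1) * norm (1 + x) + norm x"
    using norm_triangle_ineq[of "(v - 1) * (1 + x)" x] by (simp add: norm_mult)
  also have "\<dots> \<le> (exp T - 1) * (1 + norm x) + norm x"
    using v norm_triangle_ineq[of 1 x] order_trans[OF norm_ge_zero v]
    by (intro add_right_mono mult_mono) auto
  also have "\<dots> = exp T * (1 + norm x) - 1" by (simp add: algebra_simps)
  also have "\<dots> \<le> exp T * exp (norm x) - 1"
    using exp_ge_add_one_self[of "norm x"] by (intro diff_right_mono mult_left_mono) auto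
  also have "\<dots> = exp (norm x + T) - 1" by (simp add: exp_add mult.commute)
  finally show ?case by (simp add: v_def T_def mult.assoc add.assoc)
qed

text \<open>
  Jensen's inequality by the maximum principle, applied to the cofactor \<open>Q\<close> on the disc of radius \<open>3/2\<close>
  about \<open>z0\<close>: on its boundary each \<open>|z - a|\<close> is at least \<open>1\<close>, while \<open>|z0 - a| \<le> 1/2\<close>.
\<close>

lemma partial_factorization_bounds:
  assumes H: "\<And>z. z \<in> ball 0 2 \<Longrightarrow> norm (H z) \<le> M"
    and z0: "z0 \<in> ball 0 (1/4)" "0 < m" "m \<le> norm (H z0)"
    and zs: "set zs \<subseteq> cball z0 (1/2)" and Q: "Q holomorphic_on ball 0 2"
    and fac: "\<And>z. z \<in> ball 0 2 \<Longrightarrow> H z = (\<Prod>a\<leftarrow>zs. z - a) * Q z"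
  shows "z \<in> cball z0 (3/2) \<Longrightarrow> norm (Q z) \<le> M" "m \<le> norm (Q z0)" "2 ^ length zs * m \<le> M"
proof -
  have sub: "cball z0 (3/2) \<subseteq> ball 0 2"
  proof
    fix z assume "z \<in> cball z0 (3/2)"
    then show "z \<in> ball 0 2" using z0(1) norm_triangle_ineq[of z0 "z - z0"] by (simp add: dist_norm norm_minus_commute)
  qed
  have z0': "z0 \<in> ball 0 2" using z0(1) by simp
  show QM: "norm (Q z) \<le> M" if "z \<in> cball z0 (3/2)" for z
  proof (rule maximum_modulus_frontier[of Q "cball z0 (3/2)"])
    show "Q holomorphic_on interior (cball z0 (3/2))"
      by (rule holomorphic_on_subset[OF Q]) (use sub interior_subset in blast)
    show "continuous_on (closure (cball z0 (3/2))) Q"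
      using continuous_on_subset[OF holomorphic_on_imp_continuous_on[OF Q] sub] by simp
    fix w assume "w \<in> frontier (cball z0 (3/2))"
    then have w: "norm (w - z0) = 3/2" by (simp add: frontier_cball dist_norm norm_minus_commute)
    then have "w \<in> cball z0 (3/2)" by (simp add: dist_norm norm_minus_commute)
    then have w2: "w \<in> ball 0 2" using sub by blast
    have "1 ^ length (map (\<lambda>a. w - a) zs) \<le> norm (prod_list (map (\<lambda>a. w - a) zs))"
    proof (rule norm_prod_list_ge_power)
      fix x assume "x \<in> set (map (\<lambda>a. w - a) zs)"
      then obtain a where a: "a \<in> set zs" "x = w - a" by auto
      then have "norm (a - z0) \<le> 1/2" using zs by (auto simp: dist_norm norm_minus_commute)
      then show "1 \<le> norm x" using norm_triangle_ineq[of "w - a" "a - z0"] w a by simp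
    qed simp
    then have "1 * norm (Q w) \<le> norm (\<Prod>a\<leftarrow>zs. w - a) * norm (Q w)" by (intro mult_right_mono) auto
    also have "\<dots> = norm (H w)" using fac[OF w2] by (simp add: norm_mult)
    finally show "norm (Q w) \<le> M" using H[OF w2] by simp
  qed (use that in auto)
  have le: "norm (\<Prod>a\<leftarrow>zs. z0 - a) \<le> (1/2) ^ length zs"
  proof -
    have "norm (prod_list (map (\<lambda>a. z0 - a) zs)) \<le> (1/2) ^ length (map (\<lambda>a. z0 - a) zs)"
      by (rule norm_prod_list_le_power) (use zs in \<open>auto simp: dist_norm\<close>)
    then show ?thesis by simp
  qed
  have m1: "m \<le> (1/2) ^ length zs * norm (Q z0)"
    using z0(3) fac[OF z0'] le mult_right_mono[OF le, of "norm (Q z0)"] by (simp add: norm_mult)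
  also have "\<dots> \<le> 1 * norm (Q z0)" by (intro mult_right_mono) (auto simp: power_le_one)
  finally show "m \<le> norm (Q z0)" by simp
  have "2 ^ length zs * m \<le> 2 ^ length zs * ((1/2) ^ length zs * norm (Q z0))"
    using m1 by (intro mult_left_mono) auto
  also have "\<dots> = norm (Q z0)" by (simp add: power_one_over)
  also have "\<dots> \<le> M" using QM[of z0] by simp
  finally show "2 ^ length zs * m \<le> M" .
qed

text \<open>
  By the third of the preceding bounds, the number of linear factors that can be split off is bounded.
  After splitting off as many as possible, the cofactor has no zero left in the disc.
\<close>

lemma zero_factorization:
  assumes hol: "H holomorphic_on ball 0 2" and H: "\<And>z. z \<in> ball 0 2 \<Longrightarrow> norm (H z) \<le> M"
    and z0: "z0 \<in> ball 0 (1/4)" "0 < m" "m \<le> norm (H z0)"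
  obtains zs Q where "set zs \<subseteq> cball z0 (1/2)" "Q holomorphic_on ball 0 2"
    "\<And>z. z \<in> ball 0 2 \<Longrightarrow> H z = (\<Prod>a\<leftarrow>zs. z - a) * Q z"
    "\<And>z. z \<in> cball z0 (1/2) \<Longrightarrow> Q z \<noteq> 0" "real (length zs) \<le> 2 * ln (M / m)"
proof -
  define good where "good zs Q \<longleftrightarrow> set zs \<subseteq> cball z0 (1/2) \<and> Q holomorphic_on ball 0 2 \<and>
    (\<forall>z\<in>ball 0 2. H z = (\<Prod>a\<leftarrow>zs. z - a) * Q z)" for zs Q
  have len: "real (length zs) \<le> 2 * ln (M / m)" if "good zs Q" for zs Q
  proof -
    have "2 ^ length zs * m \<le> M"
      by (rule partial_factorization_bounds(3)[of H M z0 m zs Q])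
        (use that H z0 in \<open>auto simp: good_def\<close>)
    then have "2 ^ length zs \<le> M / m" using z0 by (simp add: field_simps)
    then have "ln (2 ^ length zs) \<le> ln (M / m)"
      by (intro ln_mono) (auto intro: less_le_trans[OF zero_less_power])
    then have "real (length zs) * ln 2 \<le> ln (M / m)" by (simp add: ln_realpow)
    moreover have "real (length zs) * (1/2) \<le> real (length zs) * ln 2"
    proof (intro mult_left_mono)
      have "exp (1/2) \<le> (2::real)" using exp_bound_half[of "1/2::real"] by simp
      then show "1/2 \<le> ln (2::real)" by (subst ln_ge_iff) auto
    qed simp
    ultimately show ?thesis by simp
  qed
  have ex: "\<exists>zs Q. good zs Q \<and> length zs = 0"
    using hol by (intro exI[of _ "[]"] exI[of _ H]) (simp add: good_def)
  have bd: "(\<exists>zs Q. good zs Q \<and> length zs = n) \<Longrightarrow> n \<le> nat \<lceil>2 * ln (M / m)\<rceil>" for n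
    using len by (metis le_nat_iff le_ceiling_iff real_nat_ceiling_ge of_nat_le_iff order_trans)
  obtain n where n: "\<exists>zs Q. good zs Q \<and> length zs = n" "\<And>k. (\<exists>zs Q. good zs Q \<and> length zs = k) \<Longrightarrow> k \<le> n"
    using GreatestI_nat[where P="\<lambda>n. \<exists>zs Q. good zs Q \<and> length zs = n", OF ex bd]
      Greatest_le_nat[where P="\<lambda>n. \<exists>zs Q. good zs Q \<and> length zs = n", OF _ bd] by blast
  then obtain zs Q where g: "good zs Q" "length zs = n" by blast
  show thesis
  proof (rule that[of zs Q])
    show "Q z \<noteq> 0" if z: "z \<in> cball z0 (1/2)" for z
    proof
      assume "Q z = 0"
      define Q1 where "Q1 w = (if w = z then deriv Q z else Q w / (w - z))" for w
      have "Q1 holomorphic_on ball 0 2"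
        by (rule pole_theorem_open_0[of Q _ z]) (use g \<open>Q z = 0\<close> in \<open>auto simp: good_def Q1_def\<close>)
      moreover have "Q w = (w - z) * Q1 w" for w using \<open>Q z = 0\<close> by (simp add: Q1_def)
      ultimately have "good (z # zs) Q1" using g z by (auto simp: good_def mult_ac)
      then show False using n(2)[of "Suc n"] g(2) by fastforce
    qed
  qed (use g len in \<open>auto simp: good_def\<close>)
qed

text \<open>
  The Borel-Caratheodory inequality. Let \<open>g\<close> be a logarithm of \<open>Q\<close>, \<open>u = g - g z0\<close> and \<open>A\<close> an upper bound for
  the real part of \<open>u\<close>. Schwarz's lemma applies to \<open>u / (2 A - u)\<close>, which maps into the unit disc, and
  gives \<open>|u| \<le> 8 A\<close> on the disc of radius \<open>2/5\<close>. Cauchy's estimate then bounds \<open>u'\<close>.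
\<close>

lemma nonvanishing_log_lipschitz:
  assumes Q: "Q holomorphic_on ball z0 (1/2)" "\<And>z. z \<in> ball z0 (1/2) \<Longrightarrow> Q z \<noteq> 0"
    and M: "\<And>z. z \<in> ball z0 (1/2) \<Longrightarrow> norm (Q z) \<le> M" and m: "0 < m" "m \<le> norm (Q z0)"
  obtains g where "\<And>z. z \<in> ball z0 (1/2) \<Longrightarrow> Q z = exp (g z)"
    "\<And>z w. z \<in> ball z0 (3/10) \<Longrightarrow> w \<in> ball z0 (3/10) \<Longrightarrow> norm (g w - g z) \<le> 80 * (ln (M / m) + 1) * norm (w - z)"
proof -
  obtain g where "g holomorphic_on ball z0 (1/2)" and "\<And>z. z \<in> ball z0 (1/2) \<Longrightarrow> exp (g z) = Q z"
    by (rule holomorphic_logarithm_exists[of "ball z0 (1/2)" Q z0]) (use Q in auto)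
  then have g: "g holomorphic_on ball z0 (1/2)" "\<And>z. z \<in> ball z0 (1/2) \<Longrightarrow> Q z = exp (g z)" by auto
  define A where "A = ln (M / m) + 1"
  have Mm: "0 < M" "m \<le> M" using M[of z0] m by auto
  have A: "A \<ge> 1" using Mm m by (simp add: A_def)
  define u where "u z = g z - g z0" for z
  have Re_u: "Re (u z) < A" if "z \<in> ball z0 (1/2)" for z
  proof -
    have "exp (Re (u z)) = norm (Q z) / norm (Q z0)"
      using g(2)[OF that] g(2)[of z0] by (simp add: u_def exp_diff)
    also have "\<dots> \<le> M / m" using M[OF that] m Mm by (intro frac_le) auto
    finally have "Re (u z) \<le> ln (M / m)" using Mm m by (subst ln_ge_iff) auto
    then show ?thesis by (simp add: A_def)
  qed
  have u_hol: "u holomorphic_on ball z0 (1/2)" unfolding u_def[abs_def] by (intro holomorphic_intros g)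
  \<comment> \<open>rescaled to the unit disc; \<open>|u| < |2 A - u|\<close> because the real part of \<open>u\<close> is below \<open>A\<close>\<close>
  define f where "f w = u (z0 + w / 2) / (2 * of_real A - u (z0 + w / 2))" for w
  have in_ball: "z0 + w / 2 \<in> ball z0 (1/2)" if "norm w < 1" for w :: complex using that by (simp add: dist_norm norm_divide)
  have ne: "2 * of_real A - u z \<noteq> 0" if "z \<in> ball z0 (1/2)" for z
  proof
    assume "2 * of_real A - u z = 0"
    then have "Re (2 * of_real A - u z) = 0" by simp
    then show False using Re_u[OF that] A by simp
  qed
  have lt: "norm (u z) < norm (2 * of_real A - u z)" if "z \<in> ball z0 (1/2)" for z
  proof -
    have "(norm (u z))\<^sup>2 < (norm (2 * of_real A - u z))\<^sup>2"
      unfolding cmod_power2 using Re_u[OF that] A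
      by (simp add: power2_eq_square algebra_simps)
    then show ?thesis by (rule power2_less_imp_less) simp
  qed
  have f_hol: "f holomorphic_on ball 0 1"
  proof -
    have 1: "(\<lambda>w. u (z0 + w / 2)) holomorphic_on ball 0 1"
    proof -
      have "(\<lambda>w. z0 + w / 2) holomorphic_on ball 0 1" by (intro holomorphic_intros) auto
      moreover have "(\<lambda>w. z0 + w / 2) ` ball 0 1 \<subseteq> ball z0 (1/2)"
        by (rule image_subsetI) (rule in_ball, simp)
      ultimately show ?thesis
        using holomorphic_on_compose_gen[OF _ u_hol] by (simp add: comp_def)
    qed
    show ?thesis unfolding f_def[abs_def]
      by (intro holomorphic_intros 1) (use ne in_ball in auto)
  qed
  have schwarz: "norm (f w) \<le> norm w" if "norm w < 1" for w
  proof (rule Schwarz_Lemma(1)[OF f_hol _ _ that])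
    show "f 0 = 0" by (simp add: f_def u_def)
    fix z :: complex assume "norm z < 1"
    then show "norm (f z) < 1" using lt[OF in_ball] ne[OF in_ball] by (simp add: f_def norm_divide)
  qed
  have u_bound: "norm (u z) \<le> 8 * A" if "z \<in> cball z0 (4/10)" for z
  proof -
    define w where "w = 2 * (z - z0)"
    have "norm w = 2 * norm (z - z0)" unfolding w_def norm_mult by simp
    moreover have "norm (z - z0) \<le> 4/10" using that by (simp add: dist_norm norm_minus_commute)
    ultimately have w: "norm w \<le> 4/5" "z = z0 + w / 2" by (simp_all add: w_def field_simps)
    have zb: "z \<in> ball z0 (1/2)" using that by simp
    have "norm (u z) / norm (2 * of_real A - u z) \<le> norm w"
      using schwarz[of w] w(1) by (simp add: f_def w(2)[symmetric] norm_divide)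
    then have "norm (u z) \<le> norm w * norm (2 * of_real A - u z)"
      using ne[OF zb] by (simp add: divide_le_eq)
    also have "\<dots> \<le> 4/5 * (2 * A + norm (u z))"
      using norm_triangle_ineq4[of "2 * of_real A" "u z"] A w(1) by (intro mult_mono) (auto simp: norm_mult)
    finally show ?thesis by simp
  qed
  have deriv_bound: "norm (deriv u z) \<le> 80 * A" if z: "z \<in> ball z0 (3/10)" for z
  proof -
    have sub: "cball z (1/10) \<subseteq> cball z0 (4/10)"
    proof
      fix x assume "x \<in> cball z (1/10)"
      then show "x \<in> cball z0 (4/10)" using z dist_triangle[of z0 x z] by simp
    qed
    then have sub2: "cball z (1/10) \<subseteq> ball z0 (1/2)" by auto
    have "norm ((deriv ^^ 1) u z) \<le> fact 1 * (8 * A) / (1/10) ^ 1"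
    proof (rule Cauchy_inequality)
      show "u holomorphic_on ball z (1/10)"
        by (rule holomorphic_on_subset[OF u_hol]) (use sub2 in auto)
      show "continuous_on (cball z (1/10)) u"
        by (rule continuous_on_subset[OF holomorphic_on_imp_continuous_on[OF u_hol] sub2])
      show "norm (u x) \<le> 8 * A" if "norm (z - x) = 1/10" for x
      proof (rule u_bound)
        have "x \<in> cball z (1/10)" using that by (simp add: dist_norm)
        then show "x \<in> cball z0 (4/10)" using sub by blast
      qed
    qed simp
    then show ?thesis by simp
  qed
  show thesis
  proof (rule that[of g])
    show "Q z = exp (g z)" if "z \<in> ball z0 (1/2)" for z by (rule g(2)[OF that])
    fix z w assume zw: "z \<in> ball z0 (3/10)" "w \<in> ball z0 (3/10)"
    have "norm (u w - u z) \<le> 80 * A * norm (w - z)"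
    proof (rule field_differentiable_bound[of "ball z0 (3/10)" u "deriv u"])
      fix x assume x: "x \<in> ball z0 (3/10)"
      have "(u has_field_derivative deriv u x) (at x)"
        by (rule holomorphic_derivI[OF u_hol open_ball]) (use x in auto)
      then show "(u has_field_derivative deriv u x) (at x within ball z0 (3/10))"
        by (rule has_field_derivative_at_within)
    qed (use deriv_bound zw in auto)
    then show "norm (g w - g z) \<le> 80 * (ln (M / m) + 1) * norm (w - z)" by (simp add: u_def A_def)
  qed
qed

text \<open>
  Write \<open>H\<close> as the product of its linear factors and \<open>exp g\<close>. Then \<open>H w / H z\<close> is the product of the
  numbers \<open>1 + (w - z) / (z - a)\<close> and \<open>exp (g w - g z)\<close>; by assumption the sum of all deviations from \<open>1\<close>
  is at most \<open>1/20\<close>.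
\<close>

theorem doubling_controls_oscillation:
  fixes H :: "complex \<Rightarrow> complex"
  assumes hol: "H holomorphic_on ball 0 2" and H: "\<And>z. z \<in> ball 0 2 \<Longrightarrow> norm (H z) \<le> M"
    and z0: "z0 \<in> ball 0 (1/4)" "0 < m" "m \<le> norm (H z0)"
  obtains zs where "set zs \<subseteq> ball 0 1" "real (length zs) \<le> 2 * ln (M / m)"
    "\<And>z w \<delta>. z \<in> ball 0 (1/60) \<Longrightarrow> z \<notin> set zs \<Longrightarrow> norm (w - z) \<le> \<delta> \<Longrightarrow>
       \<delta> * ((\<Sum>a\<leftarrow>zs. 1 / norm (z - a)) + 120 * (ln (M / m) + 1)) \<le> 1/20 \<Longrightarrow>
       H z \<noteq> 0 \<and> norm (H w - H z) \<le> norm (H z) / 10"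
proof -
  obtain zs Q where zs: "set zs \<subseteq> cball z0 (1/2)" and Q: "Q holomorphic_on ball 0 2"
    and fac: "\<And>z. z \<in> ball 0 2 \<Longrightarrow> H z = (\<Prod>a\<leftarrow>zs. z - a) * Q z"
    and Q0: "\<And>z. z \<in> cball z0 (1/2) \<Longrightarrow> Q z \<noteq> 0" and len: "real (length zs) \<le> 2 * ln (M / m)"
    using zero_factorization[OF hol H z0] by metis
  note pf = partial_factorization_bounds[OF H z0 zs Q fac]
  have QM: "norm (Q z) \<le> M" if "z \<in> cball z0 (3/2)" for z by (rule pf(1)) (use that in auto)
  have Qm: "m \<le> norm (Q z0)" by (rule pf(2))
  have sub: "ball z0 (1/2) \<subseteq> ball 0 2"
  proof
    fix z assume "z \<in> ball z0 (1/2)"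
    then show "z \<in> ball 0 2" using z0(1) norm_triangle_ineq[of z0 "z - z0"] by (simp add: dist_norm norm_minus_commute)
  qed
  obtain g where g: "\<And>z. z \<in> ball z0 (1/2) \<Longrightarrow> Q z = exp (g z)"
    "\<And>z w. z \<in> ball z0 (3/10) \<Longrightarrow> w \<in> ball z0 (3/10) \<Longrightarrow> norm (g w - g z) \<le> 80 * (ln (M / m) + 1) * norm (w - z)"
    by (rule nonvanishing_log_lipschitz[of Q z0 M m])
      (use holomorphic_on_subset[OF Q sub] Q0 QM Qm z0 in auto)
  have L: "0 \<le> ln (M / m)"
    using QM[of z0] Qm z0(2) by (intro ln_ge_zero) (simp add: field_simps)
  show thesis
  proof (rule that[of zs])
    show "set zs \<subseteq> ball 0 1"
    proof
      fix a assume "a \<in> set zs"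
      then have "norm (a - z0) \<le> 1/2" using zs by (auto simp: dist_norm norm_minus_commute)
      then show "a \<in> ball 0 1" using z0(1) norm_triangle_ineq[of z0 "a - z0"] by simp
    qed
    show "real (length zs) \<le> 2 * ln (M / m)" by (rule len)
    fix z w :: complex and \<delta> :: real
    assume z: "z \<in> ball 0 (1/60)" "z \<notin> set zs" and w: "norm (w - z) \<le> \<delta>"
      and \<delta>: "\<delta> * ((\<Sum>a\<leftarrow>zs. 1 / norm (z - a)) + 120 * (ln (M / m) + 1)) \<le> 1/20"
    define S where "S = (\<Sum>a\<leftarrow>zs. 1 / norm (z - a))"
    have S: "0 \<le> S" unfolding S_def by (intro sum_list_nonneg) auto
    have \<delta>0: "0 \<le> \<delta>" using w norm_ge_zero[of "w - z"] by linarith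
    have "\<delta> * 120 \<le> \<delta> * (S + 120 * (ln (M / m) + 1))" using \<delta>0 S L by (intro mult_left_mono) auto
    then have "\<delta> \<le> 1/60" using \<delta> by (simp add: S_def)
    then have zb: "z \<in> ball z0 (3/10)" "w \<in> ball z0 (3/10)"
      using z(1) z0(1) w norm_triangle_ineq4[of z z0] norm_triangle_ineq[of "w - z" "z - z0"]
      by (auto simp: dist_norm norm_minus_commute)
    then have zb2: "z \<in> ball z0 (1/2)" "w \<in> ball z0 (1/2)" by auto
    then have zb3: "z \<in> ball 0 2" "w \<in> ball 0 2" using sub by auto
    have Hz: "H z \<noteq> 0"
      using fac[OF zb3(1)] Q0[of z] zb2 z(2) by (auto simp: prod_list_zero_iff)
    define xs where "xs = map (\<lambda>a. (w - z) / (z - a)) zs"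
    have pe: "(\<Prod>a\<leftarrow>as. w - a) = (\<Prod>a\<leftarrow>as. z - a) * (\<Prod>x\<leftarrow>map (\<lambda>a. (w - z) / (z - a)) as. 1 + x)"
      if "z \<notin> set as" for as
      using that
    proof (induction as)
      case (Cons a as)
      then have "w - a = (z - a) * (1 + (w - z) / (z - a))" by (simp add: field_simps)
      with Cons show ?case by (simp add: mult_ac)
    qed simp
    define y where "y = g w - g z"
    have Qe: "Q w = Q z * exp y" using g(1)[OF zb2(1)] g(1)[OF zb2(2)] by (simp add: y_def exp_diff)
    have Hw: "H w = H z * ((\<Prod>x\<leftarrow>xs. 1 + x) * exp y)"
      unfolding fac[OF zb3(1)] fac[OF zb3(2)] Qe pe[OF z(2)] xs_def by (simp add: mult_ac)
    have y: "3/2 * norm y \<le> \<delta> * (120 * (ln (M / m) + 1))"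
    proof -
      have "norm y \<le> 80 * (ln (M / m) + 1) * norm (w - z)" unfolding y_def by (rule g(2)[OF zb])
      also have "\<dots> \<le> 80 * (ln (M / m) + 1) * \<delta>" using w L by (intro mult_left_mono) auto
      finally have "3/2 * norm y \<le> 3/2 * (80 * (ln (M / m) + 1) * \<delta>)" by (intro mult_left_mono) auto
      also have "\<dots> = \<delta> * (120 * (ln (M / m) + 1))" by (simp only: mult_ac)
      finally show ?thesis .
    qed
    have xsum: "(\<Sum>x\<leftarrow>xs. norm x) \<le> \<delta> * S"
    proof -
      have "(\<Sum>x\<leftarrow>xs. norm x) = (\<Sum>a\<leftarrow>zs. norm (w - z) * (1 / norm (z - a)))"
        by (simp add: xs_def comp_def norm_divide)
      also have "\<dots> = norm (w - z) * S" unfolding S_def by (rule sum_list_const_mult)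
      also have "\<dots> \<le> \<delta> * S" by (intro mult_right_mono w S)
      finally show ?thesis .
    qed
    have tot: "(\<Sum>x\<leftarrow>xs. norm x) + 3/2 * norm y \<le> 1/20"
      using xsum y \<delta> unfolding S_def[symmetric] distrib_left[of \<delta>] by linarith
    have xs0: "0 \<le> (\<Sum>x\<leftarrow>xs. norm x)" by (intro sum_list_nonneg) auto
    have "norm (exp y - 1) \<le> 3/2 * norm y"
      by (rule norm_exp_bounds) (use tot xs0 in simp)
    also have "\<dots> \<le> exp (3/2 * norm y) - 1" using exp_ge_add_one_self[of "3/2 * norm y"] by linarith
    finally have "norm ((\<Prod>x\<leftarrow>xs. 1 + x) * exp y - 1) \<le> exp ((\<Sum>x\<leftarrow>xs. norm x) + 3/2 * norm y) - 1"
      by (rule norm_prod_list_minus_one)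
    also have "\<dots> \<le> exp (1/20) - 1" using tot by simp
    also have "\<dots> \<le> 1/10" using exp_bound_lemma[of "1/20::real"] by simp
    finally have "norm ((\<Prod>x\<leftarrow>xs. 1 + x) * exp y - 1) \<le> 1/10" .
    moreover have "H w - H z = H z * ((\<Prod>x\<leftarrow>xs. 1 + x) * exp y - 1)" unfolding Hw by (simp only: right_diff_distrib mult_1_right)
    ultimately have "norm (H w - H z) \<le> norm (H z) * (1/10)"
      by (simp only: norm_mult) (intro mult_left_mono, auto)
    then show "H z \<noteq> 0 \<and> norm (H w - H z) \<le> norm (H z) / 10" using Hz by simp
  qed
qed

section \<open>One-dimensional Hausdorff premeasure\<close>

lemma hausdorff1_pre_le:
  assumes "A \<subseteq> (\<Union>i. C i)" "\<And>i. bounded (C i)" "\<And>i. diameter (C i) \<le> \<delta>"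
  shows "hausdorff1_pre \<delta> A \<le> (\<Sum>i. ennreal (diameter (C i)))"
  unfolding hausdorff1_pre_def by (rule INF_lower) (use assms in auto)

lemma hausdorff1_pre_le_diameter:
  assumes "bounded A" "diameter A \<le> \<delta>" "0 \<le> \<delta>"
  shows "hausdorff1_pre \<delta> A \<le> ennreal (diameter A)"
proof -
  have "hausdorff1_pre \<delta> A \<le> (\<Sum>i. ennreal (diameter (if i = 0 then A else {})))"
    by (rule hausdorff1_pre_le[where C="\<lambda>i::nat. if i = 0 then A else {}"]) (use assms in \<open>auto split: if_splits\<close>)
  also have "\<dots> = (\<Sum>i\<in>{0::nat}. ennreal (diameter (if i = 0 then A else {})))"
    by (rule suminf_finite) auto
  finally show ?thesis by simp
qed

lemma hausdorff1_pre_mono: "A \<subseteq> B \<Longrightarrow> hausdorff1_pre \<delta> A \<le> hausdorff1_pre \<delta> B"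
  unfolding hausdorff1_pre_def by (rule INF_superset_mono) auto

lemma hausdorff1_pre_countably_subadditive:
  fixes A :: "nat \<Rightarrow> 'a::metric_space set"
  shows "hausdorff1_pre \<delta> (\<Union>i. A i) \<le> (\<Sum>i. hausdorff1_pre \<delta> (A i))"
proof (rule ennreal_le_epsilon)
  fix e :: real assume e: "0 < e" and fin: "(\<Sum>i. hausdorff1_pre \<delta> (A i)) < top"
  have "\<exists>C. A i \<subseteq> (\<Union>j. C j) \<and> (\<forall>j. bounded (C j) \<and> diameter (C j) \<le> \<delta>) \<and>
      (\<Sum>j. ennreal (diameter (C j))) \<le> hausdorff1_pre \<delta> (A i) + ennreal (e * (1/2) ^ Suc i)" for i
  proof -
    have "hausdorff1_pre \<delta> (A i) < top"
      using fin sum_le_suminf[of "\<lambda>i. hausdorff1_pre \<delta> (A i)" "{i}"] by (auto simp: le_less_trans)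
    then have "hausdorff1_pre \<delta> (A i) < hausdorff1_pre \<delta> (A i) + ennreal (e * (1/2) ^ Suc i)"
      using e by (simp add: ennreal_add_left_cancel_less[of _ 0, simplified] less_top)
    then show ?thesis
      unfolding hausdorff1_pre_def[of \<delta> "A i"] INF_less_iff by (auto intro: less_imp_le)
  qed
  then obtain C where C: "\<And>i. A i \<subseteq> (\<Union>j. C i j)" "\<And>i j. bounded (C i j)" "\<And>i j. diameter (C i j) \<le> \<delta>"
    "\<And>i. (\<Sum>j. ennreal (diameter (C i j))) \<le> hausdorff1_pre \<delta> (A i) + ennreal (e * (1/2) ^ Suc i)"
    by metis
  \<comment> \<open>enumerate the double sequence of covering sets\<close>
  define D where "D n = (case prod_decode n of (i, j) \<Rightarrow> C i j)" for n
  have "hausdorff1_pre \<delta> (\<Union>i. A i) \<le> (\<Sum>n. ennreal (diameter (D n)))"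
  proof (rule hausdorff1_pre_le)
    show "(\<Union>i. A i) \<subseteq> (\<Union>n. D n)"
    proof
      fix x assume "x \<in> (\<Union>i. A i)"
      then obtain i j where "x \<in> C i j" using C(1) by blast
      then have "x \<in> D (prod_encode (i, j))" by (simp add: D_def)
      then show "x \<in> (\<Union>n. D n)" by blast
    qed
  qed (auto simp: D_def C split: prod.split)
  also have "\<dots> = (\<Sum>i. \<Sum>j. ennreal (diameter (C i j)))"
    using suminf_ennreal_2dimen[of "\<lambda>i. \<Sum>j. ennreal (diameter (C i j))" "\<lambda>(i, j). ennreal (diameter (C i j))"]
    by (simp add: D_def comp_def case_prod_beta)
  also have "\<dots> \<le> (\<Sum>i. hausdorff1_pre \<delta> (A i) + ennreal (e * (1/2) ^ Suc i))"
    by (intro suminf_le C) auto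
  also have "\<dots> = (\<Sum>i. hausdorff1_pre \<delta> (A i)) + (\<Sum>i. ennreal (e * (1/2) ^ Suc i))"
    by (rule suminf_add[symmetric]) auto
  also have "(\<Sum>i. ennreal (e * (1/2) ^ Suc i)) = ennreal e"
  proof (rule suminf_ennreal_eq)
    show "(\<lambda>i. e * (1/2) ^ Suc i) sums e"
      using sums_mult[OF power_half_series, of e] by (simp only: mult_1_right)
  qed (use e in auto)
  finally show "hausdorff1_pre \<delta> (\<Union>i. A i) \<le> (\<Sum>i. hausdorff1_pre \<delta> (A i)) + ennreal e" .
qed

lemma hausdorff1_pre_empty: "0 \<le> \<delta> \<Longrightarrow> hausdorff1_pre \<delta> {} = 0"
  using hausdorff1_pre_le_diameter[of "{}" \<delta>] by simp

lemma hausdorff1_pre_Un: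
  assumes "0 \<le> \<delta>"
  shows "hausdorff1_pre \<delta> (A \<union> B) \<le> hausdorff1_pre \<delta> A + hausdorff1_pre \<delta> B"
proof -
  define D where "D n = (if n = 0 then A else if n = 1 then B else {})" for n :: nat
  have "hausdorff1_pre \<delta> (A \<union> B) \<le> hausdorff1_pre \<delta> (\<Union>n. D n)"
  proof (rule hausdorff1_pre_mono)
    have "A = D 0" "B = D 1" by (auto simp: D_def)
    then show "A \<union> B \<subseteq> (\<Union>n. D n)" by blast
  qed
  also have "\<dots> \<le> (\<Sum>n. hausdorff1_pre \<delta> (D n))" by (rule hausdorff1_pre_countably_subadditive)
  also have "\<dots> = (\<Sum>n\<in>{0,1}. hausdorff1_pre \<delta> (D n))"
    by (rule suminf_finite) (auto simp: D_def hausdorff1_pre_empty[OF assms])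
  also have "\<dots> = hausdorff1_pre \<delta> A + hausdorff1_pre \<delta> B" by (simp add: D_def)
  finally show ?thesis .
qed

lemma hausdorff1_pre_finite_UN:
  assumes "0 \<le> \<delta>" "finite I"
  shows "hausdorff1_pre \<delta> (\<Union>i\<in>I. A i) \<le> (\<Sum>i\<in>I. hausdorff1_pre \<delta> (A i))"
  using assms(2)
proof (induction I)
  case (insert i I)
  then show ?case
    using order_trans[OF hausdorff1_pre_Un[OF assms(1), of "A i" "\<Union>i\<in>I. A i"]]
    by (auto intro: add_left_mono)
qed (simp add: hausdorff1_pre_empty assms)

lemma hausdorff1_pre_finite_set:
  assumes "0 \<le> \<delta>" "finite I"
  shows "hausdorff1_pre \<delta> I = 0"
proof -
  have "hausdorff1_pre \<delta> I \<le> (\<Sum>i\<in>I. hausdorff1_pre \<delta> {i})"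
    using hausdorff1_pre_finite_UN[OF assms, of "\<lambda>i. {i}"] by simp
  also have "\<dots> \<le> (\<Sum>i\<in>I. 0)"
    by (intro sum_mono order_trans[OF hausdorff1_pre_le_diameter]) (use assms in auto)
  finally show ?thesis by simp
qed

text \<open>
  Cut the interval \<open>[- r, r]\<close>, which contains the range of \<open>f\<close>, into \<open>n\<close> intervals of equal length. As the
  inverse of \<open>f\<close> is \<open>K\<close>-Lipschitz, each of the \<open>n\<close> corresponding pieces of \<open>A\<close> has diameter at most
  \<open>2 K r / n\<close>.
\<close>

lemma hausdorff1_pre_lipschitz_graph:
  fixes A :: "'a::metric_space set" and f :: "'a \<Rightarrow> real"
  assumes lip: "\<And>x y. x \<in> A \<Longrightarrow> y \<in> A \<Longrightarrow> dist x y \<le> K * \<bar>f x - f y\<bar>"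
    and range: "\<And>x. x \<in> A \<Longrightarrow> \<bar>f x\<bar> \<le> r" and "0 \<le> K" "0 < r" "0 < \<delta>"
  shows "hausdorff1_pre \<delta> A \<le> ennreal (2 * K * r)"
proof -
  obtain n :: nat where n: "2 * K * r / \<delta> < real n" using reals_Archimedean2 by blast
  have "0 \<le> 2 * K * r / \<delta>" using assms by simp
  then have n0: "0 < n" using n by (cases n) auto
  define B where "B k = {x \<in> A. - r + real k * (2 * r / n) \<le> f x \<and> f x \<le> - r + real (Suc k) * (2 * r / n)}" for k
  have close: "dist x y \<le> 2 * K * r / n" if "x \<in> B k" "y \<in> B k" for x y k
  proof -
    have "\<bar>f x - f y\<bar> \<le> 2 * r / n" using that by (auto simp: B_def algebra_simps add_divide_distrib)
    then have "K * \<bar>f x - f y\<bar> \<le> K * (2 * r / n)" using assms by (intro mult_left_mono)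
    moreover have "K * (2 * r / n) = 2 * K * r / n" by (simp add: mult_ac)
    moreover have "dist x y \<le> K * \<bar>f x - f y\<bar>" using that by (intro lip) (auto simp: B_def)
    ultimately show ?thesis by linarith
  qed
  have nn: "0 \<le> 2 * K * r / n" using assms by simp
  have bd: "bounded (B k)" for k
    unfolding bounded_def using close by (metis equals0I)
  have di: "diameter (B k) \<le> 2 * K * r / n" for k
    unfolding diameter_def using close nn by (auto intro!: cSUP_least)
  have small: "2 * K * r / n \<le> \<delta>" using n n0 assms by (simp add: field_simps)
  have cover: "A \<subseteq> (\<Union>k\<in>{..<n}. B k)"
  proof
    fix x assume x: "x \<in> A"
    define t where "t = (f x + r) / (2 * r / n)"
    have t: "0 \<le> t" "t \<le> real n"
    proof -
      have r: "0 \<le> f x + r" "f x + r \<le> 2 * r" using range[OF x] by (auto simp: abs_le_iff)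
      then show "0 \<le> t" using assms by (simp add: t_def)
      have "0 < 2 * r / n" using assms n0 by simp
      moreover have "f x + r \<le> real n * (2 * r / n)" using r n0 by simp
      ultimately show "t \<le> real n" unfolding t_def by (subst pos_divide_le_eq) auto
    qed
    have fx: "f x = - r + t * (2 * r / n)" using assms n0 by (simp add: t_def)
    define k where "k = min (n - 1) (nat \<lfloor>t\<rfloor>)"
    have "real k \<le> t" "t \<le> real (Suc k)" "k < n"
    proof -
      show "real k \<le> t" using t(1) by (simp add: k_def min_def) linarith
      show "t \<le> real (Suc k)" using t n0 by (cases "n - 1 \<le> nat \<lfloor>t\<rfloor>") (auto simp: k_def min_def, linarith)
      show "k < n" using n0 by (simp add: k_def min_less_iff_disj)
    qed
    moreover have "0 \<le> 2 * r / n" using assms by simp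
    ultimately have "real k * (2 * r / n) \<le> t * (2 * r / n)" "t * (2 * r / n) \<le> real (Suc k) * (2 * r / n)"
      by (intro mult_right_mono; simp)+
    then have "x \<in> B k" using x fx by (simp add: B_def)
    then show "x \<in> (\<Union>k\<in>{..<n}. B k)" using \<open>k < n\<close> by blast
  qed
  have "hausdorff1_pre \<delta> A \<le> hausdorff1_pre \<delta> (\<Union>k\<in>{..<n}. B k)" by (rule hausdorff1_pre_mono[OF cover])
  also have "\<dots> \<le> (\<Sum>k<n. hausdorff1_pre \<delta> (B k))" by (rule hausdorff1_pre_finite_UN) (use assms in auto)
  also have "\<dots> \<le> (\<Sum>k<n. ennreal (2 * K * r / n))"
    by (intro sum_mono order_trans[OF hausdorff1_pre_le_diameter] ennreal_leI di bd order_trans[OF di small])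
      (use assms in auto)
  also have "\<dots> = ennreal (2 * K * r)" using n0 nn by (simp add: ennreal_of_nat_eq_real_of_nat ennreal_mult[symmetric])
  finally show ?thesis .
qed

section \<open>Zeros of the solution where the factor is nearly constant\<close>

text \<open>
  After the zero at \<open>0\<close> the function is positive, so just before its next zero it is positive as well,
  and the derivative at that zero cannot be positive.
\<close>

lemma no_two_upcrossing_zeros:
  fixes \<phi> :: "real \<Rightarrow> real"
  assumes der: "\<And>t. 0 \<le> t \<Longrightarrow> t \<le> 1 \<Longrightarrow> (\<phi> has_real_derivative \<phi>' t) (at t)"
    and pos: "\<And>t. 0 \<le> t \<Longrightarrow> t \<le> 1 \<Longrightarrow> \<phi> t = 0 \<Longrightarrow> 0 < \<phi>' t"
    and "\<phi> 0 = 0" "\<phi> 1 = 0"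
  shows False
proof -
  obtain d where d: "0 < d" "\<And>h. 0 < h \<Longrightarrow> h < d \<Longrightarrow> \<phi> 0 < \<phi> (0 + h)"
    using DERIV_pos_inc_right[OF der[of 0]] pos[of 0] assms(3) by auto
  define h where "h = min d 1 / 2"
  have h: "0 < h" "h < d" "h < 1" using d by (auto simp: h_def min_def)
  have hp: "0 < \<phi> h" using d(2)[OF h(1,2)] assms(3) by simp
  have cont: "continuous_on {h..1} \<phi>"
    by (intro continuous_at_imp_continuous_on ballI DERIV_isCont[OF der]) (use h in auto)
  define S where "S = {t \<in> {h..1}. \<phi> t = 0}"
  have "closed S"
    unfolding S_def by (rule continuous_closed_preimage_constant[OF cont]) simp
  moreover have "bounded S" by (rule bounded_subset[of "{h..1}"]) (auto simp: S_def)
  ultimately have "compact S" by (simp add: compact_eq_bounded_closed)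
  moreover have "1 \<in> S" using h assms by (simp add: S_def)
  ultimately obtain t1 where t1: "t1 \<in> S" "\<And>t. t \<in> S \<Longrightarrow> t1 \<le> t"
    using compact_attains_inf[of S] by auto
  have t1': "h \<le> t1" "t1 \<le> 1" "\<phi> t1 = 0" using t1 by (auto simp: S_def)
  then have "h < t1" using hp by (cases "h = t1") auto
  obtain e where e: "0 < e" "\<And>x. 0 < x \<Longrightarrow> x < e \<Longrightarrow> \<phi> (t1 - x) < \<phi> t1"
    using DERIV_pos_inc_left[OF der[of t1]] pos[of t1] t1' h by auto
  define x where "x = min e (t1 - h) / 2"
  have x: "0 < x" "x < e" "x < t1 - h" using e \<open>h < t1\<close> by (auto simp: x_def min_def)
  have neg: "\<phi> (t1 - x) < 0" using e(2)[OF x(1,2)] t1' by simp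
  have "\<exists>t\<ge>h. t \<le> t1 - x \<and> \<phi> t = 0"
    by (rule IVT2') (use neg hp x continuous_on_subset[OF cont] t1' in \<open>auto intro: less_imp_le\<close>)
  then obtain t where "h \<le> t" "t \<le> t1 - x" "\<phi> t = 0" by blast
  then have "t \<in> S" using t1' x by (simp add: S_def)
  then show False using t1(2)[of t] \<open>t \<le> t1 - x\<close> x by simp
qed

text \<open>
  Otherwise \<open>F\<close> increases through each of its zeros on the segment from \<open>a\<close> to \<open>b\<close>: there
  \<open>P = exp s * H\<close> differs from \<open>H z\<close> by at most \<open>|H z| / 2\<close>.
\<close>

lemma (in similarity_disc) zeros_in_cone:
  assumes z: "H z \<noteq> 0" and osc: "\<And>w. w \<in> ball z \<rho> \<Longrightarrow> norm (H w - H z) \<le> norm (H z) / 10"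
    and sub: "ball z \<rho> \<subseteq> ball 0 R" and a: "a \<in> ball z \<rho>" "F a = 0" and b: "b \<in> ball z \<rho>" "F b = 0"
  shows "Re (H z * (b - a)) \<le> norm (H z) * norm (b - a) / 2"
proof (rule ccontr)
  assume "\<not> ?thesis"
  then have big: "norm (H z) * norm (b - a) / 2 < Re (H z * (b - a))" by simp
  let ?x = "\<lambda>t. a + of_real t * (b - a)"
  have seg: "?x t \<in> ball z \<rho>" if "0 \<le> t" "t \<le> 1" for t
  proof -
    have "(1 - t) *\<^sub>R a + t *\<^sub>R b \<in> ball z \<rho>"
      using convexD[OF convex_ball[of z \<rho>] a(1) b(1), of "1 - t" t] that by simp
    then show ?thesis by (simp add: scaleR_conv_of_real algebra_simps)
  qed
  show False
  proof (rule no_two_upcrossing_zeros[of "\<lambda>t. F (?x t)" "\<lambda>t. 2 * Re (P (?x t) * (b - a))"])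
    fix t :: real assume t: "0 \<le> t" "t \<le> 1"
    have x: "?x t \<in> ball 0 R" using seg[OF t] sub by blast
    show "((\<lambda>t. F (?x t)) has_real_derivative 2 * Re (P (?x t) * (b - a))) (at t)"
      by (rule F_line[OF x])
    assume "F (?x t) = 0"
    then have P: "P (?x t) = exp (s (?x t)) * H (?x t)" using rep[OF x] by simp
    have e: "norm (exp (s (?x t)) - 1) \<le> 3/2 * (1/10)"
      using norm_exp_bounds(2)[of "s (?x t)"] s_bound[OF x] by simp
    have h: "norm (H (?x t) - H z) \<le> norm (H z) / 10" by (rule osc[OF seg[OF t]])
    have "norm (H (?x t)) \<le> 11/10 * norm (H z)"
      using h norm_triangle_ineq[of "H (?x t) - H z" "H z"] by simp
    then have eh: "norm (exp (s (?x t)) - 1) * norm (H (?x t)) \<le> 3/20 * (11/10 * norm (H z))"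
      using e by (intro mult_mono) auto
    have eq: "P (?x t) - H z = (exp (s (?x t)) - 1) * H (?x t) + (H (?x t) - H z)"
      unfolding P by (simp add: algebra_simps)
    have "norm (P (?x t) - H z) \<le> norm (exp (s (?x t)) - 1) * norm (H (?x t)) + norm (H (?x t) - H z)"
      unfolding eq using norm_triangle_ineq[of "(exp (s (?x t)) - 1) * H (?x t)" "H (?x t) - H z"]
      by (simp only: norm_mult)
    then have "norm (P (?x t) - H z) \<le> norm (H z) / 2" using eh h norm_ge_zero[of "H z"] by linarith
    then have "norm ((P (?x t) - H z) * (b - a)) \<le> norm (H z) / 2 * norm (b - a)"
      unfolding norm_mult by (intro mult_right_mono) auto
    then have "\<bar>Re ((P (?x t) - H z) * (b - a))\<bar> \<le> norm (H z) * norm (b - a) / 2"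
      using abs_Re_le_cmod[of "(P (?x t) - H z) * (b - a)"] by simp
    moreover have "Re (P (?x t) * (b - a)) = Re (H z * (b - a)) + Re ((P (?x t) - H z) * (b - a))"
      by (simp add: algebra_simps)
    ultimately show "0 < 2 * Re (P (?x t) * (b - a))" using big by linarith
  qed (use a b in auto)
qed

text \<open>
  With \<open>u = H z / |H z|\<close>, the cone condition bounds the component \<open>Re (u (x - y))\<close> by half of the distance
  of two zeros, so that the component \<open>Im (u (x - y))\<close> is at least the other half.
\<close>

lemma (in similarity_disc) zeros_lipschitz_graph:
  assumes z: "H z \<noteq> 0" and osc: "\<And>w. w \<in> ball z \<rho> \<Longrightarrow> norm (H w - H z) \<le> norm (H z) / 10"
    and sub: "ball z \<rho> \<subseteq> ball 0 R" and "0 < \<rho>" "0 < \<delta>"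
  shows "hausdorff1_pre \<delta> {x \<in> ball z \<rho>. F x = 0} \<le> ennreal (4 * \<rho>)"
proof -
  define u where "u = H z / norm (H z)"
  have u: "norm u = 1" using z by (simp add: u_def norm_divide)
  have "hausdorff1_pre \<delta> {x \<in> ball z \<rho>. F x = 0} \<le> ennreal (2 * 2 * \<rho>)"
  proof (rule hausdorff1_pre_lipschitz_graph[where f="\<lambda>x. Im (u * (x - z))"])
    fix x y assume xy: "x \<in> {x \<in> ball z \<rho>. F x = 0}" "y \<in> {x \<in> ball z \<rho>. F x = 0}"
    have c: "Re (u * (b - a)) \<le> norm (b - a) / 2"
      if "a \<in> {x \<in> ball z \<rho>. F x = 0}" "b \<in> {x \<in> ball z \<rho>. F x = 0}" for a b
    proof -
      have "Re (H z * (b - a)) \<le> norm (H z) * norm (b - a) / 2"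
        by (rule zeros_in_cone[OF z osc sub]) (use that in auto)
      moreover have "u * (b - a) = H z * (b - a) / norm (H z)" by (simp add: u_def)
      ultimately show ?thesis using z by (simp only: Re_divide_of_real) (simp add: field_simps)
    qed
    have "Re (u * (x - y)) = - Re (u * (y - x))" by (simp add: algebra_simps)
    then have "\<bar>Re (u * (x - y))\<bar> \<le> norm (x - y) / 2"
      using c[OF xy] c[OF xy(2,1)] norm_minus_commute[of x y] by linarith
    moreover have "norm (x - y) \<le> \<bar>Re (u * (x - y))\<bar> + \<bar>Im (u * (x - y))\<bar>"
      using cmod_le[of "u * (x - y)"] u by (simp add: norm_mult)
    moreover have "Im (u * (x - y)) = Im (u * (x - z)) - Im (u * (y - z))" by (simp add: algebra_simps)
    ultimately show "dist x y \<le> 2 * \<bar>Im (u * (x - z)) - Im (u * (y - z))\<bar>"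
      by (simp add: dist_norm)
  next
    fix x assume "x \<in> {x \<in> ball z \<rho>. F x = 0}"
    then show "\<bar>Im (u * (x - z))\<bar> \<le> \<rho>"
      using abs_Im_le_cmod[of "u * (x - z)"] u by (simp add: norm_mult dist_norm norm_minus_commute)
  qed (use assms in auto)
  then show ?thesis by simp
qed

section \<open>Summing the radii of a covering\<close>

lemma integral_inverse_dist_unit_ball:
  fixes a :: complex
  assumes "a \<in> ball 0 1"
  shows "integrable lborel (\<lambda>z. indicator (ball 0 1) z * (1 / norm (z - a)))"
    "(LINT z|lborel. indicator (ball 0 1) z * (1 / norm (z - a))) \<le> 2 * planar_riesz"
proof -
  define k where "k w = (indicator (ball 0 2) w / norm w :: real)" for w :: complex
  have k: "integrable lborel k" unfolding k_def by (rule integrable_inverse_norm_on_ball)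
  have ka: "integrable lborel (\<lambda>z. k (z - a))"
    using lborel_integrable_affine[OF k, of 1 "- a"] by (simp add: algebra_simps)
  have le: "indicator (ball 0 1) z * (1 / norm (z - a)) \<le> k (z - a)" for z
    using norm_triangle_ineq4[of z a] assms by (auto simp: k_def indicator_def)
  show i: "integrable lborel (\<lambda>z. indicator (ball 0 1) z * (1 / norm (z - a)))"
  proof (rule Bochner_Integration.integrable_bound[OF ka])
    show "(\<lambda>z. indicator (ball 0 1) z * (1 / norm (z - a))) \<in> borel_measurable lborel"
      by (auto intro!: borel_measurable_times borel_measurable_indicator borel_measurable_divide)
    show "AE z in lborel. norm (indicator (ball 0 1) z * (1 / norm (z - a))) \<le> norm (k (z - a))"
    proof (rule AE_I2)
      fix z
      have "norm (indicator (ball 0 1) z * (1 / norm (z - a))) = indicator (ball 0 1) z * (1 / norm (z - a))"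
        by (simp add: abs_mult)
      then show "norm (indicator (ball 0 1) z * (1 / norm (z - a))) \<le> norm (k (z - a))"
        using le[of z] by simp
    qed
  qed
  have "(LINT z|lborel. indicator (ball 0 1) z * (1 / norm (z - a))) \<le> (LINT z|lborel. k (z - a))"
    by (intro integral_mono i ka le)
  also have "\<dots> = (LINT z|lborel. k z)"
    using lborel_integral_affine[of k 1 "- a"] k by (simp add: algebra_simps)
  also have "\<dots> = 2 * planar_riesz" unfolding k_def by (rule integral_inverse_norm_ball) simp
  finally show "(LINT z|lborel. indicator (ball 0 1) z * (1 / norm (z - a))) \<le> 2 * planar_riesz" .
qed

text \<open>
  A holomorphic function with zeros \<open>zs\<close> and cofactor \<open>exp g\<close>, where \<open>|g'| \<le> K\<close>, has logarithmic
  derivative at most \<open>root_weight K zs z\<close> at \<open>z\<close>. Its inverse is the scale on which the function is nearly constant.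
\<close>

definition root_weight :: "real \<Rightarrow> complex list \<Rightarrow> complex \<Rightarrow> real" where
  "root_weight K zs z = (\<Sum>a\<leftarrow>zs. 1 / norm (z - a)) + K"

definition unit_disc_area :: real where
  "unit_disc_area = measure lborel (ball (0::complex) 1)"

lemma measure_disc: "0 \<le> r \<Longrightarrow> measure lborel (ball (z::complex) r) = r\<^sup>2 * unit_disc_area"
  by (simp add: unit_disc_area_def content_ball)

lemma unit_disc_area_pos: "0 < unit_disc_area"
  unfolding unit_disc_area_def by (rule content_ball_pos) simp

lemma root_weight_integral:
  assumes "set zs \<subseteq> ball 0 1"
  shows "integrable lborel (\<lambda>z. indicator (ball 0 1) z * root_weight K zs z)" (is ?A)
    "(LINT z|lborel. indicator (ball 0 1) z * root_weight K zs z) \<le> length zs * (2 * planar_riesz) + K * unit_disc_area" (is ?B)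
proof -
  have "?A \<and> ?B" using assms
  proof (induction zs)
    case Nil
    have "integrable lborel (indicator (ball (0::complex) 1) :: complex \<Rightarrow> real)"
      using emeasure_lborel_ball_finite[of "0::complex" 1] by (intro integrable_real_indicator) auto
    then show ?case by (simp add: root_weight_def unit_disc_area_def)
  next
    case (Cons a zs)
    then have a: "a \<in> ball 0 1" by simp
    note i1 = integral_inverse_dist_unit_ball[OF a]
    have IH: "integrable lborel (\<lambda>z. indicator (ball 0 1) z * root_weight K zs z)"
      "(LINT z|lborel. indicator (ball 0 1) z * root_weight K zs z) \<le> length zs * (2 * planar_riesz) + K * unit_disc_area"
      using Cons by auto
    have eq: "(\<lambda>z. indicator (ball 0 1) z * root_weight K (a # zs) z) =
        (\<lambda>z. indicator (ball 0 1) z * (1 / norm (z - a)) + indicator (ball 0 1) z * root_weight K zs z)"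
      by (rule ext) (simp add: root_weight_def algebra_simps)
    have "(LINT z|lborel. indicator (ball 0 1) z * root_weight K (a # zs) z) \<le>
        2 * planar_riesz + (length zs * (2 * planar_riesz) + K * unit_disc_area)"
      unfolding eq Bochner_Integration.integral_add[OF i1(1) IH(1)] by (intro add_mono i1(2) IH(2))
    moreover have "integrable lborel (\<lambda>z. indicator (ball 0 1) z * root_weight K (a # zs) z)"
      unfolding eq by (intro Bochner_Integration.integrable_add i1 IH)
    ultimately show ?case by (simp add: algebra_simps)
  qed
  then show ?A ?B by auto
qed

text \<open>
  The distance of \<open>z\<close> to each root is at least \<open>1 / root_weight K zs z\<close>, so that moving \<open>z\<close> by less than
  this at most doubles each distance.
\<close>

lemma root_weight_comparable:
  assumes z: "z \<notin> set zs" and K: "0 < K" and w: "norm (w - z) < 1 / root_weight K zs z" and w': "w \<notin> set zs"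
  shows "root_weight K zs z \<le> 2 * root_weight K zs w"
proof -
  have each: "1 / norm (z - a) \<le> 2 * (1 / norm (w - a))" if a: "a \<in> set zs" for a
  proof -
    have pos: "0 < norm (z - a)" "0 < norm (w - a)" using a z w' by auto
    have "1 / norm (z - a) \<le> (\<Sum>a\<leftarrow>zs. 1 / norm (z - a))"
      by (rule member_le_sum_list) (use a in auto)
    then have "1 / norm (z - a) \<le> root_weight K zs z" using K by (simp add: root_weight_def)
    then have "inverse (root_weight K zs z) \<le> inverse (1 / norm (z - a))"
      using pos by (intro le_imp_inverse_le) auto
    then have "1 / root_weight K zs z \<le> norm (z - a)" by (simp add: divide_inverse)
    then have "norm (w - a) \<le> 2 * norm (z - a)"
      using w norm_triangle_ineq[of "w - z" "z - a"] by simp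
    then show ?thesis using pos by (simp add: field_simps)
  qed
  have "(\<Sum>a\<leftarrow>zs. 1 / norm (z - a)) \<le> (\<Sum>a\<leftarrow>zs. 2 * (1 / norm (w - a)))"
    by (rule sum_list_mono) (rule each)
  also have "\<dots> = 2 * (\<Sum>a\<leftarrow>zs. 1 / norm (w - a))" by (rule sum_list_const_mult)
  finally show ?thesis using K by (simp add: root_weight_def)
qed

text \<open>
  A disc of radius \<open>\<rho> = 1 / (100 W)\<close> has area \<open>\<pi> \<rho>\<^sup>2\<close> and \<open>W\<close> is at least half of its central value on it,
  hence the integral of \<open>W\<close> over it is at least a constant times \<open>\<rho>\<close>.
  Since the discs are disjoint, these integrals add up to at most the integral over the unit disc.
\<close>

lemma disjoint_radii_sum:
  assumes zs: "set zs \<subseteq> ball 0 1" and K: "0 < K" and T: "finite T" "T \<subseteq> ball 0 1" "T \<inter> set zs = {}"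
    and rad: "\<And>z. z \<in> T \<Longrightarrow> \<rho> z = 1 / (100 * root_weight K zs z)"
    and sub: "\<And>z. z \<in> T \<Longrightarrow> ball z (\<rho> z) \<subseteq> ball 0 1"
    and disj: "pairwise (\<lambda>z w. disjnt (ball z (\<rho> z)) (ball w (\<rho> w))) T"
  shows "(\<Sum>z\<in>T. \<rho> z) \<le> 200 / unit_disc_area * (length zs * (2 * planar_riesz) + K * unit_disc_area)"
proof -
  let ?W = "root_weight K zs"
  note W = root_weight_integral[OF zs, of K]
  have Wpos: "0 < ?W z" for z
    using K unfolding root_weight_def by (intro add_nonneg_pos sum_list_nonneg) auto
  have meas: "?W \<in> borel_measurable borel"
  proof -
    have "(\<lambda>z::complex. \<Sum>a\<leftarrow>as. 1 / norm (z - a)) \<in> borel_measurable borel" for as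
      by (induction as) (auto intro!: borel_measurable_add borel_measurable_divide)
    then show ?thesis unfolding root_weight_def[abs_def] by (intro borel_measurable_add) auto
  qed
  have iz: "integrable lborel (\<lambda>w. indicator (ball z (\<rho> z)) w * ?W w)" if "z \<in> T" for z
  proof (rule Bochner_Integration.integrable_bound[OF W(1)])
    show "(\<lambda>w. indicator (ball z (\<rho> z)) w * ?W w) \<in> borel_measurable lborel"
      using meas by (auto intro!: borel_measurable_times borel_measurable_indicator)
    show "AE w in lborel. norm (indicator (ball z (\<rho> z)) w * ?W w) \<le> norm (indicator (ball 0 1) w * ?W w)"
      using sub[OF that] by (intro AE_I2) (auto simp: indicator_def)
  qed
  have one: "\<rho> z \<le> 200 / unit_disc_area * (LINT w|lborel. indicator (ball z (\<rho> z)) w * ?W w)" if z: "z \<in> T" for z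
  proof -
    have r: "0 < \<rho> z" using rad[OF z] Wpos[of z] by simp
    have ii: "integrable lborel (\<lambda>w. (?W z / 2) * indicator (ball z (\<rho> z)) w :: real)"
      using emeasure_lborel_ball_finite[of z "\<rho> z"] by (intro integrable_mult_right integrable_real_indicator) auto
    have "(LINT w|lborel. (?W z / 2) * indicator (ball z (\<rho> z)) w) \<le> (LINT w|lborel. indicator (ball z (\<rho> z)) w * ?W w)"
    proof (rule integral_mono_AE[OF ii iz[OF z]])
      have "AE w in lborel. w \<notin> set zs"
        by (rule AE_not_in) (intro finite_imp_null_set_lborel, simp)
      then show "AE w in lborel. (?W z / 2) * indicator (ball z (\<rho> z)) w \<le> indicator (ball z (\<rho> z)) w * ?W w"
      proof eventually_elim
        case (elim w)
        show ?case
        proof (cases "w \<in> ball z (\<rho> z)")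
          case True
          have "\<rho> z \<le> 1 / ?W z" using rad[OF z] Wpos[of z] by (simp add: field_simps)
          then have "?W z \<le> 2 * ?W w"
            using True z T(3) elim
            by (intro root_weight_comparable K) (auto simp: dist_norm norm_minus_commute)
          then show ?thesis using True by simp
        qed simp
      qed
    qed
    moreover have "(LINT w|lborel. (?W z / 2) * indicator (ball z (\<rho> z)) w) = ?W z / 2 * ((\<rho> z)\<^sup>2 * unit_disc_area)"
      using measure_disc[of "\<rho> z" z] r by simp
    moreover have "?W z / 2 * ((\<rho> z)\<^sup>2 * unit_disc_area) = \<rho> z * unit_disc_area / 200"
      using Wpos[of z] rad[OF z] by (simp add: power2_eq_square field_simps)
    ultimately have "\<rho> z * unit_disc_area / 200 \<le> (LINT w|lborel. indicator (ball z (\<rho> z)) w * ?W w)" by linarith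
    then show ?thesis using unit_disc_area_pos by (simp add: field_simps)
  qed
  have total: "(\<Sum>z\<in>T. \<rho> z) \<le> 200 / unit_disc_area * (LINT w|lborel. (\<Sum>z\<in>T. indicator (ball z (\<rho> z)) w * ?W w))"
  proof -
    have "(\<Sum>z\<in>T. \<rho> z) \<le> (\<Sum>z\<in>T. 200 / unit_disc_area * (LINT w|lborel. indicator (ball z (\<rho> z)) w * ?W w))"
      by (intro sum_mono one)
    also have "\<dots> = 200 / unit_disc_area * (LINT w|lborel. (\<Sum>z\<in>T. indicator (ball z (\<rho> z)) w * ?W w))"
      by (simp only: sum_distrib_left[symmetric] Bochner_Integration.integral_sum[OF iz])
    finally show ?thesis .
  qed
  have "(LINT w|lborel. (\<Sum>z\<in>T. indicator (ball z (\<rho> z)) w * ?W w)) \<le> (LINT w|lborel. indicator (ball 0 1) w * ?W w)"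
  proof (rule integral_mono)
    show "integrable lborel (\<lambda>w. \<Sum>z\<in>T. indicator (ball z (\<rho> z)) w * ?W w)" by (intro Bochner_Integration.integrable_sum iz)
    fix w
    have "(\<Sum>z\<in>T. indicator (ball z (\<rho> z)) w) \<le> (indicator (ball 0 1) w :: real)"
    proof (cases "\<exists>z\<in>T. w \<in> ball z (\<rho> z)")
      case True
      then obtain z where z: "z \<in> T" "w \<in> ball z (\<rho> z)" by blast
      have "(\<Sum>x\<in>T. indicator (ball x (\<rho> x)) w) = (\<Sum>x\<in>{z}. indicator (ball x (\<rho> x)) w :: real)"
      proof (rule sum.mono_neutral_right)
        show "\<forall>i\<in>T - {z}. indicator (ball i (\<rho> i)) w = (0::real)"
          using disj z unfolding pairwise_def disjnt_iff by (auto simp: indicator_def)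
      qed (use z T in auto)
      then show ?thesis using z sub[OF z(1)] by auto
    next
      case False
      then have "(\<Sum>z\<in>T. indicator (ball z (\<rho> z)) w) = (0::real)" by (intro sum.neutral) (auto simp: indicator_def)
      then show ?thesis by simp
    qed
    then show "(\<Sum>z\<in>T. indicator (ball z (\<rho> z)) w * ?W w) \<le> indicator (ball 0 1) w * ?W w"
      unfolding sum_distrib_right[symmetric] using Wpos[of w] by (intro mult_right_mono) auto
  qed (rule W(1))
  also have "\<dots> \<le> length zs * (2 * planar_riesz) + K * unit_disc_area" by (rule W(2))
  finally show ?thesis
    by (intro order_trans[OF total] mult_left_mono) (use unit_disc_area_pos in auto)
qed

lemma hausdorff1_pre_countable_UN:
  fixes A :: "'i \<Rightarrow> 'a::metric_space set"
  assumes C: "countable C" and \<delta>: "0 \<le> \<delta>"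
    and A: "\<And>i. i \<in> C \<Longrightarrow> hausdorff1_pre \<delta> (A i) \<le> ennreal (b i)" and b: "\<And>i. i \<in> C \<Longrightarrow> 0 \<le> b i"
    and sum: "\<And>T. finite T \<Longrightarrow> T \<subseteq> C \<Longrightarrow> (\<Sum>i\<in>T. b i) \<le> B"
  shows "hausdorff1_pre \<delta> (\<Union>i\<in>C. A i) \<le> ennreal B"
proof -
  let ?f = "to_nat_on C" and ?g = "from_nat_into C"
  have inv: "?g (?f i) = i" if "i \<in> C" for i using C that by simp
  define D where "D n = (if n \<in> ?f ` C then A (?g n) else {})" for n
  define r where "r n = (if n \<in> ?f ` C then b (?g n) else 0)" for n
  have "(\<Union>i\<in>C. A i) \<subseteq> (\<Union>n. D n)"
  proof
    fix x assume "x \<in> (\<Union>i\<in>C. A i)"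
    then obtain i where "i \<in> C" "x \<in> A i" by blast
    then have "x \<in> D (?f i)" by (simp add: D_def inv)
    then show "x \<in> (\<Union>n. D n)" by blast
  qed
  then have "hausdorff1_pre \<delta> (\<Union>i\<in>C. A i) \<le> hausdorff1_pre \<delta> (\<Union>n. D n)" by (rule hausdorff1_pre_mono)
  also have "\<dots> \<le> (\<Sum>n. hausdorff1_pre \<delta> (D n))" by (rule hausdorff1_pre_countably_subadditive)
  also have "\<dots> \<le> (\<Sum>n. ennreal (r n))"
  proof (rule suminf_le)
    show "hausdorff1_pre \<delta> (D n) \<le> ennreal (r n)" for n
      using A inv hausdorff1_pre_empty[OF \<delta>] by (auto simp: D_def r_def)
  qed auto
  also have "\<dots> \<le> ennreal B"
  proof (rule suminf_le_const)
    fix k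
    define T where "T = {i \<in> C. ?f i < k}"
    have inj: "inj_on ?f T" by (rule inj_on_subset[OF inj_on_to_nat_on[OF C]]) (simp add: T_def)
    have fT: "finite T" by (rule finite_imageD[OF _ inj]) (auto intro: finite_subset[of _ "{..<k}"] simp: T_def)
    have "(\<Sum>n<k. r n) = (\<Sum>n\<in>?f ` T. r n)"
      by (rule sum.mono_neutral_right) (auto simp: T_def r_def)
    also have "\<dots> = (\<Sum>i\<in>T. r (?f i))" by (rule sum.reindex[OF inj, simplified comp_def])
    also have "\<dots> = (\<Sum>i\<in>T. b i)" by (rule sum.cong) (auto simp: r_def T_def inv)
    also have "\<dots> \<le> B" by (rule sum[OF fT]) (auto simp: T_def)
    finally have "(\<Sum>n<k. r n) \<le> B" .
    moreover have "(\<Sum>n<k. ennreal (r n)) = ennreal (\<Sum>n<k. r n)"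
      by (rule sum_ennreal) (use b inv in \<open>auto simp: r_def\<close>)
    ultimately show "(\<Sum>n<k. ennreal (r n)) \<le> ennreal B" by (simp add: ennreal_leI)
  qed auto
  finally show ?thesis .
qed

section \<open>Nodal length in complex coordinates\<close>

text \<open>
  The factor \<open>20\<close> is the length bound \<open>4\<close> per radius times the enlargement \<open>5\<close> of the discs of the covering;
  \<open>4 planar_riesz\<close> accounts for at most \<open>2 L\<close> zeros of the factor, where \<open>L\<close> is the logarithm of its
  doubling, and \<open>120\<close> is the constant in the bound for its oscillation.
\<close>

definition nodal_length_constant :: real where
  "nodal_length_constant = 20 * (200 / unit_disc_area * (4 * planar_riesz + 120 * unit_disc_area))"

lemma nodal_length_constant_pos: "0 < nodal_length_constant"
  unfolding nodal_length_constant_def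
  using unit_disc_area_pos planar_riesz_nonneg by (intro mult_pos_pos divide_pos_pos add_nonneg_pos) auto

text \<open>
  The radius \<open>\<rho> z = 1 / (100 W z)\<close> is chosen so that \<open>H\<close> is nearly constant even on the disc of radius
  \<open>5 \<rho> z\<close>, as Vitali's covering lemma enlarges the selected disjoint discs by the factor \<open>5\<close>. The zeros of
  \<open>H\<close> themselves are finitely many and have length zero.
\<close>

theorem (in similarity_disc) nodal_length_le_doubling:
  assumes M: "\<And>z. z \<in> ball 0 2 \<Longrightarrow> norm (H z) \<le> M"
    and z0: "z0 \<in> ball 0 (1/4)" "0 < m" "m \<le> norm (H z0)" and "0 < \<delta>"
  shows "hausdorff1_pre \<delta> {x \<in> ball 0 (1/60). F x = 0} \<le> ennreal (nodal_length_constant * (ln (M / m) + 1))"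
proof -
  define L where "L = ln (M / m)"
  have "m \<le> M" using M[of z0] z0 by auto
  then have L: "0 \<le> L" unfolding L_def using z0(2) by (intro ln_ge_zero) (simp add: field_simps)
  have H2: "H holomorphic_on ball 0 2" by (rule holomorphic_on_subset[OF H_hol]) (use R in auto)
  obtain zs where zs: "set zs \<subseteq> ball 0 1" "real (length zs) \<le> 2 * L"
    and osc: "\<And>z w \<delta>. z \<in> ball 0 (1/60) \<Longrightarrow> z \<notin> set zs \<Longrightarrow> norm (w - z) \<le> \<delta> \<Longrightarrow>
       \<delta> * ((\<Sum>a\<leftarrow>zs. 1 / norm (z - a)) + 120 * (L + 1)) \<le> 1/20 \<Longrightarrow>
       H z \<noteq> 0 \<and> norm (H w - H z) \<le> norm (H z) / 10"
    unfolding L_def by (rule doubling_controls_oscillation[OF H2 M z0]) blast+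
  define K where "K = 120 * (L + 1)"
  have K: "120 \<le> K" using L by (simp add: K_def)
  define \<rho> where "\<rho> z = 1 / (100 * root_weight K zs z)" for z
  have W: "120 \<le> root_weight K zs z" for z
  proof -
    have "0 \<le> (\<Sum>a\<leftarrow>zs. 1 / norm (z - a))" by (intro sum_list_nonneg) auto
    then show ?thesis using K by (simp add: root_weight_def)
  qed
  have \<rho>: "0 < \<rho> z" "\<rho> z \<le> 1/100" for z
    using W[of z] by (simp_all add: \<rho>_def field_simps)
  \<comment> \<open>the condition under which the oscillation on the enlarged disc is controlled\<close>
  have \<rho>W: "5 * \<rho> z * root_weight K zs z = 1/20" for z
    using W[of z] by (simp add: \<rho>_def field_simps)
  define S where "S = {x \<in> ball 0 (1/60). F x = 0} - set zs"
  have sub1: "ball z (\<rho> z) \<subseteq> ball 0 1" and sub5: "ball z (5 * \<rho> z) \<subseteq> ball 0 R" if "z \<in> S" for z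
  proof -
    have z: "norm z < 1/60" using that by (simp add: S_def)
    show "ball z (\<rho> z) \<subseteq> ball 0 1"
      using z \<rho>[of z] by (auto simp: dist_norm ball_subset_ball_iff)
    show "ball z (5 * \<rho> z) \<subseteq> ball 0 R"
      using z \<rho>[of z] R by (auto simp: dist_norm ball_subset_ball_iff)
  qed
  obtain C where C: "countable C" "C \<subseteq> S"
     "pairwise (\<lambda>i j. disjnt (ball i (\<rho> i)) (ball j (\<rho> j))) C" "S \<subseteq> (\<Union>i\<in>C. ball i (5 * \<rho> i))"
  proof (rule Vitali_covering_lemma_balls[where S=S and K=S and a="\<lambda>z. z" and r=\<rho> and B="1/100"])
    show "S \<subseteq> (\<Union>i\<in>S. ball i (\<rho> i))" using \<rho>(1) by auto
  qed (use \<rho> in auto)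
  have piece: "hausdorff1_pre \<delta> {x \<in> ball z (5 * \<rho> z). F x = 0} \<le> ennreal (4 * (5 * \<rho> z))" if z: "z \<in> S" for z
  proof -
    have z': "z \<in> ball 0 (1/60)" "z \<notin> set zs" using z by (auto simp: S_def)
    have o: "H z \<noteq> 0 \<and> norm (H w - H z) \<le> norm (H z) / 10" if "norm (w - z) \<le> 5 * \<rho> z" for w
      by (rule osc[OF z' that]) (use \<rho>W[of z] in \<open>simp add: root_weight_def K_def\<close>)
    show ?thesis
      by (rule zeros_lipschitz_graph)
        (use o[of z] o sub5[OF z] \<rho>[of z] \<open>0 < \<delta>\<close> in \<open>auto simp: dist_norm norm_minus_commute\<close>)
  qed
  have rsum: "(\<Sum>z\<in>T. 4 * (5 * \<rho> z)) \<le> nodal_length_constant * (L + 1)" if T: "finite T" "T \<subseteq> C" for T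
  proof -
    have "(\<Sum>z\<in>T. \<rho> z) \<le> 200 / unit_disc_area * (length zs * (2 * planar_riesz) + K * unit_disc_area)"
    proof (rule disjoint_radii_sum[OF zs(1) _ T(1)])
      show "pairwise (\<lambda>z w. disjnt (ball z (\<rho> z)) (ball w (\<rho> w))) T" by (rule pairwise_subset[OF C(3) T(2)])
      have "T \<subseteq> S" using T C by auto
      then show "T \<subseteq> ball 0 1" "T \<inter> set zs = {}" by (auto simp: S_def)
      show "ball z (\<rho> z) \<subseteq> ball 0 1" if "z \<in> T" for z using sub1 that \<open>T \<subseteq> S\<close> by blast
    qed (use K in \<open>auto simp: \<rho>_def\<close>)
    also have "\<dots> \<le> 200 / unit_disc_area * ((2 * L) * (2 * planar_riesz) + 120 * (L + 1) * unit_disc_area)"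
      unfolding K_def using zs(2) planar_riesz_nonneg unit_disc_area_pos
      by (intro mult_left_mono add_right_mono mult_right_mono) auto
    also have "\<dots> \<le> 200 / unit_disc_area * ((4 * planar_riesz + 120 * unit_disc_area) * (L + 1))"
      using planar_riesz_nonneg unit_disc_area_pos by (intro mult_left_mono) (auto simp: algebra_simps)
    finally have "20 * (\<Sum>z\<in>T. \<rho> z) \<le> 20 * (200 / unit_disc_area * ((4 * planar_riesz + 120 * unit_disc_area) * (L + 1)))"
      by (intro mult_left_mono) auto
    also have "\<dots> = nodal_length_constant * (L + 1)" by (simp only: nodal_length_constant_def mult.assoc)
    finally show ?thesis by (simp add: sum_distrib_left)
  qed
  have "{x \<in> ball 0 (1/60). F x = 0} \<subseteq> set zs \<union> (\<Union>z\<in>C. {x \<in> ball z (5 * \<rho> z). F x = 0})"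
    using C(4) by (auto simp: S_def)
  then have "hausdorff1_pre \<delta> {x \<in> ball 0 (1/60). F x = 0} \<le>
      hausdorff1_pre \<delta> (set zs \<union> (\<Union>z\<in>C. {x \<in> ball z (5 * \<rho> z). F x = 0}))"
    by (rule hausdorff1_pre_mono)
  also have "\<dots> \<le> hausdorff1_pre \<delta> (set zs) + hausdorff1_pre \<delta> (\<Union>z\<in>C. {x \<in> ball z (5 * \<rho> z). F x = 0})"
    using \<open>0 < \<delta>\<close> by (intro hausdorff1_pre_Un) simp
  also have "hausdorff1_pre \<delta> (set zs) = 0"
    using \<open>0 < \<delta>\<close> by (intro hausdorff1_pre_finite_set) auto
  also have "0 + hausdorff1_pre \<delta> (\<Union>z\<in>C. {x \<in> ball z (5 * \<rho> z). F x = 0}) \<le> ennreal (nodal_length_constant * (L + 1))"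
  proof -
    have "hausdorff1_pre \<delta> (\<Union>z\<in>C. {x \<in> ball z (5 * \<rho> z). F x = 0}) \<le> ennreal (nodal_length_constant * (L + 1))"
      by (rule hausdorff1_pre_countable_UN[where b="\<lambda>z. 4 * (5 * \<rho> z)"])
        (use C piece rsum \<rho> \<open>0 < \<delta>\<close> in \<open>auto simp: less_imp_le\<close>)
    then show ?thesis by simp
  qed
  finally show ?thesis unfolding L_def .
qed

lemma (in similarity_disc) continuous_on_F: "continuous_on (ball 0 3) F"
proof -
  have "continuous_on (ball 0 3) (\<lambda>z. Re (of_real (F z)))"
    by (intro continuous_on_Re continuous_at_imp_continuous_on ballI has_wirtinger_continuous[OF F_deriv])
  then show ?thesis by simp
qed

text \<open>
  It remains to compare the doubling of \<open>H\<close> with that of \<open>F\<close>. If \<open>F\<close> has no zero in the small disc, there is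
  nothing to prove. Otherwise \<open>sup |H|\<close> on the disc of radius \<open>1/4\<close> is at least \<open>m / 8\<close>, and \<open>m\<close> is
  positive by unique continuation.
\<close>

theorem nodal_length_le_growth:
  obtains c where "0 < c" "\<And>F q P R H l s \<delta>. similarity_disc F q P R H l s \<Longrightarrow> \<exists>z\<in>ball 0 R. F z \<noteq> 0 \<Longrightarrow> 0 < \<delta> \<Longrightarrow>
    hausdorff1_pre \<delta> {x \<in> ball 0 (1/60). F x = 0} \<le>
      ennreal (c * max (ln ((SUP z\<in>ball 0 (5/2). \<bar>F z\<bar>) / (SUP z\<in>ball 0 (1/4). \<bar>F z\<bar>))) 1)"
proof -
  obtain C0 where C0: "0 \<le> C0" "\<And>F q P R H l s M z. similarity_disc F q P R H l s \<Longrightarrow>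
    (\<And>z. z \<in> ball 0 (5/2) \<Longrightarrow> \<bar>F z\<bar> \<le> M) \<Longrightarrow> 0 < M \<Longrightarrow> z \<in> ball 0 2 \<Longrightarrow> norm (H z) \<le> C0 * M"
    by (rule representation_factor_bound) blast
  define C where "C = max C0 1"
  have C: "1 \<le> C" "C0 \<le> C" by (auto simp: C_def)
  define k where "k = ln (8 * C)"
  have k: "0 \<le> k" using C by (simp add: k_def)
  show thesis
  proof (rule that[of "nodal_length_constant * (k + 2)"])
    show "0 < nodal_length_constant * (k + 2)" using k nodal_length_constant_pos by simp
    fix F q P R H l s and \<delta> :: real
    assume "similarity_disc F q P R H l s" and ex: "\<exists>z\<in>ball 0 R. F z \<noteq> 0" and \<delta>: "0 < \<delta>"
    then interpret similarity_disc F q P R H l s by simp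
    define M where "M = (SUP z\<in>ball 0 (5/2). \<bar>F z\<bar>)"
    define m where "m = (SUP z\<in>ball 0 (1/4). \<bar>F z\<bar>)"
    have "compact ((\<lambda>z. \<bar>F z\<bar>) ` cball 0 (5/2))"
      by (intro compact_continuous_image continuous_on_rabs continuous_on_subset[OF continuous_on_F]) auto
    then have bdd: "bdd_above ((\<lambda>z. \<bar>F z\<bar>) ` cball 0 (5/2))" by (intro bounded_imp_bdd_above compact_imp_bounded)
    have bM: "bdd_above ((\<lambda>z. \<bar>F z\<bar>) ` ball 0 (5/2))" and bm: "bdd_above ((\<lambda>z. \<bar>F z\<bar>) ` ball 0 (1/4))"
      by (rule bdd_above_mono[OF bdd], auto)+
    have Mle: "\<bar>F z\<bar> \<le> M" if "z \<in> ball 0 (5/2)" for z unfolding M_def by (rule cSUP_upper[OF that bM])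
    have mle: "\<bar>F z\<bar> \<le> m" if "z \<in> ball 0 (1/4)" for z unfolding m_def by (rule cSUP_upper[OF that bm])
    have mM: "m \<le> M" unfolding m_def by (rule cSUP_least) (auto intro: Mle)
    have m0: "0 < m"
    proof -
      obtain z where "z \<in> ball 0 (1/4)" "F z \<noteq> 0" using vanishing_on_small_disc ex by blast
      then show ?thesis using mle[of z] by auto
    qed
    let ?\<beta> = "ln (M / m)"
    show "hausdorff1_pre \<delta> {x \<in> ball 0 (1/60). F x = 0} \<le> ennreal (nodal_length_constant * (k + 2) * max ?\<beta> 1)"
    proof (cases "{x \<in> ball 0 (1/60). F x = 0} = {}")
      case True
      show ?thesis unfolding True by (subst hausdorff1_pre_empty) (use \<delta> in auto)
    next
      case False
      then obtain p where p: "p \<in> ball 0 (1/60)" "F p = 0" by blast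
      have "\<exists>z0\<in>ball 0 (1/4). m / 8 \<le> norm (H z0)"
      proof (rule ccontr)
        assume "\<not> ?thesis"
        then have h: "norm (H w) \<le> m / 8" if "w \<in> ball 0 (1/4)" for w using that by (auto simp: not_le less_imp_le)
        have "(SUP z\<in>ball 0 (1/4). \<bar>F z\<bar>) \<le> 2 * (m / 8) + m / 2"
        proof (rule cSUP_least)
          show "\<bar>F z\<bar> \<le> 2 * (m / 8) + m / 2" if "z \<in> ball 0 (1/4)" for z
            by (rule F_bound_by_factor[OF p that mle h])
        qed simp
        then have "m \<le> 2 * (m / 8) + m / 2" unfolding m_def[symmetric] .
        then show False using m0 by simp
      qed
      then obtain z0 where z0: "z0 \<in> ball 0 (1/4)" "m / 8 \<le> norm (H z0)" by blast
      have HM: "norm (H z) \<le> C * M" if "z \<in> ball 0 2" for z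
      proof -
        have "norm (H z) \<le> C0 * M" by (rule C0(2)[OF similarity_disc_axioms Mle _ that]) (use m0 mM in auto)
        also have "\<dots> \<le> C * M" using C m0 mM by (intro mult_right_mono) auto
        finally show ?thesis .
      qed
      have "hausdorff1_pre \<delta> {x \<in> ball 0 (1/60). F x = 0} \<le> ennreal (nodal_length_constant * (ln (C * M / (m / 8)) + 1))"
        by (rule nodal_length_le_doubling[OF HM z0(1) _ z0(2) \<delta>]) (use m0 in simp_all)
      also have "\<dots> \<le> ennreal (nodal_length_constant * ((k + 2) * max ?\<beta> 1))"
      proof (intro ennreal_leI mult_left_mono)
        have "C * M / (m / 8) = (8 * C) * (M / m)" by simp
        moreover have "ln ((8 * C) * (M / m)) = k + ?\<beta>"
          unfolding k_def using C m0 mM by (intro ln_mult_pos) auto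
        ultimately have eq: "ln (C * M / (m / 8)) = k + ?\<beta>" by (simp only:)
        have "k * 1 \<le> k * max ?\<beta> 1" using k by (intro mult_left_mono) auto
        moreover have "?\<beta> + 1 \<le> 2 * max ?\<beta> 1" by (simp add: max_def)
        ultimately show "ln (C * M / (m / 8)) + 1 \<le> (k + 2) * max ?\<beta> 1"
          unfolding eq distrib_right by linarith
      qed (use nodal_length_constant_pos in simp)
      finally show ?thesis by (simp only: mult.assoc)
    qed
  qed
qed

section \<open>Partial derivatives in the plane\<close>

definition directional_derivative_on ::
    "complex set \<Rightarrow> complex \<Rightarrow> (complex \<Rightarrow> real) \<Rightarrow> (complex \<Rightarrow> real) \<Rightarrow> bool" where
  "directional_derivative_on S u g g' \<longleftrightarrow>
     (\<forall>z\<in>S. ((\<lambda>t. g (z + of_real t * u)) has_real_derivative g' z) (at 0))"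

lemma directional_derivative_at:
  assumes "directional_derivative_on S u g g'" "z + of_real t * u \<in> S"
  shows "((\<lambda>t. g (z + of_real t * u)) has_real_derivative g' (z + of_real t * u)) (at t)"
proof -
  have "((\<lambda>s. g ((z + of_real t * u) + of_real s * u)) has_real_derivative g' (z + of_real t * u)) (at 0)"
    using assms unfolding directional_derivative_on_def by blast
  then have "((\<lambda>s. g (z + of_real (s + t) * u)) has_real_derivative g' (z + of_real t * u)) (at 0)"
    by (simp add: algebra_simps)
  then show ?thesis using DERIV_shift[of "\<lambda>t. g (z + of_real t * u)" "g' (z + of_real t * u)" 0 t] by simp
qed

text \<open>
  The sign of \<open>h\<close> is arbitrary, so that increments in all four coordinate directions are covered.
\<close>

lemma directional_mvt:
  assumes g: "directional_derivative_on S u g g'" and S: "\<And>t. \<bar>t\<bar> \<le> \<bar>h\<bar> \<Longrightarrow> z + of_real t * u \<in> S"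
  obtains \<xi> where "\<bar>\<xi>\<bar> \<le> \<bar>h\<bar>" "g (z + of_real h * u) - g z = h * g' (z + of_real \<xi> * u)"
proof (cases h "0::real" rule: linorder_cases)
  case less
  have "\<exists>\<xi>>h. \<xi> < 0 \<and> g (z + of_real 0 * u) - g (z + of_real h * u) = (0 - h) * g' (z + of_real \<xi> * u)"
    by (rule MVT2[OF less]) (rule directional_derivative_at[OF g S], use less in auto)
  then obtain \<xi> where "h < \<xi>" "\<xi> < 0" "g z - g (z + of_real h * u) = - h * g' (z + of_real \<xi> * u)" by auto
  then show thesis by (intro that[of \<xi>]) auto
next
  case greater
  have "\<exists>\<xi>>0. \<xi> < h \<and> g (z + of_real h * u) - g (z + of_real 0 * u) = (h - 0) * g' (z + of_real \<xi> * u)"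
    by (rule MVT2[OF greater]) (rule directional_derivative_at[OF g S], use greater in auto)
  then obtain \<xi> where "0 < \<xi>" "\<xi> < h" "g (z + of_real h * u) - g z = h * g' (z + of_real \<xi> * u)" by auto
  then show thesis by (intro that[of \<xi>]) auto
qed (use that[of 0] in auto)

text \<open>
  A function with continuous partial derivatives is differentiable: apply the mean value theorem first in
  the direction \<open>1\<close> and then in the direction \<open>\<i>\<close>.
\<close>

lemma has_wirtinger_from_partials:
  assumes "open S" "z \<in> S" and g1: "directional_derivative_on S 1 g g1" and g2: "directional_derivative_on S \<i> g g2"
    and c: "continuous_on S g1" "continuous_on S g2"
  shows "has_wirtinger (\<lambda>z. of_real (g z)) ((of_real (g1 z) - \<i> * of_real (g2 z)) / 2)
    ((of_real (g1 z) + \<i> * of_real (g2 z)) / 2) z"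
proof -
  have "(g has_derivative (\<lambda>h. g1 z * Re h + g2 z * Im h)) (at z)"
    unfolding has_derivative_at_alt
  proof (intro conjI allI impI)
    show "bounded_linear (\<lambda>h. g1 z * Re h + g2 z * Im h)"
      by (intro bounded_linear_add bounded_linear_compose[OF bounded_linear_mult_right bounded_linear_Re]
        bounded_linear_compose[OF bounded_linear_mult_right bounded_linear_Im])
    fix e :: real assume "e > 0"
    then have e: "e / 2 > 0" by simp
    obtain d0 where d0: "d0 > 0" "ball z d0 \<subseteq> S" using assms(1,2) open_contains_ball by blast
    obtain d1 where d1: "d1 > 0" "\<And>w. w \<in> S \<Longrightarrow> dist w z < d1 \<Longrightarrow> dist (g1 w) (g1 z) < e / 2"
      using c(1) e assms(2) unfolding continuous_on_iff by metis
    obtain d2 where d2: "d2 > 0" "\<And>w. w \<in> S \<Longrightarrow> dist w z < d2 \<Longrightarrow> dist (g2 w) (g2 z) < e / 2"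
      using c(2) e assms(2) unfolding continuous_on_iff by metis
    define d where "d = min d0 (min d1 d2)"
    show "\<exists>d>0. \<forall>y. norm (y - z) < d \<longrightarrow> norm (g y - g z - (g1 z * Re (y - z) + g2 z * Im (y - z))) \<le> e * norm (y - z)"
    proof (intro exI[of _ d] conjI allI impI)
      show "d > 0" using d0 d1 d2 by (simp add: d_def)
      fix y assume y: "norm (y - z) < d"
      define a b where "a = Re (y - z)" and "b = Im (y - z)"
      have yz: "y = z + of_real a * 1 + of_real b * \<i>" by (simp add: a_def b_def complex_eq_iff)
      have near: "z + of_real s * 1 + of_real t * \<i> \<in> S \<and> dist (z + of_real s * 1 + of_real t * \<i>) z < d"
        if "\<bar>s\<bar> \<le> \<bar>a\<bar>" "\<bar>t\<bar> \<le> \<bar>b\<bar>" for s t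
      proof -
        have "(norm (of_real s + of_real t * \<i>))\<^sup>2 \<le> (norm (y - z))\<^sup>2"
          unfolding cmod_power2 using that by (simp add: a_def b_def add_mono abs_le_square_iff)
        then have "norm (of_real s + of_real t * \<i>) \<le> norm (y - z)" by (rule power2_le_imp_le) simp
        then have "dist (z + of_real s * 1 + of_real t * \<i>) z < d" using y by (simp add: dist_norm add.assoc)
        then show ?thesis using d0 by (auto simp: d_def dist_commute subset_iff)
      qed
      obtain \<xi> where \<xi>: "\<bar>\<xi>\<bar> \<le> \<bar>a\<bar>" "g (z + of_real a * 1) - g z = a * g1 (z + of_real \<xi> * 1)"
        using directional_mvt[OF g1, of a z] near[of _ 0] by auto
      obtain \<eta> where \<eta>: "\<bar>\<eta>\<bar> \<le> \<bar>b\<bar>" "g (z + of_real a * 1 + of_real b * \<i>) - g (z + of_real a * 1) =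
          b * g2 (z + of_real a * 1 + of_real \<eta> * \<i>)"
        using directional_mvt[OF g2, of b "z + of_real a * 1"] near[of a] by auto
      have A: "\<bar>g1 (z + of_real \<xi> * 1) - g1 z\<bar> \<le> e / 2"
        using d1(2)[of "z + of_real \<xi> * 1"] near[OF \<xi>(1), of 0] by (auto simp: d_def dist_real_def)
      have B: "\<bar>g2 (z + of_real a * 1 + of_real \<eta> * \<i>) - g2 z\<bar> \<le> e / 2"
        using d2(2)[of "z + of_real a * 1 + of_real \<eta> * \<i>"] near[OF _ \<eta>(1), of a] by (auto simp: d_def dist_real_def)
      have "g y - g z - (g1 z * a + g2 z * b) =
          a * (g1 (z + of_real \<xi> * 1) - g1 z) + b * (g2 (z + of_real a * 1 + of_real \<eta> * \<i>) - g2 z)"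
        using \<xi>(2) \<eta>(2) unfolding yz by (simp add: algebra_simps)
      also have "\<bar>\<dots>\<bar> \<le> \<bar>a\<bar> * (e / 2) + \<bar>b\<bar> * (e / 2)"
        by (rule order_trans[OF abs_triangle_ineq], unfold abs_mult)
          (intro add_mono mult_left_mono A B abs_ge_zero)
      also have "\<dots> \<le> norm (y - z) * (e / 2) + norm (y - z) * (e / 2)"
        unfolding a_def b_def using \<open>e > 0\<close> by (intro add_mono mult_right_mono abs_Re_le_cmod abs_Im_le_cmod) auto
      finally show "norm (g y - g z - (g1 z * Re (y - z) + g2 z * Im (y - z))) \<le> e * norm (y - z)"
        by (simp add: a_def b_def mult.commute)
    qed
  qed
  then have "((\<lambda>z. of_real (g z) :: complex) has_derivative (\<lambda>h. of_real (g1 z * Re h + g2 z * Im h))) (at z)"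
    by (rule bounded_linear.has_derivative[OF bounded_linear_of_real])
  also have "(\<lambda>h. of_real (g1 z * Re h + g2 z * Im h)) = (\<lambda>h. (of_real (g1 z) - \<i> * of_real (g2 z)) / 2 * h +
      (of_real (g1 z) + \<i> * of_real (g2 z)) / 2 * cnj h)"
    by (rule ext) (simp add: complex_eq_iff field_simps)
  finally show ?thesis by (simp add: has_wirtinger_def)
qed

text \<open>
  The mean value theorem, first in the direction \<open>u\<close> for the difference in the direction \<open>v\<close>, and then in
  the direction \<open>v\<close>. The left-hand side is symmetric in \<open>u\<close> and \<open>v\<close>.
\<close>

lemma mixed_difference:
  assumes gu: "directional_derivative_on S u g gu" and guv: "directional_derivative_on S v gu guv"
    and S: "\<And>s t. \<bar>s\<bar> \<le> \<bar>h\<bar> \<Longrightarrow> \<bar>t\<bar> \<le> \<bar>h\<bar> \<Longrightarrow> z + of_real s * u + of_real t * v \<in> S"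
  obtains s t where "\<bar>s\<bar> \<le> \<bar>h\<bar>" "\<bar>t\<bar> \<le> \<bar>h\<bar>"
    "g (z + of_real h * u + of_real h * v) - g (z + of_real h * u) - g (z + of_real h * v) + g z =
      h * (h * guv (z + of_real s * u + of_real t * v))"
proof -
  have D: "directional_derivative_on {w. w \<in> S \<and> w + of_real h * v \<in> S} u
      (\<lambda>w. g (w + of_real h * v) - g w) (\<lambda>w. gu (w + of_real h * v) - gu w)"
    unfolding directional_derivative_on_def
  proof (intro ballI DERIV_diff)
    fix w assume w: "w \<in> {w. w \<in> S \<and> w + of_real h * v \<in> S}"
    show "((\<lambda>t. g (w + of_real t * u)) has_real_derivative gu w) (at 0)"
      using gu w unfolding directional_derivative_on_def by blast
    have "((\<lambda>t. g ((w + of_real h * v) + of_real t * u)) has_real_derivative gu (w + of_real h * v)) (at 0)"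
      using gu w unfolding directional_derivative_on_def by blast
    then show "((\<lambda>t. g (w + of_real t * u + of_real h * v)) has_real_derivative gu (w + of_real h * v)) (at 0)"
      by (simp add: add_ac)
  qed
  obtain s where s: "\<bar>s\<bar> \<le> \<bar>h\<bar>"
    "(g (z + of_real h * u + of_real h * v) - g (z + of_real h * u)) - (g (z + of_real h * v) - g z) =
     h * (gu (z + of_real s * u + of_real h * v) - gu (z + of_real s * u))"
    using directional_mvt[OF D, of h z] S[of _ 0] S[of _ h] by auto
  obtain t where t: "\<bar>t\<bar> \<le> \<bar>h\<bar>"
    "gu (z + of_real s * u + of_real h * v) - gu (z + of_real s * u) = h * guv (z + of_real s * u + of_real t * v)"
    using directional_mvt[OF guv, of h "z + of_real s * u"] S[OF s(1)] by auto
  show thesis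
    by (rule that[OF s(1) t(1)]) (use s(2) t(2) in auto)
qed

text \<open>
  Schwarz's theorem. It makes the imaginary part of \<open>4 \<partial>P/\<partial>zbar\<close> vanish.
\<close>

lemma mixed_partials_eq:
  assumes "open S" "z \<in> S"
    and g1: "directional_derivative_on S 1 g g1" and g12: "directional_derivative_on S \<i> g1 g12"
    and g2: "directional_derivative_on S \<i> g g2" and g21: "directional_derivative_on S 1 g2 g21"
    and c: "continuous_on S g12" "continuous_on S g21"
  shows "g12 z = g21 z"
proof -
  have "\<bar>g12 z - g21 z\<bar> \<le> 0 + e" if "e > 0" for e
  proof -
    have e: "e / 2 > 0" using that by simp
    obtain d0 where d0: "d0 > 0" "ball z d0 \<subseteq> S" using assms(1,2) open_contains_ball by blast
    obtain d1 where d1: "d1 > 0" "\<And>w. w \<in> S \<Longrightarrow> dist w z < d1 \<Longrightarrow> dist (g12 w) (g12 z) < e / 2"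
      using c(1) e assms(2) unfolding continuous_on_iff by metis
    obtain d2 where d2: "d2 > 0" "\<And>w. w \<in> S \<Longrightarrow> dist w z < d2 \<Longrightarrow> dist (g21 w) (g21 z) < e / 2"
      using c(2) e assms(2) unfolding continuous_on_iff by metis
    define d where "d = min d0 (min d1 d2)"
    have d: "d > 0" using d0 d1 d2 by (simp add: d_def)
    define h where "h = d / 3"
    have h: "h > 0" using d by (simp add: h_def)
    have near: "z + of_real s * 1 + of_real t * \<i> \<in> S \<and> dist (z + of_real s * 1 + of_real t * \<i>) z < d"
      if "\<bar>s\<bar> \<le> \<bar>h\<bar>" "\<bar>t\<bar> \<le> \<bar>h\<bar>" for s t
    proof -
      have "norm (of_real s + of_real t * \<i>) \<le> \<bar>s\<bar> + \<bar>t\<bar>"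
        using norm_triangle_ineq[of "of_real s" "of_real t * \<i>"] by (simp add: norm_mult)
      also have "\<dots> < d" using that h by (simp add: h_def)
      finally have "dist (z + of_real s * 1 + of_real t * \<i>) z < d" by (simp add: dist_norm add.assoc)
      then show ?thesis using d0 by (auto simp: d_def dist_commute subset_iff)
    qed
    have near': "z + of_real t * \<i> + of_real s * 1 \<in> S" if "\<bar>t\<bar> \<le> \<bar>h\<bar>" "\<bar>s\<bar> \<le> \<bar>h\<bar>" for s t
      using near[OF that(2,1)] by (simp add: add_ac)
    obtain s t where st: "\<bar>s\<bar> \<le> \<bar>h\<bar>" "\<bar>t\<bar> \<le> \<bar>h\<bar>"
      "g (z + of_real h * 1 + of_real h * \<i>) - g (z + of_real h * 1) - g (z + of_real h * \<i>) + g z =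
        h * (h * g12 (z + of_real s * 1 + of_real t * \<i>))"
      by (rule mixed_difference[OF g1 g12, of h z]) (use near in blast)+
    obtain t' s' where st': "\<bar>t'\<bar> \<le> \<bar>h\<bar>" "\<bar>s'\<bar> \<le> \<bar>h\<bar>"
      "g (z + of_real h * \<i> + of_real h * 1) - g (z + of_real h * \<i>) - g (z + of_real h * 1) + g z =
        h * (h * g21 (z + of_real t' * \<i> + of_real s' * 1))"
      by (rule mixed_difference[OF g2 g21, of h z]) (use near' in blast)+
    define p where "p = z + of_real s * 1 + of_real t * \<i>"
    define p' where "p' = z + of_real s' * 1 + of_real t' * \<i>"
    have p: "p \<in> S" "dist p z < d" and p': "p' \<in> S" "dist p' z < d"
      using near[OF st(1,2)] near[OF st'(2,1)] by (simp_all add: p_def p'_def)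
    have "z + of_real h * \<i> + of_real h * 1 = z + of_real h * 1 + of_real h * \<i>"
      "z + of_real t' * \<i> + of_real s' * 1 = p'" by (simp_all add: p'_def)
    then have "h * (h * g12 p) = h * (h * g21 p')"
      using st(3) st'(3) unfolding p_def[symmetric] by (simp only:)
    then have "g12 p = g21 p'" using h by simp
    moreover have "\<bar>g12 p - g12 z\<bar> < e / 2" "\<bar>g21 p' - g21 z\<bar> < e / 2"
      using d1(2)[OF p(1)] d2(2)[OF p'(1)] p(2) p'(2) by (simp_all add: d_def dist_real_def)
    ultimately show ?thesis by linarith
  qed
  then have "\<bar>g12 z - g21 z\<bar> \<le> 0" by (rule field_le_epsilon)
  then show ?thesis by simp
qed

section \<open>Transfer to the Euclidean plane\<close>

definition to_plane :: "complex \<Rightarrow> real^2" where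
  "to_plane z = (\<chi> i. if i = 1 then Re z else Im z)"

lemma to_plane_nth [simp]: "vec_nth (to_plane z) 1 = Re z" "vec_nth (to_plane z) 2 = Im z"
  by (simp_all add: to_plane_def)

lemma norm_to_plane [simp]: "norm (to_plane z) = norm z"
  by (simp add: norm_vec_def L2_set_def sum_2 cmod_def)

lemma to_plane_diff: "to_plane z - to_plane w = to_plane (z - w)"
  by (simp add: vec_eq_iff forall_2)

lemma dist_to_plane [simp]: "dist (to_plane z) (to_plane w) = dist z w"
  by (simp add: dist_norm to_plane_diff)

lemma to_plane_surj: "\<exists>z. x = to_plane z"
  by (rule exI[of _ "Complex (vec_nth x 1) (vec_nth x 2)"]) (simp add: vec_eq_iff forall_2)

lemma ball_to_plane: "ball 0 r = to_plane ` ball 0 r"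
proof (intro equalityI subsetI)
  fix x :: "real^2" assume x: "x \<in> ball 0 r"
  obtain z where "x = to_plane z" using to_plane_surj by blast
  with x show "x \<in> to_plane ` ball 0 r" by auto
qed auto

lemma to_plane_line:
  "to_plane z + t *\<^sub>R axis 1 1 = to_plane (z + of_real t * 1)"
  "to_plane z + t *\<^sub>R axis 2 1 = to_plane (z + of_real t * \<i>)"
  by (simp_all add: vec_eq_iff forall_2 axis_def)

lemma Basis_plane: "(Basis :: (real^2) set) = {axis 1 1, axis 2 1}"
  by (auto simp: Basis_vec_def UNIV_2)

lemma axes_distinct: "axis 1 1 \<noteq> (axis 2 1 :: real^2)"
  by (simp add: axis_eq_axis)

lemma continuous_on_to_plane: "continuous_on S to_plane"
  unfolding continuous_on_iff by auto

lemma continuous_on_compose_to_plane: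
  "continuous_on (ball 0 r) f \<Longrightarrow> continuous_on (ball 0 r) (\<lambda>z. f (to_plane z))"
  by (rule continuous_on_compose2[OF _ continuous_on_to_plane]) auto

lemma directional_derivative_to_plane:
  assumes "\<And>x. x \<in> ball 0 r \<Longrightarrow> (\<lambda>t. f (x + t *\<^sub>R b)) differentiable (at 0)"
    and line: "\<And>z t. to_plane z + t *\<^sub>R b = to_plane (z + of_real t * u)"
  shows "directional_derivative_on (ball 0 r) u (\<lambda>z. f (to_plane z)) (\<lambda>z. partial_deriv b f (to_plane z))"
  unfolding directional_derivative_on_def
proof
  fix z :: complex assume "z \<in> ball 0 r"
  then have "(\<lambda>t. f (to_plane z + t *\<^sub>R b)) differentiable (at 0)" by (intro assms(1)) simp
  then have "((\<lambda>t. f (to_plane z + t *\<^sub>R b)) has_real_derivative partial_deriv b f (to_plane z)) (at 0)"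
    unfolding partial_deriv_def by (simp add: DERIV_deriv_iff_real_differentiable)
  then show "((\<lambda>t. f (to_plane (z + of_real t * u))) has_real_derivative partial_deriv b f (to_plane z)) (at 0)"
    by (simp only: line)
qed

lemma Ck_on_plane_partials:
  fixes f :: "real^2 \<Rightarrow> real"
  assumes "Ck_on (Suc k) f (ball 0 r)"
  shows "directional_derivative_on (ball 0 r) 1 (\<lambda>z. f (to_plane z)) (\<lambda>z. partial_deriv (axis 1 1) f (to_plane z))"
    "directional_derivative_on (ball 0 r) \<i> (\<lambda>z. f (to_plane z)) (\<lambda>z. partial_deriv (axis 2 1) f (to_plane z))"
    "Ck_on k (partial_deriv (axis 1 1) f) (ball 0 r)" "Ck_on k (partial_deriv (axis 2 1) f) (ball 0 r)"
  using assms
  by (auto simp: Basis_plane to_plane_line intro!: directional_derivative_to_plane)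

lemma Ck_on_imp_continuous: "Ck_on k f S \<Longrightarrow> continuous_on S f"
  by (cases k) auto

text \<open>
  An isometry maps coverings to coverings of the same diameters.
\<close>

lemma hausdorff1_pre_to_plane: "hausdorff1_pre \<delta> (to_plane ` A) \<le> hausdorff1_pre \<delta> A"
  unfolding hausdorff1_pre_def[of \<delta> A]
proof (rule INF_greatest)
  fix C :: "nat \<Rightarrow> complex set"
  assume C: "C \<in> {C. A \<subseteq> (\<Union>i. C i) \<and> (\<forall>i. bounded (C i) \<and> diameter (C i) \<le> \<delta>)}"
  have dia: "diameter (to_plane ` C i) \<le> diameter (C i)" for i
  proof (cases "C i = {}")
    case False
    have bi: "bounded (C i)" using C by simp
    have "diameter (to_plane ` C i) = (SUP (x, y) \<in> to_plane ` C i \<times> to_plane ` C i. dist x y)"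
      using False by (simp add: diameter_def)
    also have "\<dots> \<le> diameter (C i)"
      by (rule cSUP_least) (use False in \<open>auto intro: diameter_bounded_bound[OF bi]\<close>)
    finally show ?thesis .
  qed simp
  have bd: "bounded (to_plane ` C i)" for i
  proof -
    have "bounded (C i)" using C by simp
    then obtain a where "\<And>x. x \<in> C i \<Longrightarrow> norm x \<le> a" by (auto simp: bounded_iff)
    then show ?thesis by (auto simp: bounded_iff)
  qed
  have "hausdorff1_pre \<delta> (to_plane ` A) \<le> (\<Sum>i. ennreal (diameter (to_plane ` C i)))"
  proof (rule hausdorff1_pre_le[OF _ bd])
    have "A \<subseteq> (\<Union>i. C i)" using C by simp
    then show "to_plane ` A \<subseteq> (\<Union>i. to_plane ` C i)" by blast
    show "diameter (to_plane ` C i) \<le> \<delta>" for i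
      by (rule order_trans[OF dia]) (use C in simp)
  qed
  also have "\<dots> \<le> (\<Sum>i. ennreal (diameter (C i)))"
    by (intro suminf_le ennreal_leI dia) auto
  finally show "hausdorff1_pre \<delta> (to_plane ` A) \<le> (\<Sum>i. ennreal (diameter (C i)))" .
qed

text \<open>
  With \<open>P = (F\<^sub>x - \<i> F\<^sub>y) / 2\<close>, the derivative \<open>\<partial>P/\<partial>zbar\<close> is a quarter of the Laplacian of \<open>F\<close>.
\<close>

lemma plane_to_schroedinger_disc:
  fixes F q :: "real^2 \<Rightarrow> real"
  assumes q: "smooth_on q (ball 0 3)" "\<And>x. x \<in> ball 0 3 \<Longrightarrow> \<bar>q x\<bar> \<le> 1"
    and F: "schroedinger_solution q F (ball 0 3)"
  obtains P where "schroedinger_disc (\<lambda>z. F (to_plane z)) (\<lambda>z. q (to_plane z)) P"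
proof -
  have q1: "Ck_on (Suc 0) q (ball 0 3)" using q(1) unfolding smooth_on_def by blast
  have F2: "Ck_on (Suc (Suc 0)) F (ball 0 3)" using F unfolding schroedinger_solution_def numeral_2_eq_2 by blast
  let ?f = "\<lambda>z. F (to_plane z)"
  let ?F1 = "partial_deriv (axis 1 1) F" and ?F2 = "partial_deriv (axis 2 1) F"
  note d = Ck_on_plane_partials[OF F2]
  note d1 = Ck_on_plane_partials[OF d(3)] and d2 = Ck_on_plane_partials[OF d(4)]
  note cont = continuous_on_compose_to_plane[OF Ck_on_imp_continuous]
  define P where "P z = (of_real (?F1 (to_plane z)) - \<i> * of_real (?F2 (to_plane z))) / 2" for z
  have Fd: "has_wirtinger (\<lambda>z. of_real (?f z)) (P z) (cnj (P z)) z" if "z \<in> ball 0 3" for z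
    using has_wirtinger_from_partials[OF open_ball that d(1,2) cont[OF d(3)] cont[OF d(4)]]
    by (simp add: P_def)
  let ?F11 = "\<lambda>z. partial_deriv (axis 1 1) ?F1 (to_plane z)" and ?F12 = "\<lambda>z. partial_deriv (axis 2 1) ?F1 (to_plane z)"
  let ?F21 = "\<lambda>z. partial_deriv (axis 1 1) ?F2 (to_plane z)" and ?F22 = "\<lambda>z. partial_deriv (axis 2 1) ?F2 (to_plane z)"
  define A where "A z = ((of_real (?F11 z) - \<i> * of_real (?F12 z)) / 2 - \<i> * ((of_real (?F21 z) - \<i> * of_real (?F22 z)) / 2)) / 2" for z
  define B where "B z = ((of_real (?F11 z) + \<i> * of_real (?F12 z)) / 2 - \<i> * ((of_real (?F21 z) + \<i> * of_real (?F22 z)) / 2)) / 2" for z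
  have Pd: "has_wirtinger P (A z) (B z) z" if "z \<in> ball 0 3" for z
  proof -
    note w1 = has_wirtinger_from_partials[OF open_ball that d1(1,2) cont[OF d1(3)] cont[OF d1(4)]]
    note w2 = has_wirtinger_from_partials[OF open_ball that d2(1,2) cont[OF d2(3)] cont[OF d2(4)]]
    note w = has_wirtinger_mult[OF has_wirtinger_const[of "1/2"] has_wirtinger_diff[OF w1
        has_wirtinger_mult[OF has_wirtinger_const[of \<i>] w2]]]
    have "P = (\<lambda>z. 1 / 2 * (of_real (?F1 (to_plane z)) - \<i> * of_real (?F2 (to_plane z))))"
      by (simp add: P_def fun_eq_iff)
    then show ?thesis
      by (simp only:) (rule has_wirtinger_eq_rhs[OF w], simp_all add: A_def B_def)
  qed
  have mixed: "?F12 z = ?F21 z" if "z \<in> ball 0 3" for z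
    by (rule mixed_partials_eq[OF open_ball that d(1) d1(2) d(2) d2(1) cont[OF d1(4)] cont[OF d2(3)]])
  have Bz: "B z = of_real (- q (to_plane z) * F (to_plane z) / 4)" if z: "z \<in> ball 0 3" for z
  proof -
    have "to_plane z \<in> ball 0 3" using z by simp
    then have "laplacian F (to_plane z) + q (to_plane z) * F (to_plane z) = 0"
      using F unfolding schroedinger_solution_def by blast
    then have "?F11 z + ?F22 z = - q (to_plane z) * F (to_plane z)"
      using axes_distinct by (simp add: laplacian_def Basis_plane)
    moreover have "B z = of_real ((?F11 z + ?F22 z) / 4)"
      unfolding B_def mixed[OF z] by (simp add: complex_eq_iff)
    ultimately show ?thesis by simp
  qed
  show thesis
  proof (rule that[of P], unfold_locales)
    show "C1_on (ball 0 3) (\<lambda>z. of_real (q (to_plane z)))"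
    proof -
      note p = Ck_on_plane_partials[OF q1]
      show ?thesis
        by (rule C1_onI[OF _ _ has_wirtinger_from_partials[OF open_ball _ p(1,2) cont[OF p(3)] cont[OF p(4)]]])
          (auto intro!: continuous_intros cont[OF p(3)] cont[OF p(4)])
    qed
    show "\<bar>q (to_plane z)\<bar> \<le> 1" if "z \<in> ball 0 3" for z using q(2) that by simp
    show "has_wirtinger (\<lambda>z. of_real (?f z)) (P z) (cnj (P z)) z" if "z \<in> ball 0 3" for z by (rule Fd[OF that])
    show "C1_on (ball 0 3) P"
    proof (rule C1_onI[of _ A B])
      show "continuous_on (ball 0 3) A" "continuous_on (ball 0 3) B"
        unfolding A_def B_def
        by (intro continuous_intros cont[OF d1(3)] cont[OF d1(4)] cont[OF d2(3)] cont[OF d2(4)]; simp)+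
    qed (rule Pd)
    show "\<exists>A. has_wirtinger P A (of_real (- q (to_plane z) * F (to_plane z) / 4)) z" if "z \<in> ball 0 3" for z
      using Pd[OF that] Bz[OF that] by metis
  qed
qed

theorem theorem2p1p1:
  shows "\<exists>\<epsilon>\<^sub>0 c\<^sub>3 :: real. \<epsilon>\<^sub>0 > 0 \<and> c\<^sub>3 > 0 \<and>
    (\<forall>(F :: real^2 \<Rightarrow> real) (q :: real^2 \<Rightarrow> real).
       (\<exists>x\<in>ball 0 3. F x \<noteq> 0) \<and>
       smooth_on q (ball 0 3) \<and>
       bdd_above ((\<lambda>x. \<bar>q x\<bar>) ` ball 0 3) \<and>
       (SUP x\<in>ball 0 3. \<bar>q x\<bar>) < \<epsilon>\<^sub>0 \<and>
       schroedinger_solution q F (ball 0 3)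
       \<longrightarrow> hausdorff1 ({p \<in> ball 0 3. F p = 0} \<inter> ball 0 (1/60))
             \<le> ennreal (c\<^sub>3 * max (growth_exponent F) 1))"
proof -
  obtain c where c: "0 < c" "\<And>F q P R H l s \<delta>. similarity_disc F q P R H l s \<Longrightarrow> \<exists>z\<in>ball 0 R. F z \<noteq> 0 \<Longrightarrow> 0 < \<delta> \<Longrightarrow>
    hausdorff1_pre \<delta> {x \<in> ball 0 (1/60). F x = 0} \<le>
      ennreal (c * max (ln ((SUP z\<in>ball 0 (5/2). \<bar>F z\<bar>) / (SUP z\<in>ball 0 (1/4). \<bar>F z\<bar>))) 1)"
    by (rule nodal_length_le_growth) blast
  \<comment> \<open>small enough for the Riccati iteration to contract and for \<open>|s| \<le> 1/10\<close>\<close>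
  define \<Lambda> where "\<Lambda> = 1 / (10 * (disc_constant + 1))"
  define \<epsilon> where "\<epsilon> = min 1 (2 * \<Lambda> / (disc_constant + 1))"
  have K: "0 \<le> disc_constant" by (rule disc_constant_nonneg)
  have \<Lambda>: "0 < \<Lambda>" "\<Lambda> \<le> 1/10" "disc_constant * \<Lambda> \<le> 1/10"
    using K by (simp_all add: \<Lambda>_def field_simps)
  have \<epsilon>: "0 < \<epsilon>" "\<epsilon> \<le> 1" using \<Lambda> K by (simp_all add: \<epsilon>_def)
  have "disc_constant * \<epsilon> \<le> (disc_constant + 1) * (2 * \<Lambda> / (disc_constant + 1))"
    using K \<Lambda> \<epsilon> by (intro mult_mono) (auto simp: \<epsilon>_def)
  then have K\<epsilon>: "disc_constant * (\<epsilon> / 4) \<le> \<Lambda> / 2" using K by simp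
  show ?thesis
  proof (rule exI[of _ \<epsilon>], rule exI[of _ c], intro conjI allI impI)
    show "\<epsilon> > 0" by (fact \<epsilon>(1))
    show "c > 0" by (fact c(1))
    fix F q :: "real^2 \<Rightarrow> real"
    assume asm: "(\<exists>x\<in>ball 0 3. F x \<noteq> 0) \<and> smooth_on q (ball 0 3) \<and> bdd_above ((\<lambda>x. \<bar>q x\<bar>) ` ball 0 3) \<and>
       (SUP x\<in>ball 0 3. \<bar>q x\<bar>) < \<epsilon> \<and> schroedinger_solution q F (ball 0 3)"
    have q\<epsilon>: "\<bar>q x\<bar> \<le> \<epsilon>" if "x \<in> ball 0 3" for x
      using cSUP_upper[OF that, of "\<lambda>x. \<bar>q x\<bar>"] asm by auto
    obtain P where "schroedinger_disc (\<lambda>z. F (to_plane z)) (\<lambda>z. q (to_plane z)) P"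
      by (rule plane_to_schroedinger_disc[of q F]) (use asm q\<epsilon> \<epsilon> in \<open>auto intro: order_trans\<close>)
    then interpret schroedinger_disc "\<lambda>z. F (to_plane z)" "\<lambda>z. q (to_plane z)" P .
    obtain x0 where x0: "x0 \<in> ball 0 3" "F (to_plane x0) \<noteq> 0" using asm unfolding ball_to_plane by auto
    \<comment> \<open>the disc of radius \<open>R\<close> must contain a point at which \<open>F\<close> does not vanish\<close>
  define R where "R = max (29/10) ((norm x0 + 3) / 2)"
    have R: "5/2 < R" "R < 3" "x0 \<in> ball 0 R" using x0 by (auto simp: R_def max_def)
    obtain H l s where H: "H holomorphic_on ball 0 R"
      "\<And>z. z \<in> ball 0 R \<Longrightarrow> norm (l z) \<le> \<Lambda>" "\<And>z. z \<in> ball 0 R \<Longrightarrow> norm (s z) \<le> 1/10"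
      "\<And>z. z \<in> ball 0 R \<Longrightarrow> P z - l z * of_real (F (to_plane z)) = exp (s z) * H z"
      by (rule similarity_representation[OF \<Lambda> K\<epsilon>, of R])
        (use R q\<epsilon> \<epsilon> in auto)
    have sim: "similarity_disc (\<lambda>z. F (to_plane z)) (\<lambda>z. q (to_plane z)) P R H l s"
    proof unfold_locales
      show "norm (l z) \<le> 1/10" if "z \<in> ball 0 R" for z
        by (rule order_trans[OF H(2)[OF that] \<Lambda>(2)])
    qed (use R H in auto)
    have growth: "growth_exponent F = ln ((SUP z\<in>ball 0 (5/2). \<bar>F (to_plane z)\<bar>) / (SUP z\<in>ball 0 (1/4). \<bar>F (to_plane z)\<bar>))"
      unfolding growth_exponent_def ball_to_plane image_image ..
    have sub: "{p \<in> ball 0 3. F p = 0} \<inter> ball 0 (1/60) \<subseteq> to_plane ` {z \<in> ball 0 (1/60). F (to_plane z) = 0}"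
      unfolding ball_to_plane[of "1/60"] by auto
    show "hausdorff1 ({p \<in> ball 0 3. F p = 0} \<inter> ball 0 (1/60)) \<le> ennreal (c * max (growth_exponent F) 1)"
      unfolding hausdorff1_def
    proof (rule SUP_least)
      fix \<delta> :: real assume "\<delta> \<in> {0<..}"
      then have \<delta>: "0 < \<delta>" by simp
      have "hausdorff1_pre \<delta> ({p \<in> ball 0 3. F p = 0} \<inter> ball 0 (1/60)) \<le>
          hausdorff1_pre \<delta> (to_plane ` {z \<in> ball 0 (1/60). F (to_plane z) = 0})"
        by (rule hausdorff1_pre_mono[OF sub])
      also have "\<dots> \<le> hausdorff1_pre \<delta> {z \<in> ball 0 (1/60). F (to_plane z) = 0}"
        by (rule hausdorff1_pre_to_plane)
      also have "\<dots> \<le> ennreal (c * max (growth_exponent F) 1)"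
        unfolding growth by (rule c(2)[OF sim _ \<delta>]) (use x0 R in auto)
      finally show "hausdorff1_pre \<delta> ({p \<in> ball 0 3. F p = 0} \<inter> ball 0 (1/60)) \<le> ennreal (c * max (growth_exponent F) 1)" .
    qed
  qed
qed

end
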